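(* Let $1\le p\le2$, $\frac1p+\frac1q=1$, and let $f\in\mathcal{B}^p_{\mathrm{slice}}(\mathbb{R}^{n+1}_+)$. Then for every $I\in\mathbb{S}$ there exists a function $g_I\in L^q\big((-\infty,0),(-w)^{-q/p}dw\big)$ with values in $\mathbb{R}_n$ such that for every $\mathbf{x}=u+Iv$ with $u>0$, $v\in\mathbb{R}$, $$f(\mathbf{x})=\frac{1}{\sqrt{2\pi}}\int_{-\infty}^{0}e^{\mathbf{x}w}g_I(w)\,dw.$$ Moreover, for $1<p\le2$, $$\left[\int_{-\infty}^{0}\left(\frac{1}{-pw}\right)^{q/p}|g_I(w)|^q\,dw\right]^{1/q}\le\|f\|_{\mathcal{B}^p_{\mathrm{slice}}(\mathbb{R}^{n+1}_+)}<\infty,$$ and for $p=1$, $$\sup_{w\in(-\infty,0)}\frac{|g_I(w)|}{-w}\le\|f\|_{\mathcal{B}^1_{\mathrm{slice}}(\mathbb{R}^{n+1}_+)}<\infty.$$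
   Context: $\mathbb{R}_n$ is the real Clifford algebra generated by $\mathbf{e}_1,\dots,\mathbf{e}_n$ with $\mathbf{e}_r\mathbf{e}_s+\mathbf{e}_s\mathbf{e}_r=-2\delta_{rs}$; its elements are $a=\sum_A a_A\mathbf{e}_A$ ($a_A\in\mathbb{R}$, $A\subseteq\{1,\dots,n\}$ ordered, $\mathbf{e}_A$ the corresponding ordered product, $\mathbf{e}_\varnothing=1$), with norm $|a|=(\sum_A a_A^2)^{1/2}$. $\mathbb{R}^{n+1}$ is identified with the set of paravectors $x_0+x_1\mathbf{e}_1+\dots+x_n\mathbf{e}_n$. $\mathbb{S}=\{x_1\mathbf{e}_1+\dots+x_n\mathbf{e}_n:\ x_1^2+\dots+x_n^2=1\}$, so $I^2=-1$ for $I\in\mathbb{S}$; $L_I=\mathbb{R}+I\mathbb{R}\cong\mathbb{C}$. For $U\subseteq\mathbb{R}^{n+1}$ open, a real differentiable $f:U\to\mathbb{R}_n$ is left slice monogenic, written $f\in\mathcal{SM}_l(U)$, if for every $I\in\mathbb{S}$, $\frac12\left(\frac{\partial}{\partial u}+I\frac{\partial}{\partial v}\right)f(u+Iv)=0$ on $U\cap L_I$. $\mathbb{R}^{n+1}_+=\{u+Iv:\ u>0,\ v\in\mathbb{R},\ I\in\mathbb{S}\}$. For $1\le p<\infty$, the slice monogenic Bergman space $\mathcal{B}^p_{\mathrm{slice}}(\mathbb{R}^{n+1}_+)$ is the set of $f\in\mathcal{SM}_l(\mathbb{R}^{n+1}_+)$ with $$\|f\|^p_{\mathcal{B}^p_{\mathrm{slice}}(\mathbb{R}^{n+1}_+)}=\sup_{I\in\mathbb{S}}\int_0^\infty\int_{-\infty}^{\infty}|f(u+Iv)|^p\,dv\,du<\infty.$$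 When $p=1$ ($q=\infty$), membership of $g_I$ in the weighted space means that $g_I(w)/(-w)$ is essentially bounded on $(-\infty,0)$, and the supremum is an essential supremum. *)

theory Defs
  imports "HOL-Analysis.Analysis" "HOL-Probability.Essential_Supremum"
begin

section \<open>The real Clifford algebra\<close>

text \<open>
  The generators are indexed by a finite linearly ordered type \<open>'n\<close>, so \<open>n = CARD('n)\<close>.  An element
  is its family of coordinates with respect to the basis \<open>e\<^sub>A\<close>, \<open>A\<close> a subset of the index type; the
  library norm on this vector type is then the Euclidean norm of the coordinates.  The
  componentwise product that the library puts on \<open>vec\<close> is never used.
\<close>

type_synonym 'n clifford = "(real, 'n set) vec"

text \<open>
  Sorting the word \<open>e\<^sub>A e\<^sub>B\<close> costs one sign for every pair \<open>a > b\<close>, and each square \<open>e\<^sub>a e\<^sub>a = -1\<close>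
  with \<open>a \<in> A \<inter> B\<close> costs another one.
\<close>

definition blade_sign :: "'n::{finite,linorder} set \<Rightarrow> 'n set \<Rightarrow> real" where
  "blade_sign A B = (-1) ^ card {(a, b). a \<in> A \<and> b \<in> B \<and> b \<le> a}"

definition blade :: "'n::{finite,linorder} set \<Rightarrow> 'n clifford" where
  "blade A = axis A 1"

definition clifford_mult :: "'n::{finite,linorder} clifford \<Rightarrow> 'n clifford \<Rightarrow> 'n clifford"
    (infixl "\<odot>" 70) where
  "a \<odot> b = (\<Sum>A\<in>UNIV. \<Sum>B\<in>UNIV. (a $ A * b $ B * blade_sign A B) *\<^sub>R blade (sym_diff A B))"

abbreviation clifford_one :: "'n::{finite,linorder} clifford" where
  "clifford_one \<equiv> blade {}"

abbreviation gen :: "'n::{finite,linorder} \<Rightarrow> 'n clifford" where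
  "gen r \<equiv> blade {r}"

primrec clifford_power :: "'n::{finite,linorder} clifford \<Rightarrow> nat \<Rightarrow> 'n clifford" where
  "clifford_power a 0 = clifford_one"
| "clifford_power a (Suc k) = a \<odot> clifford_power a k"

definition clifford_exp :: "'n::{finite,linorder} clifford \<Rightarrow> 'n clifford" where
  "clifford_exp a = (\<Sum>k. (1 / fact k) *\<^sub>R clifford_power a k)"

text \<open>
  The following facts confirm that \<open>\<odot>\<close> is the product of the Clifford algebra: it is bilinear,
  associative and unital, the generators satisfy the defining relations, and \<open>blade A\<close> is the
  ordered product of the generators with index in \<open>A\<close>.
\<close>

lemma blade_sign_prod:
  "blade_sign A B = (\<Prod>a\<in>A. \<Prod>b\<in>B. if b \<le> a then -1 else 1)"
proof -
  have "(\<Prod>a\<in>A. \<Prod>b\<in>B. if b \<le> a then -1 else (1::real))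
      = (\<Prod>(a,b)\<in>A \<times> B. if b \<le> a then -1 else 1)"
    by (simp add: prod.cartesian_product)
  also have "\<dots> = (\<Prod>x\<in>{x \<in> A \<times> B. snd x \<le> fst x}. -1)"
    by (subst prod.inter_filter) (auto simp: case_prod_unfold)
  also have "{x \<in> A \<times> B. snd x \<le> fst x} = {(a, b). a \<in> A \<and> b \<in> B \<and> b \<le> a}"
    by auto
  finally show ?thesis
    by (simp add: blade_sign_def)
qed

lemma prod_sym_diff:
  fixes f :: "'a::finite \<Rightarrow> real"
  assumes "\<And>x. f x * f x = 1"
  shows "prod f (sym_diff A B) = prod f A * prod f B"
proof -
  have 1: "prod f (A \<inter> B) * prod f (A \<inter> B) = 1"
    by (simp add: assms flip: prod.distrib)
  have "prod f A = prod f (A - B) * prod f (A \<inter> B)"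
    by (subst prod.union_disjoint[symmetric]) (auto intro: arg_cong[of _ _ "prod f"])
  moreover have "prod f B = prod f (B - A) * prod f (A \<inter> B)"
    by (subst prod.union_disjoint[symmetric]) (auto intro: arg_cong[of _ _ "prod f"])
  moreover have "prod f (sym_diff A B) = prod f (A - B) * prod f (B - A)"
    by (rule prod.union_disjoint) auto
  ultimately have "prod f A * prod f B
      = prod f (sym_diff A B) * (prod f (A \<inter> B) * prod f (A \<inter> B))"
    by (simp only: ac_simps)
  then show ?thesis
    by (simp add: 1)
qed

lemma blade_sign_sq [simp]: "blade_sign A B * blade_sign A B = 1"
  by (simp add: blade_sign_def flip: power_mult_distrib)

lemma blade_sign_sym_diff_left:
  "blade_sign (sym_diff A B) C = blade_sign A C * blade_sign B C"
  unfolding blade_sign_prod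
  by (rule prod_sym_diff) (auto simp flip: prod.distrib intro!: prod.neutral)

lemma blade_sign_sym_diff_right:
  "blade_sign A (sym_diff B C) = blade_sign A B * blade_sign A C"
  unfolding blade_sign_prod prod.distrib[symmetric]
  by (intro prod.cong refl prod_sym_diff) auto

lemma bilinear_clifford_mult:
  "bilinear (clifford_mult :: 'n::{finite,linorder} clifford \<Rightarrow> _)"
  unfolding bilinear_def clifford_mult_def
  by (auto intro!: linearI simp: algebra_simps sum.distrib scaleR_sum_right)

lemmas clifford_mult_simps =
  bilinear_ladd[OF bilinear_clifford_mult] bilinear_radd[OF bilinear_clifford_mult]
  bilinear_lmul[OF bilinear_clifford_mult] bilinear_rmul[OF bilinear_clifford_mult]
  bilinear_lzero[OF bilinear_clifford_mult] bilinear_rzero[OF bilinear_clifford_mult]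

lemma blade_nth: "blade A $ B = (if A = B then 1 else 0)"
  by (auto simp: blade_def axis_def)

lemma blade_mult: "blade A \<odot> blade B = blade_sign A B *\<^sub>R blade (sym_diff A B)"
proof -
  have "blade A \<odot> blade B
      = (\<Sum>A'\<in>UNIV. if A' = A then blade_sign A B *\<^sub>R blade (sym_diff A B) else 0)"
    unfolding clifford_mult_def
  proof (rule sum.cong[OF refl])
    fix A' :: "'a set"
    have "(\<Sum>B'\<in>UNIV. (blade A $ A' * blade B $ B' * blade_sign A' B') *\<^sub>R blade (sym_diff A' B'))
        = (\<Sum>B'\<in>UNIV. if B' = B then (blade A $ A' * blade_sign A' B) *\<^sub>R blade (sym_diff A' B) else 0)"
      by (intro sum.cong) (auto simp: blade_nth)
    then show "(\<Sum>B'\<in>UNIV. (blade A $ A' * blade B $ B' * blade_sign A' B') *\<^sub>R blade (sym_diff A' B'))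
        = (if A' = A then blade_sign A B *\<^sub>R blade (sym_diff A B) else 0)"
      by (auto simp: blade_nth)
  qed
  then show ?thesis by simp
qed

lemma clifford_expand: "(a :: 'n::{finite,linorder} clifford) = (\<Sum>A\<in>UNIV. a $ A *\<^sub>R blade A)"
  by (simp add: vec_eq_iff blade_nth if_distrib cong: if_cong)

lemma clifford_mult_sum_left:
  "(\<Sum>i\<in>S. f i) \<odot> b = (\<Sum>i\<in>S. f i \<odot> b)"
  by (induction S rule: infinite_finite_induct) (simp_all add: clifford_mult_simps)

lemma clifford_mult_sum_right:
  "b \<odot> (\<Sum>i\<in>S. f i) = (\<Sum>i\<in>S. b \<odot> f i)"
  by (induction S rule: infinite_finite_induct) (simp_all add: clifford_mult_simps)

lemma clifford_one_mult [simp]: "clifford_one \<odot> a = a" "a \<odot> clifford_one = a"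
proof -
  have "clifford_one \<odot> (\<Sum>A\<in>UNIV. a $ A *\<^sub>R blade A) = (\<Sum>A\<in>UNIV. a $ A *\<^sub>R blade A)"
    by (simp add: clifford_mult_sum_right clifford_mult_simps blade_mult blade_sign_def)
  then show "clifford_one \<odot> a = a"
    by (simp flip: clifford_expand)
  have "(\<Sum>A\<in>UNIV. a $ A *\<^sub>R blade A) \<odot> clifford_one = (\<Sum>A\<in>UNIV. a $ A *\<^sub>R blade A)"
    by (simp add: clifford_mult_sum_left clifford_mult_simps blade_mult blade_sign_def)
  then show "a \<odot> clifford_one = a"
    by (simp flip: clifford_expand)
qed

lemma sym_diff_assoc: "sym_diff (sym_diff A B) C = sym_diff A (sym_diff B C)"
  by auto

lemma blade_mult_assoc: "(blade A \<odot> blade B) \<odot> blade C = blade A \<odot> (blade B \<odot> blade C)"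
  by (simp only: blade_mult clifford_mult_simps scaleR_scaleR blade_sign_sym_diff_left
      blade_sign_sym_diff_right sym_diff_assoc mult.assoc mult.commute mult.left_commute)

lemma clifford_mult_assoc: "(a \<odot> b) \<odot> c = a \<odot> (b \<odot> c)"
proof -
  have "((\<Sum>A\<in>UNIV. a $ A *\<^sub>R blade A) \<odot> (\<Sum>B\<in>UNIV. b $ B *\<^sub>R blade B)) \<odot> (\<Sum>C\<in>UNIV. c $ C *\<^sub>R blade C)
      = (\<Sum>A\<in>UNIV. a $ A *\<^sub>R blade A) \<odot> ((\<Sum>B\<in>UNIV. b $ B *\<^sub>R blade B) \<odot> (\<Sum>C\<in>UNIV. c $ C *\<^sub>R blade C))"
    by (simp only: clifford_mult_sum_left clifford_mult_sum_right clifford_mult_simps blade_mult_assoc)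
  then show ?thesis
    by (simp only: clifford_expand[symmetric])
qed

lemma gen_anticommute:
  "gen r \<odot> gen s + gen s \<odot> gen r = (if r = s then -2 else 0) *\<^sub>R clifford_one"
proof -
  have sd: "sym_diff {r} {s} = sym_diff {s} {r}"
    by auto
  show ?thesis
    unfolding blade_mult blade_sign_prod sd
    by (auto simp: not_le simp flip: scaleR_add_left)
qed

lemma blade_ordered_product:
  "blade A = foldr (\<lambda>r b. gen r \<odot> b) (sorted_list_of_set A) clifford_one"
proof -
  have "foldr (\<lambda>r b. gen r \<odot> b) xs clifford_one = blade (set xs)"
    if "sorted_wrt (<) xs" for xs :: "'a list"
    using that
  proof (induction xs)
    case (Cons x xs)
    have "blade_sign {x} (set xs) = 1"
      unfolding blade_sign_prod using Cons.prems by (auto simp: not_le intro!: prod.neutral)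
    moreover have "sym_diff {x} (set xs) = set (x # xs)"
      using Cons.prems by auto
    ultimately show ?case
      using Cons by (simp add: blade_mult)
  qed simp
  from this[of "sorted_list_of_set A"] show ?thesis
    by simp
qed

section \<open>Paravectors and slices\<close>

definition paravectors :: "'n::{finite,linorder} clifford set" where
  "paravectors = {x\<^sub>0 *\<^sub>R clifford_one + (\<Sum>i\<in>UNIV. x i *\<^sub>R gen i) | x\<^sub>0 x. True}"

definition imag_units :: "'n::{finite,linorder} clifford set" where
  "imag_units = {(\<Sum>i\<in>UNIV. x i *\<^sub>R gen i) | x. (\<Sum>i\<in>UNIV. (x i)\<^sup>2) = 1}"

definition slice_pt :: "'n::{finite,linorder} clifford \<Rightarrow> real \<Rightarrow> real \<Rightarrow> 'n clifford" where
  "slice_pt I u v = u *\<^sub>R clifford_one + v *\<^sub>R I"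

definition half_space :: "'n::{finite,linorder} clifford set" where
  "half_space = {slice_pt I u v | I u v. I \<in> imag_units \<and> u > 0}"

text \<open>
  Functions on a set of paravectors are functions on the whole algebra whose values elsewhere are
  irrelevant; \<open>U\<close> is meant to be relatively open in \<open>paravectors\<close>, and \<open>differentiable_on\<close> (within
  \<open>U\<close>) is then real (Frechet) differentiability on an open subset of \<open>n+1\<close>-dimensional space.
\<close>

definition left_slice_monogenic ::
    "'n::{finite,linorder} clifford set \<Rightarrow> ('n clifford \<Rightarrow> 'n clifford) set" where
  "left_slice_monogenic U = {f. f differentiable_on U \<and>
     (\<forall>I\<in>imag_units. \<forall>u v. slice_pt I u v \<in> U \<longrightarrow>
        (1/2) *\<^sub>R (vector_derivative (\<lambda>s. f (slice_pt I s v)) (at u) +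
                 I \<odot> vector_derivative (\<lambda>t. f (slice_pt I u t)) (at v)) = 0)}"

lemma paravectors_coord:
  "a \<in> paravectors \<longleftrightarrow> a = a $ {} *\<^sub>R clifford_one + (\<Sum>i\<in>UNIV. a $ {i} *\<^sub>R gen i)"
proof
  assume "a \<in> paravectors"
  then obtain x0 x where a: "a = x0 *\<^sub>R clifford_one + (\<Sum>i\<in>UNIV. x i *\<^sub>R gen i)"
    by (auto simp: paravectors_def)
  have "a $ {} = x0" "\<And>i. a $ {i} = x i"
    by (simp_all add: a blade_nth if_distrib cong: if_cong)
  with a show "a = a $ {} *\<^sub>R clifford_one + (\<Sum>i\<in>UNIV. a $ {i} *\<^sub>R gen i)"
    by simp
qed (auto simp: paravectors_def)

lemma imag_unit_sq:
  assumes "I \<in> imag_units"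
  shows "I \<odot> I = - clifford_one"
proof -
  obtain x where I: "I = (\<Sum>i\<in>UNIV. x i *\<^sub>R gen i)" and x: "(\<Sum>i\<in>UNIV. (x i)\<^sup>2) = 1"
    using assms by (auto simp: imag_units_def)
  have 2: "I \<odot> I = (\<Sum>i\<in>UNIV. \<Sum>j\<in>UNIV. (x i * x j) *\<^sub>R (gen j \<odot> gen i))"
    by (simp add: I clifford_mult_sum_left clifford_mult_sum_right clifford_mult_simps
        scaleR_sum_right)
  have 1: "I \<odot> I = (\<Sum>i\<in>UNIV. \<Sum>j\<in>UNIV. (x i * x j) *\<^sub>R (gen i \<odot> gen j))"
    unfolding 2 by (subst sum.swap) (simp add: mult.commute)
  have "I \<odot> I + I \<odot> I
      = (\<Sum>i\<in>UNIV. \<Sum>j\<in>UNIV. (x i * x j) *\<^sub>R (gen i \<odot> gen j + gen j \<odot> gen i))"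
    unfolding scaleR_add_right sum.distrib using 1 2 by simp
  also have "\<dots> = (\<Sum>i\<in>UNIV. \<Sum>j\<in>UNIV. if i = j then (-2 * (x i)\<^sup>2) *\<^sub>R clifford_one else 0)"
    by (intro sum.cong) (auto simp: gen_anticommute power2_eq_square simp del: scaleR_minus_left)
  also have "\<dots> = (-2 * (\<Sum>i\<in>UNIV. (x i)\<^sup>2)) *\<^sub>R clifford_one"
    by (simp only: sum.delta' sum.delta finite UNIV_I if_True sum_distrib_left scaleR_sum_left)
  also have "\<dots> = (-2) *\<^sub>R clifford_one"
    by (simp add: x)
  finally have "(1/2) *\<^sub>R (I \<odot> I + I \<odot> I) = (1/2) *\<^sub>R (-2) *\<^sub>R clifford_one"
    by (rule arg_cong)
  then show ?thesis
    by (simp only: scaleR_half_double scaleR_scaleR) simp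
qed

lemma half_space_eq:
  "(half_space :: 'n::{finite,linorder} clifford set) = {a \<in> paravectors. a $ {} > 0}"
proof (intro set_eqI iffI)
  fix a :: "'n clifford"
  assume "a \<in> half_space"
  then obtain u v x where a: "a = u *\<^sub>R clifford_one + v *\<^sub>R (\<Sum>i\<in>UNIV. x i *\<^sub>R gen i)" and "u > 0"
    by (auto simp: half_space_def slice_pt_def imag_units_def)
  have "a = u *\<^sub>R clifford_one + (\<Sum>i\<in>UNIV. (v * x i) *\<^sub>R gen i)"
    by (simp add: a scaleR_sum_right)
  then have "a \<in> paravectors"
    unfolding paravectors_def mem_Collect_eq
    by (intro exI[of _ u] exI[of _ "\<lambda>i. v * x i"]) simp
  moreover have "a $ {} = u"
    by (simp add: a blade_nth)
  ultimately show "a \<in> {a \<in> paravectors. a $ {} > 0}"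
    using \<open>u > 0\<close> by simp
next
  fix a :: "'n clifford"
  assume a: "a \<in> {a \<in> paravectors. a $ {} > 0}"
  define r where "r = sqrt (\<Sum>i\<in>UNIV. (a $ {i})\<^sup>2)"
  have r2: "r\<^sup>2 = (\<Sum>i\<in>UNIV. (a $ {i})\<^sup>2)"
    by (simp add: r_def sum_nonneg)
  define j :: 'n where "j = undefined"
  define x where "x i = (if r = 0 then (if i = j then 1 else 0) else a $ {i} / r)" for i
  have ax: "a $ {i} = r * x i" for i
  proof (cases "r = 0")
    case True
    then have "a $ {i} = 0"
      using r2 by (simp add: sum_nonneg_eq_0_iff)
    with True show ?thesis by simp
  qed (simp add: x_def)
  have x1: "(\<Sum>i\<in>UNIV. (x i)\<^sup>2) = 1"
  proof (cases "r = 0")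
    case True
    then show ?thesis
      by (simp add: x_def if_distrib[of "\<lambda>z. z\<^sup>2"] cong: if_cong)
  next
    case False
    then show ?thesis
      by (simp add: x_def power_divide r2[symmetric] flip: sum_divide_distrib)
  qed
  have "a = slice_pt (\<Sum>i\<in>UNIV. x i *\<^sub>R gen i) (a $ {}) r"
    using a paravectors_coord[of a] unfolding slice_pt_def
    by (simp add: scaleR_sum_right flip: ax)
  moreover have "(\<Sum>i\<in>UNIV. x i *\<^sub>R gen i) \<in> imag_units"
    using x1 unfolding imag_units_def by blast
  ultimately show "a \<in> half_space"
    using a unfolding half_space_def by blast
qed

lemma openin_half_space:
  "openin (top_of_set paravectors) (half_space :: 'n::{finite,linorder} clifford set)"
proof -
  have "open {a :: 'n clifford. a $ {} > 0}"
    by (intro open_Collect_less continuous_intros)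
  then show ?thesis
    unfolding half_space_eq by (auto simp: openin_open)
qed

section \<open>Bergman and weighted Lebesgue spaces\<close>

definition ennreal_powr :: "ennreal \<Rightarrow> real \<Rightarrow> ennreal" where
  "ennreal_powr x a = (if x = \<infinity> then \<infinity> else ennreal (enn2real x powr a))"
  \<comment> \<open>meaningful for \<open>a > 0\<close>\<close>

definition bergman_norm ::
    "real \<Rightarrow> ('n::{finite,linorder} clifford \<Rightarrow> 'n clifford) \<Rightarrow> ennreal" where
  "bergman_norm p f = ennreal_powr
     (SUP I\<in>imag_units. \<integral>\<^sup>+u\<in>{0<..}. (\<integral>\<^sup>+v. ennreal (norm (f (slice_pt I u v)) powr p) \<partial>lborel) \<partial>lborel)
     (1 / p)"

definition slice_bergman ::
    "real \<Rightarrow> ('n::{finite,linorder} clifford \<Rightarrow> 'n clifford) set" where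
  "slice_bergman p = {f \<in> left_slice_monogenic half_space. bergman_norm p f < \<infinity>}"

definition neg_line :: "real measure" where
  "neg_line = restrict_space lborel {..<0}"

text \<open>
  \<open>L\<^sup>q((-\<infinity>,0), (-w)\<^bsup>-q/p\<^esup> dw)\<close>.  For \<open>q = \<infinity>\<close> (that is, \<open>p = 1\<close>) this expression has no literal
  meaning and membership means that \<open>g(w)/(-w)\<close> is essentially bounded.
\<close>

definition weighted_Lq :: "real \<Rightarrow> ennreal \<Rightarrow> (real \<Rightarrow> 'b::euclidean_space) set" where
  "weighted_Lq p q = {g \<in> borel_measurable neg_line.
     if q = \<infinity> then esssup neg_line (\<lambda>w. ennreal (norm (g w) / (- w))) < \<infinity>
     else (\<integral>\<^sup>+w. ennreal (norm (g w) powr enn2real q)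
             \<partial>density neg_line (\<lambda>w. ennreal ((- w) powr (- enn2real q / p)))) < \<infinity>}"

end

theory Submission
  imports Defs "HOL-Complex_Analysis.Complex_Analysis" "HOL-Probability.Probability"
begin

text \<open>
  Fix \<open>I \<in> imag_units\<close>.  Left multiplication by \<open>I\<close> is an orthogonal map with square \<open>-1\<close>, so the Clifford
  algebra is a complex Hilbert space of finite dimension, and a slice monogenic function restricted to the
  slice \<open>u + Iv\<close>, \<open>u > 0\<close>, is a holomorphic function \<open>F\<close> on the right half-plane with values in it
  (\<open>slice_restriction_holomorphic\<close>).  The embedding \<open>complexify I\<close> realises this space inside a space \<open>\<complex>\<^sup>m\<close>
  isometrically, and \<open>decomplexify I\<close> is a contraction back.  The theorem is therefore a Paley--Wiener theorem
  for vector-valued Bergman functions on the half-plane.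

  If \<open>F\<close> is integrable over the half-plane, the density is read off from a vertical line:
  \<open>G w = e\<^bsup>- a w\<^esup>\<close> times the Fourier transform of \<open>F(a + i\<cdot>)\<close> at \<open>w\<close>.  Cauchy's theorem shows that it does not
  depend on \<open>a\<close>, and Cauchy's formula on the line, with the Cauchy kernel written as a Laplace integral, gives the
  representation (\<open>Paley_Wiener_L1\<close>).  What moves the contours is integrability over a strip rather than a
  pointwise bound: it makes the horizontal contributions small along a sequence of heights.

  The norm estimate compares, on each vertical line, the \<open>L\<^sup>q\<close> norm of \<open>e\<^bsup>u w\<^esup> G\<close> with the \<open>L\<^sup>p\<close> norm of \<open>F(u + i\<cdot>)\<close>
  by the Hausdorff--Young inequality and integrates over \<open>u\<close> with Minkowski's inequality; the weight
  \<open>1 / (- p w)\<close> is the integral of \<open>e\<^bsup>p u w\<^esup>\<close> over \<open>u > 0\<close> (\<open>weighted_norm_estimate\<close>).  Hausdorff--Young with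
  constant \<open>1\<close> for vector-valued functions is obtained by interpolation between the bounds
  \<open>L\<^sup>1 \<rightarrow> L\<^sup>\<infinity>\<close> and \<open>L\<^sup>2 \<rightarrow> L\<^sup>2\<close>; on simple functions this is a statement about a finite matrix
  (\<open>Riesz_Thorin_finite\<close>), and the \<open>L\<^sup>2\<close> bound comes from a Gaussian regularisation (\<open>Plancherel_le\<close>).

  For \<open>p > 1\<close> a Bergman function need not be integrable.  It is multiplied by holomorphic damping factors, and
  the norm estimate for differences makes the resulting densities converge (\<open>Paley_Wiener_Bergman_gt_1\<close>).
  For \<open>p = 1\<close> the function is integrable from the start, and its density is bounded by the elementary estimate of
  the Fourier transform (\<open>Paley_Wiener_Bergman_1\<close>).
\<close>

section \<open>Hoelder and Minkowski inequalities for nonnegative integrals\<close>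

lemma conjugate_exponent_gt_1:
  fixes r s :: real
  assumes "r > 1" "1 / r + 1 / s = 1"
  shows "s > 1"
proof -
  have "inverse s = (r - 1) / r" using assms by (simp add: field_simps)
  then have "s = r / (r - 1)" using assms by (metis inverse_divide inverse_inverse_eq)
  then show ?thesis using assms by simp
qed

text \<open>
  For positive norms, Young's inequality is applied to the normalised functions
  \<open>f / A\<close> and \<open>g / B\<close> and integrated.
\<close>

lemma nn_integral_Holder_pos:
  fixes f g :: "'a \<Rightarrow> real"
  assumes [measurable]: "f \<in> borel_measurable M" "g \<in> borel_measurable M"
    and nn: "\<And>x. f x \<ge> 0" "\<And>x. g x \<ge> 0"
    and r: "r > 1" "1 / r + 1 / s = 1"
    and f: "(\<integral>\<^sup>+x. ennreal (f x powr r) \<partial>M) \<le> ennreal (A powr r)"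
    and g: "(\<integral>\<^sup>+x. ennreal (g x powr s) \<partial>M) \<le> ennreal (B powr s)"
    and AB: "A > 0" "B > 0"
  shows "(\<integral>\<^sup>+x. ennreal (f x * g x) \<partial>M) \<le> ennreal (A * B)"
proof -
  have s: "s > 1" using conjugate_exponent_gt_1 r by blast
  define c d where "c = A * B * (1 / r) / A powr r" and "d = A * B * (1 / s) / B powr s"
  have cd: "c \<ge> 0" "d \<ge> 0" using r s AB by (auto simp: c_def d_def)
  have pt: "f x * g x \<le> c * f x powr r + d * g x powr s" for x
  proof -
    have "f x / A * (g x / B) \<le> (f x / A) powr r / r + (g x / B) powr s / s"
      by (rule Youngs_inequality) (use r s nn AB in auto)
    also have "\<dots> = f x powr r / A powr r / r + g x powr s / B powr s / s"
      using nn AB by (simp add: powr_divide)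
    finally have "A * B * (f x / A * (g x / B)) \<le> A * B * (f x powr r / A powr r / r + g x powr s / B powr s / s)"
      using AB by (intro mult_left_mono) auto
    then show ?thesis using AB by (simp add: c_def d_def field_simps)
  qed
  have "(\<integral>\<^sup>+x. ennreal (f x * g x) \<partial>M) \<le> (\<integral>\<^sup>+x. ennreal c * ennreal (f x powr r) + ennreal d * ennreal (g x powr s) \<partial>M)"
    using pt cd by (intro nn_integral_mono) (simp flip: ennreal_mult' ennreal_plus)
  also have "\<dots> = ennreal c * (\<integral>\<^sup>+x. ennreal (f x powr r) \<partial>M) + ennreal d * (\<integral>\<^sup>+x. ennreal (g x powr s) \<partial>M)"
    by (simp add: nn_integral_add nn_integral_cmult)
  also have "\<dots> \<le> ennreal c * ennreal (A powr r) + ennreal d * ennreal (B powr s)"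
    by (intro add_mono mult_left_mono f g) auto
  also have "\<dots> = ennreal (c * A powr r + d * B powr s)"
    using cd by (simp flip: ennreal_mult')
  also have "c * A powr r + d * B powr s = A * B * (1 / r + 1 / s)"
    using AB by (simp add: c_def d_def distrib_left)
  finally show ?thesis using r by simp
qed

text \<open>
  Norms that may vanish are reached as the limit of \<open>A + e\<close> and \<open>B + e\<close>.  The norms enter only
  through upper bounds, so no division by a vanishing integral occurs.
\<close>

lemma nn_integral_Holder:
  fixes f g :: "'a \<Rightarrow> real"
  assumes [measurable]: "f \<in> borel_measurable M" "g \<in> borel_measurable M"
    and nn: "\<And>x. f x \<ge> 0" "\<And>x. g x \<ge> 0"
    and r: "r > 1" "1 / r + 1 / s = 1"
    and f: "(\<integral>\<^sup>+x. ennreal (f x powr r) \<partial>M) \<le> ennreal (A powr r)"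
    and g: "(\<integral>\<^sup>+x. ennreal (g x powr s) \<partial>M) \<le> ennreal (B powr s)"
    and AB: "A \<ge> 0" "B \<ge> 0"
  shows "(\<integral>\<^sup>+x. ennreal (f x * g x) \<partial>M) \<le> ennreal (A * B)"
proof -
  have s: "s > 0" using conjugate_exponent_gt_1[of r s] r by linarith
  have *: "(\<integral>\<^sup>+x. ennreal (f x * g x) \<partial>M) \<le> ennreal ((A + e) * (B + e))" if "e > 0" for e
  proof (rule nn_integral_Holder_pos[where r = r and s = s])
    show "(\<integral>\<^sup>+x. ennreal (f x powr r) \<partial>M) \<le> ennreal ((A + e) powr r)"
      using AB that r by (intro order_trans[OF f] ennreal_leI powr_mono2) auto
    show "(\<integral>\<^sup>+x. ennreal (g x powr s) \<partial>M) \<le> ennreal ((B + e) powr s)"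
      using AB that s by (intro order_trans[OF g] ennreal_leI powr_mono2) auto
  qed (use assms that in auto)
  have "((\<lambda>e. ennreal ((A + e) * (B + e))) \<longlongrightarrow> ennreal ((A + 0) * (B + 0))) (at_right 0)"
    by (intro tendsto_intros)
  then have "((\<lambda>e. ennreal ((A + e) * (B + e))) \<longlongrightarrow> ennreal (A * B)) (at_right 0)" by simp
  then show ?thesis
    by (rule tendsto_lowerbound) (auto intro!: eventually_mono[OF eventually_at_right_less] *)
qed

text \<open>
  The usual duality argument: \<open>m\<^sup>r = m\<^bsup>r-1\<^esup> \<cdot> \<integral>H\<close>, so Fubini and Hoelder's inequality bound
  \<open>X = \<integral>m\<^sup>r\<close> by \<open>C X\<^bsup>1-1/r\<^esup>\<close>.  To divide, \<open>X\<close> has to be finite; hence the integral is first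
  restricted to sets of finite measure on which \<open>m\<close> is bounded.
\<close>

lemma nn_integral_Minkowski:
  fixes H :: "'a \<Rightarrow> 'b \<Rightarrow> real" and a :: "'a \<Rightarrow> real" and m :: "'b \<Rightarrow> real"
  assumes M: "sigma_finite_measure M" and N: "sigma_finite_measure N"
    and H[measurable]: "(\<lambda>(u,w). H u w) \<in> borel_measurable (M \<Otimes>\<^sub>M N)"
    and [measurable]: "a \<in> borel_measurable M" "m \<in> borel_measurable N"
    and nn: "\<And>u w. H u w \<ge> 0" "\<And>u. a u \<ge> 0" "\<And>w. m w \<ge> 0"
    and m: "\<And>w. w \<in> space N \<Longrightarrow> (\<integral>\<^sup>+u. ennreal (H u w) \<partial>M) = ennreal (m w)"
    and r: "r \<ge> 1"
    and a: "AE u in M. (\<integral>\<^sup>+w. ennreal (H u w powr r) \<partial>N) \<le> ennreal (a u powr r)"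
    and C: "(\<integral>\<^sup>+u. ennreal (a u) \<partial>M) \<le> ennreal C" "C \<ge> 0"
  shows "(\<integral>\<^sup>+w. ennreal (m w powr r) \<partial>N) \<le> ennreal (C powr r)"
proof -
  interpret M: sigma_finite_measure M by fact
  interpret N: sigma_finite_measure N by fact
  interpret pair_sigma_finite M N ..
  show ?thesis
  proof (cases "r = 1")
    case True
    have "(\<integral>\<^sup>+w. ennreal (m w powr r) \<partial>N) = (\<integral>\<^sup>+w. (\<integral>\<^sup>+u. ennreal (H u w) \<partial>M) \<partial>N)"
      using nn True by (intro nn_integral_cong) (simp add: m)
    also have "\<dots> = (\<integral>\<^sup>+u. (\<integral>\<^sup>+w. ennreal (H u w) \<partial>N) \<partial>M)"
      by (intro Fubini') measurable
    also have "\<dots> \<le> (\<integral>\<^sup>+u. ennreal (a u) \<partial>M)"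
      using a nn True by (intro nn_integral_mono_AE) simp
    finally show ?thesis using C True by simp
  next
    case False
    define s where "s = r / (r - 1)"
    have rs: "r > 1" "1 / r + 1 / s = 1" using r False by (auto simp: s_def field_simps)
    have s1: "s > 1" using conjugate_exponent_gt_1 rs by blast
    obtain A :: "nat \<Rightarrow> 'b set" where A: "range A \<subseteq> sets N" "(\<Union>i. A i) = space N"
      "\<And>i. emeasure N (A i) \<noteq> \<infinity>" "incseq A"
      by (rule N.sigma_finite_incseq) blast
    \<comment> \<open>On these sets the integral of \<open>m powr r\<close> is finite, and they exhaust the space.\<close>
    define E where "E n = A n \<inter> {w \<in> space N. m w \<le> real n}" for n
    have A'[measurable]: "A n \<in> sets N" for n using A by auto
    have E[measurable]: "E n \<in> sets N" for n unfolding E_def by measurable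
    have le: "(\<integral>\<^sup>+w. ennreal (m w powr r * indicator (E n) w) \<partial>N) \<le> ennreal (C powr r)" for n
    proof -
      let ?I = "\<integral>\<^sup>+w. ennreal (m w powr r * indicator (E n) w) \<partial>N"
      have "?I \<le> (\<integral>\<^sup>+w. ennreal (real n powr r) * indicator (A n) w \<partial>N)"
        using nn r by (intro nn_integral_mono) (auto simp: E_def indicator_def intro!: ennreal_leI powr_mono2)
      also have "\<dots> < \<infinity>"
        using A(3)[of n] by (simp add: nn_integral_cmult_indicator ennreal_mult_less_top top.not_eq_extremum)
      finally obtain X where X: "?I = ennreal X" "X \<ge> 0"
        by (cases ?I) auto
      define B where "B = X powr (1 / s)"
      have "?I = (\<integral>\<^sup>+w. (\<integral>\<^sup>+u. ennreal ((H u w * indicator (E n) w) * (m w powr (r - 1) * indicator (E n) w)) \<partial>M) \<partial>N)"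
      proof (intro nn_integral_cong)
        fix w assume w: "w \<in> space N"
        have "(\<integral>\<^sup>+u. ennreal ((H u w * indicator (E n) w) * (m w powr (r - 1) * indicator (E n) w)) \<partial>M)
            = (\<integral>\<^sup>+u. ennreal (m w powr (r - 1) * indicator (E n) w) * ennreal (H u w) \<partial>M)"
          using nn by (intro nn_integral_cong) (auto simp: indicator_def mult.commute simp flip: ennreal_mult)
        also have "\<dots> = ennreal (m w powr (r - 1) * indicator (E n) w) * ennreal (m w)"
          using w by (subst nn_integral_cmult) (simp_all add: m)
        also have "\<dots> = ennreal (m w powr r * indicator (E n) w)"
          using nn(3)[of w] r by (cases "m w = 0") (auto simp: powr_diff simp flip: ennreal_mult)
        finally show "ennreal (m w powr r * indicator (E n) w) =
          (\<integral>\<^sup>+u. ennreal ((H u w * indicator (E n) w) * (m w powr (r - 1) * indicator (E n) w)) \<partial>M)" ..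
      qed
      also have "\<dots> = (\<integral>\<^sup>+u. (\<integral>\<^sup>+w. ennreal ((H u w * indicator (E n) w) * (m w powr (r - 1) * indicator (E n) w)) \<partial>N) \<partial>M)"
        by (intro Fubini') measurable
      also have "\<dots> \<le> (\<integral>\<^sup>+u. ennreal (a u * B) \<partial>M)"
      proof (rule nn_integral_mono_AE, rule AE_mp[OF a], rule AE_I2, rule impI, rule nn_integral_Holder[where r = r and s = s, OF _ _ _ _ rs])
        fix u assume u: "u \<in> space M" and au: "(\<integral>\<^sup>+w. ennreal (H u w powr r) \<partial>N) \<le> ennreal (a u powr r)"
        show "(\<integral>\<^sup>+w. ennreal ((H u w * indicator (E n) w) powr r) \<partial>N) \<le> ennreal (a u powr r)"
          by (rule order_trans[OF nn_integral_mono au]) (auto simp: indicator_def)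
        have "(\<integral>\<^sup>+w. ennreal ((m w powr (r - 1) * indicator (E n) w) powr s) \<partial>N) = ?I"
          using rs by (intro nn_integral_cong) (auto simp: indicator_def powr_powr s_def)
        also have "\<dots> = ennreal (B powr s)"
          using X s1 by (simp add: B_def powr_powr)
        finally show "(\<integral>\<^sup>+w. ennreal ((m w powr (r - 1) * indicator (E n) w) powr s) \<partial>N) \<le> ennreal (B powr s)"
          by simp
        show "(\<lambda>w. H u w * indicator (E n) w) \<in> borel_measurable N" using u by measurable
      qed (use nn in \<open>auto simp: B_def\<close>)
      also have "\<dots> = (\<integral>\<^sup>+u. ennreal (a u) \<partial>M) * ennreal B"
        using nn by (subst nn_integral_multc[symmetric]) (auto simp: ennreal_mult B_def)
      also have "\<dots> \<le> ennreal (C * B)"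
        using C by (subst ennreal_mult) (auto simp: B_def intro!: mult_right_mono)
      finally have XC: "X \<le> C * B"
        using X C by (simp add: B_def)
      have "X \<le> C powr r"
      proof (cases "X = 0")
        case False
        then have "X > 0" using X by simp
        have "X = X powr (1 / r) * X powr (1 / s)"
          using \<open>X > 0\<close> rs by (simp flip: powr_add)
        then have "X powr (1 / r) \<le> C"
          using XC \<open>X > 0\<close> unfolding B_def by (smt (verit) mult_le_cancel_right powr_gt_zero)
        then have "(X powr (1 / r)) powr r \<le> C powr r"
          using rs by (intro powr_mono2) auto
        then show ?thesis using \<open>X > 0\<close> rs by (simp add: powr_powr)
      qed simp
      then show ?thesis using X by (simp add: ennreal_leI)
    qed
    have "(\<integral>\<^sup>+w. ennreal (m w powr r) \<partial>N) = (\<integral>\<^sup>+w. (SUP n. ennreal (m w powr r * indicator (E n) w)) \<partial>N)"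
    proof (intro nn_integral_cong)
      fix w assume w: "w \<in> space N"
      obtain i where i: "w \<in> A i" using A w by blast
      obtain j where j: "m w \<le> real j" using real_arch_simple by blast
      have "w \<in> A (max i j)" using i A(4) by (meson incseqD max.cobounded1 subsetD)
      then have "w \<in> E (max i j)" using j w by (auto simp: E_def)
      then show "ennreal (m w powr r) = (SUP n. ennreal (m w powr r * indicator (E n) w))"
        by (intro antisym SUP_least SUP_upper2[of "max i j"]) (auto simp: indicator_def)
    qed
    also have "\<dots> = (SUP n. \<integral>\<^sup>+w. ennreal (m w powr r * indicator (E n) w) \<partial>N)"
    proof (intro nn_integral_monotone_convergence_SUP incseq_SucI le_funI)
      fix n w
      have "E n \<subseteq> E (Suc n)" using A(4) by (auto simp: E_def incseq_Suc_iff)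
      then show "ennreal (m w powr r * indicator (E n) w) \<le> ennreal (m w powr r * indicator (E (Suc n)) w)"
        by (intro ennreal_leI mult_left_mono) (auto simp: indicator_def)
    qed measurable
    also have "\<dots> \<le> ennreal (C powr r)"
      by (intro SUP_least le)
    finally show ?thesis .
  qed
qed

section \<open>Interpolation in a strip\<close>

text \<open>
  Phragmen--Lindeloef for a bounded entire function: the Gaussian factor \<open>exp (e (z\<^sup>2 - 1))\<close> has
  modulus at most \<open>1\<close> on the strip and decays vertically, so the maximum principle applies on a tall
  rectangle; then \<open>e\<close> tends to \<open>0\<close>.
\<close>

lemma strip_maximum_principle:
  fixes \<Phi> :: "complex \<Rightarrow> complex"
  assumes hol: "\<Phi> holomorphic_on UNIV"
    and bdd: "\<And>z. 0 \<le> Re z \<Longrightarrow> Re z \<le> 1 \<Longrightarrow> norm (\<Phi> z) \<le> C"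
    and left: "\<And>z. Re z = 0 \<Longrightarrow> norm (\<Phi> z) \<le> 1"
    and right: "\<And>z. Re z = 1 \<Longrightarrow> norm (\<Phi> z) \<le> 1"
    and z: "0 \<le> Re z" "Re z \<le> 1"
  shows "norm (\<Phi> z) \<le> 1"
proof -
  have C0: "C \<ge> 0" using order_trans[OF norm_ge_zero bdd[of 0]] by simp
  have *: "norm (\<Phi> z) * exp (e * (Re (z\<^sup>2) - 1)) \<le> 1" if e: "e > 0" for e :: real
  proof -
    define \<Psi> where "\<Psi> \<zeta> = \<Phi> \<zeta> * exp (of_real e * (\<zeta>\<^sup>2 - 1))" for \<zeta>
    have nPsi: "norm (\<Psi> \<zeta>) = norm (\<Phi> \<zeta>) * exp (e * (Re (\<zeta>\<^sup>2) - 1))" for \<zeta>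
      by (simp add: \<Psi>_def norm_mult)
    have re: "Re (\<zeta>\<^sup>2) - 1 \<le> - (Im \<zeta>)\<^sup>2" if "0 \<le> Re \<zeta>" "Re \<zeta> \<le> 1" for \<zeta>
      using that by (simp add: power2_eq_square mult_le_one)
    \<comment> \<open>Tall enough to contain \<open>z\<close> and to make \<open>C exp (- e R\<^sup>2) \<le> 1\<close>.\<close>
    define R where "R = 1 + \<bar>Im z\<bar> + C / e"
    have R: "R \<ge> 1" "R > \<bar>Im z\<bar>" using C0 e add_pos_nonneg[OF zero_less_one, of "C / e"] by (simp_all add: R_def)
    have big: "C * exp (- e * R\<^sup>2) \<le> 1"
    proof -
      have "C \<le> e * R" using e by (simp add: R_def field_simps)
      also have "\<dots> \<le> e * R\<^sup>2" using R e by (simp add: power2_eq_square)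
      also have "\<dots> \<le> exp (e * R\<^sup>2)" using exp_ge_add_one_self[of "e * R\<^sup>2"] by linarith
      finally show ?thesis by (simp add: exp_minus field_simps)
    qed
    let ?S = "cbox (Complex 0 (-R)) (Complex 1 R)"
    have "norm (\<Psi> z) \<le> 1"
    proof (rule maximum_modulus_frontier[where f = \<Psi> and S = "?S"])
      show "\<Psi> holomorphic_on interior ?S"
        unfolding \<Psi>_def by (intro holomorphic_intros holomorphic_on_subset[OF hol]) auto
      show "continuous_on (closure ?S) \<Psi>"
        unfolding \<Psi>_def
        by (intro continuous_intros holomorphic_on_imp_continuous_on holomorphic_on_subset[OF hol]) auto
      show "bounded ?S" by (rule bounded_cbox)
      show "z \<in> ?S" using z R by (auto simp: in_cbox_complex_iff)
    next
      fix \<zeta> assume "\<zeta> \<in> frontier ?S"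
      then have in_S: "\<zeta> \<in> ?S" and not: "\<zeta> \<notin> box (Complex 0 (-R)) (Complex 1 R)"
        by (auto simp: frontier_cbox)
      have S: "0 \<le> Re \<zeta>" "Re \<zeta> \<le> 1" "\<bar>Im \<zeta>\<bar> \<le> R" using in_S by (auto simp: in_cbox_complex_iff)
      have "Re \<zeta> = 0 \<or> Re \<zeta> = 1 \<or> \<bar>Im \<zeta>\<bar> = R"
        using S not by (auto simp: in_box_complex_iff)
      then consider "norm (\<Phi> \<zeta>) \<le> 1" | "\<bar>Im \<zeta>\<bar> = R" using left right by blast
      then show "norm (\<Psi> \<zeta>) \<le> 1"
      proof cases
        case 1
        have "exp (e * (Re (\<zeta>\<^sup>2) - 1)) \<le> 1"
          using order_trans[OF re[OF S(1,2)], of 0] e by (simp add: mult_le_0_iff)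
        then show ?thesis unfolding nPsi using 1 by (intro mult_le_one) auto
      next
        case 2
        have "norm (\<Psi> \<zeta>) \<le> C * exp (e * (- (Im \<zeta>)\<^sup>2))"
          unfolding nPsi using mult_left_mono[OF re[OF S(1,2)], of e] e bdd[OF S(1,2)] C0
          by (intro mult_mono) simp_all
        also have "(Im \<zeta>)\<^sup>2 = R\<^sup>2" using 2 by (metis power2_abs)
        finally show ?thesis using big by simp
      qed
    qed
    then show ?thesis by (simp add: nPsi)
  qed
  have "((\<lambda>e. norm (\<Phi> z) * exp (e * (Re (z\<^sup>2) - 1))) \<longlongrightarrow> norm (\<Phi> z) * exp (0 * (Re (z\<^sup>2) - 1))) (at_right 0)"
    by (intro tendsto_intros)
  then have "((\<lambda>e. norm (\<Phi> z) * exp (e * (Re (z\<^sup>2) - 1))) \<longlongrightarrow> norm (\<Phi> z)) (at_right 0)" by simp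
  then show ?thesis
    by (rule tendsto_upperbound) (auto intro!: eventually_mono[OF eventually_at_right_less] *)
qed

text \<open>
  Interpolation of a bilinear form between \<open>L\<^sup>1 \<times> L\<^sup>1\<close> and \<open>L\<^sup>2 \<times> L\<^sup>2\<close>, for functions with finitely
  many values: \<open>\<mu>\<close> and \<open>\<nu>\<close> are the measures of the level sets, \<open>\<alpha>\<close> and \<open>\<beta>\<close> the moduli of the values.
  Replacing each modulus \<open>\<alpha>\<close> by \<open>\<alpha>\<^bsup>P(\<zeta>)\<^esup>\<close> with \<open>P(\<zeta>) = p (1 - \<zeta>/2)\<close> turns the form into a finite sum of
  exponentials in \<open>\<zeta>\<close>, which is entire and bounded on the strip.  On the line \<open>Re \<zeta> = 0\<close> the
  \<open>L\<^sup>1\<close> bound gives at most \<open>1\<close>, on \<open>Re \<zeta> = 1\<close> the \<open>L\<^sup>2\<close> bound does.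
\<close>

lemma Riesz_Thorin_finite_normalised:
  fixes K :: "'s \<Rightarrow> 't \<Rightarrow> complex" and \<mu> \<alpha> :: "'s \<Rightarrow> real" and \<nu> \<beta> :: "'t \<Rightarrow> real"
  assumes b1: "\<And>a b. norm (\<Sum>s\<in>S. \<Sum>t\<in>T. K s t * a s * b t) \<le> (\<Sum>s\<in>S. \<mu> s * norm (a s)) * (\<Sum>t\<in>T. \<nu> t * norm (b t))"
    and b2: "\<And>a b. norm (\<Sum>s\<in>S. \<Sum>t\<in>T. K s t * a s * b t) \<le>
      sqrt (\<Sum>s\<in>S. \<mu> s * (norm (a s))\<^sup>2) * sqrt (\<Sum>t\<in>T. \<nu> t * (norm (b t))\<^sup>2)"
    and pos: "\<And>s. s \<in> S \<Longrightarrow> \<alpha> s > 0" "\<And>t. t \<in> T \<Longrightarrow> \<beta> t > 0"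
    and nn: "\<And>s. s \<in> S \<Longrightarrow> \<mu> s \<ge> 0" "\<And>t. t \<in> T \<Longrightarrow> \<nu> t \<ge> 0"
    and p: "1 \<le> p" "p \<le> 2"
    and a: "(\<Sum>s\<in>S. \<mu> s * \<alpha> s powr p) = 1" and b: "(\<Sum>t\<in>T. \<nu> t * \<beta> t powr p) = 1"
  shows "norm (\<Sum>s\<in>S. \<Sum>t\<in>T. K s t * of_real (\<alpha> s) * of_real (\<beta> t)) \<le> 1"
proof -
  define P :: "complex \<Rightarrow> complex" where "P \<zeta> = of_real p * (1 - \<zeta> / 2)" for \<zeta>
  define A where "A \<zeta> s = exp (P \<zeta> * of_real (ln (\<alpha> s)))" for \<zeta> s
  define B where "B \<zeta> t = exp (P \<zeta> * of_real (ln (\<beta> t)))" for \<zeta> t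
  define \<Phi> where "\<Phi> \<zeta> = (\<Sum>s\<in>S. \<Sum>t\<in>T. K s t * A \<zeta> s * B \<zeta> t)" for \<zeta>
  have nA: "norm (A \<zeta> s) = \<alpha> s powr (p * (1 - Re \<zeta> / 2))" if "s \<in> S" for \<zeta> s
    using pos(1)[OF that] by (simp add: A_def P_def powr_def)
  have nB: "norm (B \<zeta> t) = \<beta> t powr (p * (1 - Re \<zeta> / 2))" if "t \<in> T" for \<zeta> t
    using pos(2)[OF that] by (simp add: B_def P_def powr_def)
  \<comment> \<open>The point of the strip at which the exponent \<open>P \<theta>\<close> is \<open>1\<close>, so that the original form appears.\<close>
  define \<theta> where "\<theta> = 2 - 2 / p"
  have \<theta>: "0 \<le> \<theta>" "\<theta> \<le> 1" using p by (auto simp: \<theta>_def field_simps)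
  have P\<theta>: "P (of_real \<theta>) = 1"
    using p by (simp add: P_def \<theta>_def field_simps)
  have "norm (\<Phi> (of_real \<theta>)) \<le> 1"
  proof (rule strip_maximum_principle[of \<Phi>])
    show "\<Phi> holomorphic_on UNIV"
      unfolding \<Phi>_def A_def B_def P_def by (intro holomorphic_intros) auto
    show "norm (\<Phi> z) \<le> 1" if "Re z = 0" for z
      using b1[of "A z" "B z"] that a b by (simp add: \<Phi>_def nA nB)
    show "norm (\<Phi> z) \<le> 1" if "Re z = 1" for z
    proof -
      have "norm (A z s) ^ 2 = \<alpha> s powr p" if "s \<in> S" for s
        using that \<open>Re z = 1\<close> pos(1)[OF that] by (simp add: nA powr_power)
      moreover have "norm (B z s) ^ 2 = \<beta> s powr p" if "s \<in> T" for s
        using that \<open>Re z = 1\<close> pos(2)[OF that] by (simp add: nB powr_power)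
      ultimately show ?thesis
        using b2[of "A z" "B z"] a b by (simp add: \<Phi>_def)
    qed
    show "norm (\<Phi> z) \<le> (\<Sum>s\<in>S. \<mu> s * (1 + \<alpha> s powr p)) * (\<Sum>t\<in>T. \<nu> t * (1 + \<beta> t powr p))"
      if z: "0 \<le> Re z" "Re z \<le> 1" for z
    proof -
      have pw: "x powr (p * (1 - Re z / 2)) \<le> 1 + x powr p" if "x > 0" for x :: real
      proof (cases "x \<ge> 1")
        case True
        have "x powr (p * (1 - Re z / 2)) \<le> x powr p"
          using True p z by (intro powr_mono) auto
        then show ?thesis by simp
      next
        case False
        have "x powr (p * (1 - Re z / 2)) \<le> 1"
          using False that p z by (intro powr_le1) auto
        then show ?thesis by (simp add: add_increasing2)
      qed
      have "norm (\<Phi> z) \<le> (\<Sum>s\<in>S. \<mu> s * norm (A z s)) * (\<Sum>t\<in>T. \<nu> t * norm (B z t))"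
        unfolding \<Phi>_def by (rule b1)
      also have "\<dots> \<le> (\<Sum>s\<in>S. \<mu> s * (1 + \<alpha> s powr p)) * (\<Sum>t\<in>T. \<nu> t * (1 + \<beta> t powr p))"
        using nn pos pw by (intro mult_mono sum_mono mult_left_mono sum_nonneg mult_nonneg_nonneg)
          (auto simp: nA nB add_nonneg_nonneg)
      finally show ?thesis .
    qed
  qed (use \<theta> in auto)
  also have "\<Phi> (of_real \<theta>) = (\<Sum>s\<in>S. \<Sum>t\<in>T. K s t * of_real (\<alpha> s) * of_real (\<beta> t))"
  proof -
    have "exp (complex_of_real (ln x)) = of_real x" if "x > 0" for x
      using that by (simp add: exp_of_real)
    then show ?thesis
      unfolding \<Phi>_def A_def B_def P\<theta> using pos by (intro sum.cong refl) simp
  qed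
  finally show ?thesis .
qed

lemma Riesz_Thorin_finite:
  fixes K :: "'s \<Rightarrow> 't \<Rightarrow> complex" and \<mu> \<alpha> :: "'s \<Rightarrow> real" and \<nu> \<beta> :: "'t \<Rightarrow> real"
  assumes fin: "finite S" "finite T"
    and b1: "\<And>a b. norm (\<Sum>s\<in>S. \<Sum>t\<in>T. K s t * a s * b t) \<le> (\<Sum>s\<in>S. \<mu> s * norm (a s)) * (\<Sum>t\<in>T. \<nu> t * norm (b t))"
    and b2: "\<And>a b. norm (\<Sum>s\<in>S. \<Sum>t\<in>T. K s t * a s * b t) \<le>
      sqrt (\<Sum>s\<in>S. \<mu> s * (norm (a s))\<^sup>2) * sqrt (\<Sum>t\<in>T. \<nu> t * (norm (b t))\<^sup>2)"
    and pos: "\<And>s. s \<in> S \<Longrightarrow> \<alpha> s > 0" "\<And>t. t \<in> T \<Longrightarrow> \<beta> t > 0"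
    and nn: "\<And>s. s \<in> S \<Longrightarrow> \<mu> s \<ge> 0" "\<And>t. t \<in> T \<Longrightarrow> \<nu> t \<ge> 0"
    and p: "1 \<le> p" "p \<le> 2"
  shows "norm (\<Sum>s\<in>S. \<Sum>t\<in>T. K s t * of_real (\<alpha> s) * of_real (\<beta> t))
    \<le> (\<Sum>s\<in>S. \<mu> s * \<alpha> s powr p) powr (1 / p) * (\<Sum>t\<in>T. \<nu> t * \<beta> t powr p) powr (1 / p)"
proof -
  let ?X = "\<Sum>s\<in>S. \<mu> s * \<alpha> s powr p" and ?Y = "\<Sum>t\<in>T. \<nu> t * \<beta> t powr p"
  let ?N = "norm (\<Sum>s\<in>S. \<Sum>t\<in>T. K s t * of_real (\<alpha> s) * of_real (\<beta> t))"
  have X0: "?X \<ge> 0" and Y0: "?Y \<ge> 0" using nn by (auto intro!: sum_nonneg)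
  have B1: "?N \<le> (\<Sum>s\<in>S. \<mu> s * \<alpha> s) * (\<Sum>t\<in>T. \<nu> t * \<beta> t)"
    using b1[of "\<lambda>s. of_real (\<alpha> s)" "\<lambda>t. of_real (\<beta> t)"] pos by (simp add: less_imp_le cong: sum.cong)
  show ?thesis
  proof (cases "?X = 0 \<or> ?Y = 0")
    case True
    then have "(\<Sum>s\<in>S. \<mu> s * \<alpha> s) = 0 \<or> (\<Sum>t\<in>T. \<nu> t * \<beta> t) = 0"
    proof
      assume "?X = 0"
      then have "\<forall>s\<in>S. \<mu> s * \<alpha> s powr p = 0"
        by (subst (asm) sum_nonneg_eq_0_iff) (use fin nn in auto)
      then show ?thesis using pos by (intro disjI1 sum.neutral) force
    next
      assume "?Y = 0"
      then have "\<forall>s\<in>T. \<nu> s * \<beta> s powr p = 0"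
        by (subst (asm) sum_nonneg_eq_0_iff) (use fin nn in auto)
      then show ?thesis using pos by (intro disjI2 sum.neutral) force
    qed
    then have "?N \<le> 0" using B1 by auto
    then show ?thesis by (rule order_trans) simp
  next
    case False
    define x y where "x = ?X powr (1 / p)" and "y = ?Y powr (1 / p)"
    have xy: "x > 0" "y > 0" using False X0 Y0 by (auto simp: x_def y_def)
    have xp: "x powr p = ?X" "y powr p = ?Y"
      using p X0 Y0 False by (simp_all add: x_def y_def powr_powr)
    have 1: "norm (\<Sum>s\<in>S. \<Sum>t\<in>T. K s t * of_real (\<alpha> s / x) * of_real (\<beta> t / y)) \<le> 1"
    proof (rule Riesz_Thorin_finite_normalised[OF b1 b2 _ _ nn p])
      show "(\<Sum>s\<in>S. \<mu> s * (\<alpha> s / x) powr p) = 1"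
        using pos xy False X0 by (simp add: powr_divide less_imp_le xp flip: sum_divide_distrib cong: sum.cong)
      show "(\<Sum>t\<in>T. \<nu> t * (\<beta> t / y) powr p) = 1"
        using pos xy False Y0 by (simp add: powr_divide less_imp_le xp flip: sum_divide_distrib cong: sum.cong)
    qed (use pos xy in auto)
    have "(\<Sum>s\<in>S. \<Sum>t\<in>T. K s t * of_real (\<alpha> s) * of_real (\<beta> t))
        = of_real (x * y) * (\<Sum>s\<in>S. \<Sum>t\<in>T. K s t * of_real (\<alpha> s / x) * of_real (\<beta> t / y))"
      using xy by (simp add: sum_distrib_left)
    then have "?N = x * y * norm (\<Sum>s\<in>S. \<Sum>t\<in>T. K s t * of_real (\<alpha> s / x) * of_real (\<beta> t / y))"
      using xy by (simp add: norm_mult)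
    also have "\<dots> \<le> x * y * 1" using 1 xy by (intro mult_left_mono) auto
    finally show ?thesis by (simp add: x_def y_def)
  qed
qed

section \<open>The Fourier transform and the Plancherel inequality\<close>

definition fourier :: "(real \<Rightarrow> complex) \<Rightarrow> real \<Rightarrow> complex" where
  "fourier F w = (LINT v|lborel. exp (- \<i> * of_real (v * w)) * F v) / of_real (sqrt (2 * pi))"

lemma norm_exp_i [simp]: "norm (exp (- (\<i> * complex_of_real t))) = 1"
  by (metis norm_exp_i_times mult_minus_right of_real_minus)

lemma integrable_fourier_kernel [simp, intro]:
  assumes "integrable lborel F"
  shows "integrable lborel (\<lambda>v. exp (- (\<i> * of_real (v * w))) * F v)"
proof (rule Bochner_Integration.integrable_bound[OF assms])
  have [measurable]: "F \<in> borel_measurable borel" using assms by auto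
  show "(\<lambda>v. exp (- (\<i> * of_real (v * w))) * F v) \<in> borel_measurable lborel" by measurable
qed (simp add: norm_mult)

lemma fourier_measurable [measurable]:
  assumes [measurable]: "F \<in> borel_measurable borel"
  shows "fourier F \<in> borel_measurable borel"
  unfolding fourier_def[abs_def] by measurable

lemma norm_fourier_le:
  assumes "integrable lborel F"
  shows "norm (fourier F w) \<le> (LINT v|lborel. norm (F v)) / sqrt (2 * pi)"
proof -
  have "norm (fourier F w) = norm (LINT v|lborel. exp (- \<i> * of_real (v * w)) * F v) / sqrt (2 * pi)"
    by (simp add: fourier_def norm_divide)
  also have "\<dots> \<le> (LINT v|lborel. norm (exp (- \<i> * of_real (v * w)) * F v)) / sqrt (2 * pi)"
    by (intro divide_right_mono integral_norm_bound) simp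
  finally show ?thesis by (simp add: norm_mult)
qed

text \<open>
  The characteristic function of the standard normal distribution, rescaled.
\<close>

lemma gaussian_fourier:
  fixes s t :: real
  assumes "s > 0"
  shows "(LINT w|lborel. exp (- \<i> * of_real (t * w)) * of_real (exp (- (s\<^sup>2 * w\<^sup>2) / 2)))
    = of_real (2 * pi * normal_density 0 s t)" (is ?A)
   and "integrable lborel (\<lambda>w. exp (- (s\<^sup>2 * w\<^sup>2) / 2))" (is ?B)
proof -
  have eq: "exp (- (s\<^sup>2 * w\<^sup>2) / 2) = sqrt (2 * pi) * std_normal_density (s * w)" for w
    by (simp add: std_normal_density_def power_mult_distrib)
  have int: "integrable lborel (\<lambda>w. std_normal_density (0 + s * w))"
    using assms by (intro lborel_integrable_real_affine integrable_normal_density) auto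
  then show ?B unfolding eq by simp
  have "char std_normal_distribution (- t / s) = of_real (exp (- ((- t / s)\<^sup>2) / 2))"
    by (simp add: char_std_normal_distribution)
  then have "(LINT x|lborel. std_normal_density x *\<^sub>R iexp ((- t / s) * x)) = of_real (exp (- ((- t / s)\<^sup>2) / 2))"
    unfolding char_def by (subst (asm) integral_density) (auto simp: normal_density_nonneg)
  then have *: "\<bar>s\<bar> *\<^sub>R (LINT x|lborel. std_normal_density (0 + s * x) *\<^sub>R iexp ((- t / s) * (0 + s * x)))
      = of_real (exp (- ((- t / s)\<^sup>2) / 2))"
    using assms by (subst (asm) lborel_integral_real_affine[where c = s and t = 0]) auto
  have "(LINT w|lborel. exp (- \<i> * of_real (t * w)) * of_real (exp (- (s\<^sup>2 * w\<^sup>2) / 2)))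
    = (LINT x|lborel. of_real (sqrt (2 * pi)) * (std_normal_density (0 + s * x) *\<^sub>R iexp ((- t / s) * (0 + s * x))))"
    unfolding eq using assms by (intro Bochner_Integration.integral_cong refl) (simp add: scaleR_conv_of_real mult_ac)
  also have "\<dots> = of_real (sqrt (2 * pi)) * (LINT x|lborel. std_normal_density (0 + s * x) *\<^sub>R iexp ((- t / s) * (0 + s * x)))"
    by (rule integral_mult_right_zero)
  also have "\<dots> = of_real (sqrt (2 * pi)) * (of_real (exp (- ((- t / s)\<^sup>2) / 2)) / of_real s)"
    using * assms by (simp add: scaleR_conv_of_real field_simps)
  also have "\<dots> = of_real (2 * pi * normal_density 0 s t)"
  proof -
    have "sqrt (2 * pi) * (exp (- ((- t / s)\<^sup>2) / 2) / s) = 2 * pi * normal_density 0 s t"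
      using assms by (simp add: normal_density_def real_sqrt_mult power_divide field_simps)
    then show ?thesis by (metis of_real_divide of_real_mult)
  qed
  finally show ?A .
qed

text \<open>
  Schur's test: a symmetric kernel that integrates to \<open>1\<close> in each variable does not increase the
  \<open>L\<^sup>2\<close> norm, because \<open>2 f x f y \<le> (f x)\<^sup>2 + (f y)\<^sup>2\<close>.
\<close>

lemma gaussian_Schur_bound:
  fixes f :: "real \<Rightarrow> real"
  assumes [measurable]: "f \<in> borel_measurable borel" and nn: "\<And>x. f x \<ge> 0" and s: "s > 0"
  shows "(\<integral>\<^sup>+x. \<integral>\<^sup>+y. ennreal (f x * f y * normal_density 0 s (x - y)) \<partial>lborel \<partial>lborel)
    \<le> (\<integral>\<^sup>+x. ennreal ((f x)\<^sup>2) \<partial>lborel)"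
proof -
  have N: "(\<integral>\<^sup>+y. ennreal (normal_density 0 s y) \<partial>lborel) = 1"
    using s by (subst nn_integral_eq_integral) auto
  have n1: "(\<integral>\<^sup>+y. ennreal (normal_density 0 s (x - y)) \<partial>lborel) = 1" for x
    using nn_integral_real_affine[of "\<lambda>y. ennreal (normal_density 0 s y)" "-1" x] N by simp
  have n2: "(\<integral>\<^sup>+x. ennreal (normal_density 0 s (x - y)) \<partial>lborel) = 1" for y
    using nn_integral_real_affine[of "\<lambda>y. ennreal (normal_density 0 s y)" 1 "-y"] N by simp
  let ?I = "\<integral>\<^sup>+x. ennreal ((f x)\<^sup>2) \<partial>lborel"
  have "(\<integral>\<^sup>+x. \<integral>\<^sup>+y. ennreal (f x * f y * normal_density 0 s (x - y)) \<partial>lborel \<partial>lborel)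
     \<le> (\<integral>\<^sup>+x. \<integral>\<^sup>+y. ennreal ((f x)\<^sup>2 / 2) * ennreal (normal_density 0 s (x - y)) +
           ennreal ((f y)\<^sup>2 / 2) * ennreal (normal_density 0 s (x - y)) \<partial>lborel \<partial>lborel)"
  proof (intro nn_integral_mono)
    fix x y
    have "f x * f y * normal_density 0 s (x - y) \<le> ((f x)\<^sup>2 / 2 + (f y)\<^sup>2 / 2) * normal_density 0 s (x - y)"
      using sum_squares_bound[of "f x" "f y"] by (intro mult_right_mono) auto
    then show "ennreal (f x * f y * normal_density 0 s (x - y)) \<le> ennreal ((f x)\<^sup>2 / 2) * ennreal (normal_density 0 s (x - y)) +
           ennreal ((f y)\<^sup>2 / 2) * ennreal (normal_density 0 s (x - y))"
      by (simp add: distrib_right flip: ennreal_mult ennreal_plus)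
  qed
  also have "\<dots> = (\<integral>\<^sup>+x. \<integral>\<^sup>+y. ennreal ((f x)\<^sup>2 / 2) * ennreal (normal_density 0 s (x - y)) \<partial>lborel \<partial>lborel) +
     (\<integral>\<^sup>+x. \<integral>\<^sup>+y. ennreal ((f y)\<^sup>2 / 2) * ennreal (normal_density 0 s (x - y)) \<partial>lborel \<partial>lborel)"
    by (subst nn_integral_add; (subst nn_integral_add)?) (auto intro!: nn_integral_cong)
  also have "(\<integral>\<^sup>+x. \<integral>\<^sup>+y. ennreal ((f y)\<^sup>2 / 2) * ennreal (normal_density 0 s (x - y)) \<partial>lborel \<partial>lborel)
     = (\<integral>\<^sup>+y. \<integral>\<^sup>+x. ennreal ((f y)\<^sup>2 / 2) * ennreal (normal_density 0 s (x - y)) \<partial>lborel \<partial>lborel)"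
    by (intro lborel_pair.Fubini') measurable
  also have "(\<integral>\<^sup>+x. \<integral>\<^sup>+y. ennreal ((f x)\<^sup>2 / 2) * ennreal (normal_density 0 s (x - y)) \<partial>lborel \<partial>lborel) +
     (\<integral>\<^sup>+y. \<integral>\<^sup>+x. ennreal ((f y)\<^sup>2 / 2) * ennreal (normal_density 0 s (x - y)) \<partial>lborel \<partial>lborel)
     = (\<integral>\<^sup>+x. ennreal ((f x)\<^sup>2 / 2) \<partial>lborel) + (\<integral>\<^sup>+y. ennreal ((f y)\<^sup>2 / 2) \<partial>lborel)"
    by (simp add: nn_integral_cmult n1 n2)
  also have "\<dots> = ?I"
    by (subst nn_integral_add[symmetric]) (auto simp flip: ennreal_plus)
  finally show ?thesis .
qed

lemma fourier_multiplication_formula: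
  assumes F: "integrable lborel F" and G: "integrable lborel G"
  shows "(LINT w|lborel. fourier F w * G w) = (LINT v|lborel. F v * fourier G v)"
proof -
  have [measurable]: "F \<in> borel_measurable borel" "G \<in> borel_measurable borel" using F G by auto
  define h where "h v w = exp (- \<i> * of_real (v * w)) * F v * G w" for v w
  have [measurable]: "(\<lambda>(v,w). h v w) \<in> borel_measurable (borel \<Otimes>\<^sub>M borel)"
    unfolding h_def by measurable
  have nh: "norm (h v w) = norm (F v) * norm (G w)" for v w by (simp add: h_def norm_mult)
  have "integrable (lborel \<Otimes>\<^sub>M lborel) (\<lambda>(v,w). h v w)"
  proof (rule lborel_pair.Fubini_integrable)
    show "integrable lborel (\<lambda>v. LINT w|lborel. norm (case (v, w) of (v, w) \<Rightarrow> h v w))"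
      using F by (simp add: nh)
    show "AE v in lborel. integrable lborel (\<lambda>w. case (v, w) of (v, w) \<Rightarrow> h v w)"
    proof (intro AE_I2)
      fix v
      show "integrable lborel (\<lambda>w. case (v, w) of (v, w) \<Rightarrow> h v w)"
        by (rule Bochner_Integration.integrable_bound[OF integrable_mult_right[OF G, of "F v"]])
          (auto simp: nh norm_mult)
    qed
  qed simp
  then have "(LINT w|lborel. LINT v|lborel. h v w) = (LINT v|lborel. LINT w|lborel. h v w)"
    by (rule lborel_pair.Fubini_integral)
  moreover have "(LINT v|lborel. h v w) = fourier F w * G w * of_real (sqrt (2 * pi))" for w
    by (simp add: h_def fourier_def)
  moreover have "(LINT w|lborel. h v w) = F v * fourier G v * of_real (sqrt (2 * pi))" for v
  proof -
    have "(LINT w|lborel. h v w) = (LINT w|lborel. F v * (exp (- \<i> * of_real (w * v)) * G w))"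
      by (intro Bochner_Integration.integral_cong) (auto simp: h_def mult_ac)
    then show ?thesis by (simp add: fourier_def)
  qed
  ultimately show ?thesis by simp
qed

text \<open>
  The Gaussian makes the left side an absolutely convergent double Fourier integral.  Moving the
  transform to the other factor twice leaves the quadratic form of \<open>F\<close> with a Gaussian density as
  kernel, which Schur's test bounds.
\<close>

lemma Plancherel_gaussian:
  assumes F: "integrable lborel F" and s: "s > 0"
  shows "(\<integral>\<^sup>+w. ennreal ((norm (fourier F w))\<^sup>2 * exp (- (s\<^sup>2 * w\<^sup>2) / 2)) \<partial>lborel)
    \<le> (\<integral>\<^sup>+x. ennreal ((norm (F x))\<^sup>2) \<partial>lborel)"
proof -
  have [measurable]: "F \<in> borel_measurable borel" using F by auto
  define g where "g w = exp (- (s\<^sup>2 * w\<^sup>2) / 2)" for w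
  define m where "m w = of_real (g w) * cnj (fourier F w)" for w
  have [measurable]: "g \<in> borel_measurable borel" by (simp add: g_def[abs_def])
  have g: "integrable lborel g" "\<And>w. g w \<ge> 0"
    unfolding g_def[abs_def] by (rule gaussian_fourier(2)[OF s]) simp
  define c where "c = (LINT v|lborel. norm (F v)) / sqrt (2 * pi)"
  have c: "norm (fourier F w) \<le> c" for w unfolding c_def by (rule norm_fourier_le[OF F])
  have c0: "c \<ge> 0" unfolding c_def by simp
  have [measurable]: "cnj \<in> borel_measurable borel"
    by (intro borel_measurable_continuous_onI continuous_intros)
  have [measurable]: "m \<in> borel_measurable borel" unfolding m_def[abs_def] by measurable
  have m: "integrable lborel m"
    by (rule Bochner_Integration.integrable_bound[OF integrable_mult_right[OF g(1), of c]])
      (auto simp: m_def norm_mult g c0 mult.commute[of c] intro!: mult_left_mono c)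
  have int: "integrable lborel (\<lambda>w. (norm (fourier F w))\<^sup>2 * g w)"
    by (rule Bochner_Integration.integrable_bound[OF integrable_mult_right[OF g(1), of "c\<^sup>2"]])
      (auto simp: norm_mult g c0 intro!: mult_right_mono power_mono c)
  define F' where "F' t = cnj (F (- t))" for t
  have F': "integrable lborel F'"
    unfolding F'_def using lborel_integrable_real_affine[OF F, of "-1" 0] by simp
  have cnjF: "cnj (fourier F w) = fourier F' w" for w
  proof -
    have "cnj (LINT v|lborel. exp (- \<i> * of_real (v * w)) * F v) = (LINT v|lborel. cnj (exp (- \<i> * of_real (v * w)) * F v))"
      by (rule Bochner_Integration.integral_cnj[symmetric])
    also have "\<dots> = (LINT v|lborel. exp (\<i> * of_real (v * w)) * cnj (F v))"
      by (simp add: exp_cnj)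
    also have "\<dots> = (LINT v|lborel. exp (- \<i> * of_real (v * w)) * F' v)"
      by (subst lborel_integral_real_affine[where c = "-1" and t = 0]) (auto simp: F'_def)
    finally show ?thesis by (simp add: fourier_def)
  qed
  have fm: "norm (fourier m v) \<le> (LINT t|lborel. norm (F' t) * normal_density 0 s (v + t))"
      "integrable lborel (\<lambda>t. norm (F' t) * normal_density 0 s (v + t))" for v
  proof -
    \<comment> \<open>The second application: \<open>fourier m v\<close> is an integral of \<open>fourier F'\<close> against a modulated Gaussian.\<close>
    define gv where "gv w = exp (- \<i> * of_real (v * w)) * of_real (g w)" for w
    have [measurable]: "gv \<in> borel_measurable borel" unfolding gv_def[abs_def] by measurable
    have gv: "integrable lborel gv"
      by (rule Bochner_Integration.integrable_bound[OF g(1)]) (auto simp: gv_def norm_mult g)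
    have fgv: "fourier gv t = of_real (sqrt (2 * pi) * normal_density 0 s (v + t))" for t
    proof -
      have "fourier gv t = (LINT w|lborel. exp (- \<i> * of_real ((v + t) * w)) * of_real (exp (- (s\<^sup>2 * w\<^sup>2) / 2))) / of_real (sqrt (2 * pi))"
      proof -
        have "exp (- \<i> * of_real ((v + t) * w)) = exp (- \<i> * of_real (w * t)) * exp (- \<i> * of_real (v * w))" for w
          by (subst exp_add[symmetric]) (simp add: algebra_simps)
        then show ?thesis unfolding fourier_def gv_def g_def by (simp only: mult.assoc)
      qed
      also have "\<dots> = of_real (2 * pi * normal_density 0 s (v + t)) / of_real (sqrt (2 * pi))"
        by (subst gaussian_fourier(1)[OF s]) simp
      also have "\<dots> = of_real (2 * pi * normal_density 0 s (v + t) / sqrt (2 * pi))" by simp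
      also have "2 * pi * normal_density 0 s (v + t) / sqrt (2 * pi) = (2 * pi / sqrt (2 * pi)) * normal_density 0 s (v + t)"
        by (simp only: times_divide_eq_left)
      also have "2 * pi / sqrt (2 * pi) = sqrt (2 * pi)"
        by (rule real_div_sqrt) simp
      finally show ?thesis .
    qed
    have "fourier m v * of_real (sqrt (2 * pi)) = (LINT w|lborel. fourier F' w * gv w)"
    proof -
      have "exp (- \<i> * of_real (w * v)) * m w = fourier F' w * gv w" for w
        unfolding m_def gv_def cnjF by (simp only: mult_ac)
      then show ?thesis unfolding fourier_def[of m] by (simp only: times_divide_eq_left) simp
    qed
    also have "\<dots> = (LINT t|lborel. F' t * fourier gv t)"
      by (rule fourier_multiplication_formula[OF F' gv])
    also have "\<dots> = (LINT t|lborel. (F' t * of_real (normal_density 0 s (v + t))) * of_real (sqrt (2 * pi)))"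
      unfolding fgv by (simp only: of_real_mult mult_ac)
    also have "\<dots> = (LINT t|lborel. F' t * of_real (normal_density 0 s (v + t))) * of_real (sqrt (2 * pi))"
      by (rule integral_mult_left_zero)
    finally have "fourier m v = (LINT t|lborel. F' t * of_real (normal_density 0 s (v + t)))"
      by simp
    then have "norm (fourier m v) \<le> (LINT t|lborel. norm (F' t * of_real (normal_density 0 s (v + t))))"
      by (simp add: integral_norm_bound)
    then show "norm (fourier m v) \<le> (LINT t|lborel. norm (F' t) * normal_density 0 s (v + t))"
      by (simp add: norm_mult)
    have [measurable]: "F' \<in> borel_measurable borel" using F' by auto
    show "integrable lborel (\<lambda>t. norm (F' t) * normal_density 0 s (v + t))"
    proof (rule Bochner_Integration.integrable_bound[OF integrable_mult_left[OF integrable_norm[OF F'], of "1 / sqrt (2 * pi * s\<^sup>2)"]])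
      have "normal_density 0 s x \<le> 1 / sqrt (2 * pi * s\<^sup>2)" for x
        unfolding normal_density_def by (intro mult_left_le) auto
      then show "AE t in lborel. norm (norm (F' t) * normal_density 0 s (v + t)) \<le> norm (norm (F' t) * (1 / sqrt (2 * pi * s\<^sup>2)))"
      proof (intro AE_I2)
        fix t
        have "norm (F' t) * normal_density 0 s (v + t) \<le> norm (F' t) * (1 / sqrt (2 * pi * s\<^sup>2))"
          by (intro mult_left_mono \<open>\<And>x. normal_density 0 s x \<le> 1 / sqrt (2 * pi * s\<^sup>2)\<close>) simp
        then show "norm (norm (F' t) * normal_density 0 s (v + t)) \<le> norm (norm (F' t) * (1 / sqrt (2 * pi * s\<^sup>2)))"
          by (simp add: abs_mult)
      qed
    qed measurable
  qed
  have eq: "complex_of_real ((norm (fourier F w))\<^sup>2 * g w) = fourier F w * m w" for w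
    unfolding m_def of_real_mult complex_norm_square by (simp only: mult_ac)
  have "(\<integral>\<^sup>+w. ennreal ((norm (fourier F w))\<^sup>2 * g w) \<partial>lborel) = ennreal (LINT w|lborel. (norm (fourier F w))\<^sup>2 * g w)"
    using int g by (intro nn_integral_eq_integral) auto
  also have "\<dots> \<le> ennreal (norm (LINT w|lborel. complex_of_real ((norm (fourier F w))\<^sup>2 * g w)))"
    by (intro ennreal_leI) (simp only: integral_complex_of_real norm_of_real abs_ge_self)
  also have "(LINT w|lborel. complex_of_real ((norm (fourier F w))\<^sup>2 * g w)) = (LINT v|lborel. F v * fourier m v)"
    unfolding eq by (rule fourier_multiplication_formula[OF F m])
  also have "ennreal (norm \<dots>) \<le> (\<integral>\<^sup>+v. norm (F v * fourier m v) \<partial>lborel)"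
  proof (cases "integrable lborel (\<lambda>v. F v * fourier m v)")
    case True
    then show ?thesis by (rule integral_norm_bound_ennreal)
  qed (simp add: not_integrable_integral_eq)
  also have "\<dots> \<le> (\<integral>\<^sup>+v. \<integral>\<^sup>+t. ennreal (norm (F v) * norm (F t) * normal_density 0 s (v - t)) \<partial>lborel \<partial>lborel)"
  proof (intro nn_integral_mono)
    fix v
    have "ennreal (norm (F v * fourier m v)) \<le> ennreal (norm (F v)) * ennreal (LINT t|lborel. norm (F' t) * normal_density 0 s (v + t))"
      using fm(1)[of v] by (simp add: norm_mult ennreal_mult' mult_left_mono ennreal_leI)
    also have "\<dots> = ennreal (norm (F v)) * (\<integral>\<^sup>+t. ennreal (norm (F' t) * normal_density 0 s (v + t)) \<partial>lborel)"
      using fm(2)[of v] by (subst nn_integral_eq_integral) auto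
    also have "(\<integral>\<^sup>+t. ennreal (norm (F' t) * normal_density 0 s (v + t)) \<partial>lborel) = (\<integral>\<^sup>+t. ennreal (norm (F t) * normal_density 0 s (v - t)) \<partial>lborel)"
      by (subst nn_integral_real_affine[where c = "-1" and t = 0]) (auto simp: F'_def)
    also have "ennreal (norm (F v)) * (\<integral>\<^sup>+t. ennreal (norm (F t) * normal_density 0 s (v - t)) \<partial>lborel) =
        (\<integral>\<^sup>+t. ennreal (norm (F v) * norm (F t) * normal_density 0 s (v - t)) \<partial>lborel)"
      by (subst nn_integral_cmult[symmetric]) (auto simp: mult.assoc simp flip: ennreal_mult)
    finally show "ennreal (norm (F v * fourier m v)) \<le> (\<integral>\<^sup>+t. ennreal (norm (F v) * norm (F t) * normal_density 0 s (v - t)) \<partial>lborel)" .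
  qed
  also have "\<dots> \<le> (\<integral>\<^sup>+x. ennreal ((norm (F x))\<^sup>2) \<partial>lborel)"
    by (rule gaussian_Schur_bound) (use s in auto)
  finally show ?thesis by (simp add: g_def)
qed

text \<open>
  The Gaussian tends to \<open>1\<close> as its width grows, so Fatou's lemma removes it.
\<close>

lemma Plancherel_le:
  assumes F: "integrable lborel F"
  shows "(\<integral>\<^sup>+w. ennreal ((norm (fourier F w))\<^sup>2) \<partial>lborel) \<le> (\<integral>\<^sup>+x. ennreal ((norm (F x))\<^sup>2) \<partial>lborel)"
proof -
  have [measurable]: "F \<in> borel_measurable borel" using F by auto
  define s :: "nat \<Rightarrow> real" where "s n = 1 / (Suc n)" for n
  have s: "s \<longlonglongrightarrow> 0" unfolding s_def by (rule LIMSEQ_Suc) (rule lim_1_over_n)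
  have "(\<integral>\<^sup>+w. ennreal ((norm (fourier F w))\<^sup>2) \<partial>lborel)
     = (\<integral>\<^sup>+w. liminf (\<lambda>n. ennreal ((norm (fourier F w))\<^sup>2 * exp (- ((s n)\<^sup>2 * w\<^sup>2) / 2))) \<partial>lborel)"
  proof (intro nn_integral_cong)
    fix w
    have "(\<lambda>n. ennreal ((norm (fourier F w))\<^sup>2 * exp (- ((s n)\<^sup>2 * w\<^sup>2) / 2))) \<longlonglongrightarrow> ennreal ((norm (fourier F w))\<^sup>2 * exp (- (0\<^sup>2 * w\<^sup>2) / 2))"
      by (intro tendsto_intros s) auto
    then show "ennreal ((norm (fourier F w))\<^sup>2) = liminf (\<lambda>n. ennreal ((norm (fourier F w))\<^sup>2 * exp (- ((s n)\<^sup>2 * w\<^sup>2) / 2)))"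
      by (intro lim_imp_Liminf[symmetric]) auto
  qed
  also have "\<dots> \<le> liminf (\<lambda>n. \<integral>\<^sup>+w. ennreal ((norm (fourier F w))\<^sup>2 * exp (- ((s n)\<^sup>2 * w\<^sup>2) / 2)) \<partial>lborel)"
    by (intro nn_integral_liminf) measurable
  also have "\<dots> \<le> (\<integral>\<^sup>+x. ennreal ((norm (F x))\<^sup>2) \<partial>lborel)"
    using Plancherel_gaussian[OF F, of "s _"] by (intro Liminf_le always_eventually) (simp_all add: s_def)
  finally show ?thesis .
qed

section \<open>The Hausdorff--Young inequality for vector-valued functions\<close>

text \<open>
  The pairing is bilinear rather than sesquilinear: in the interpolation argument it has to be
  holomorphic in both arguments.
\<close>

definition cdot :: "complex ^ 'm \<Rightarrow> complex ^ 'm \<Rightarrow> complex" where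
  "cdot x y = (\<Sum>i\<in>UNIV. x $ i * y $ i)"

lemma norm_cdot_le: "norm (cdot x y) \<le> norm x * norm y"
proof -
  have "norm (cdot x y) \<le> (\<Sum>i\<in>UNIV. \<bar>norm (x $ i)\<bar> * \<bar>norm (y $ i)\<bar>)"
    unfolding cdot_def by (rule order_trans[OF norm_sum]) (simp add: norm_mult)
  also have "\<dots> \<le> norm x * norm y" unfolding norm_vec_def by (rule L2_set_mult_ineq)
  finally show ?thesis .
qed

lemma norm_vec_sq: "(norm (x :: complex ^ 'm))\<^sup>2 = (\<Sum>i\<in>UNIV. (norm (x $ i))\<^sup>2)"
  by (simp add: norm_vec_def L2_set_def sum_nonneg)

lemma cdot_cnj: "cdot x (\<chi> i. cnj (x $ i)) = of_real ((norm x)\<^sup>2)"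
  unfolding norm_vec_sq cdot_def of_real_sum complex_norm_square by simp

lemma norm_vec_cnj: "norm (\<chi> i. cnj (x $ i)) = norm (x :: complex ^ 'm)"
  by (simp add: norm_vec_def)

lemma norm_vector_smult: "norm (c *s x) = norm c * norm (x :: complex ^ 'm)"
  by (simp add: norm_vec_def vector_scalar_mult_def norm_mult L2_set_right_distrib)

lemma vec_nth_measurable [measurable]: "(\<lambda>x :: complex ^ 'm. x $ i) \<in> borel_measurable borel"
  by (intro borel_measurable_continuous_onI continuous_intros)

text \<open>
  The vector is a finite combination of real coordinates times fixed basis vectors.
\<close>

lemma vec_lambda_measurable [measurable (raw)]:
  fixes f :: "'a \<Rightarrow> 'm::finite \<Rightarrow> complex"
  assumes "\<And>i. (\<lambda>x. f x i) \<in> borel_measurable M"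
  shows "(\<lambda>x. (\<chi> i. f x i)) \<in> borel_measurable M"
proof -
  have "(\<lambda>x. (\<chi> i. f x i)) = (\<lambda>x. \<Sum>i\<in>UNIV. Re (f x i) *\<^sub>R axis i 1 + Im (f x i) *\<^sub>R axis i \<i>)"
    by (auto simp: fun_eq_iff vec_eq_iff axis_def if_distrib sum.distrib complex_eq_iff cong: if_cong)
  moreover have "\<dots> \<in> borel_measurable M"
    by (intro borel_measurable_sum borel_measurable_add borel_measurable_scaleR borel_measurable_const
        measurable_compose[OF assms]) auto
  ultimately show ?thesis by simp
qed

lemma integrable_vec_nth [intro]:
  fixes F :: "'a \<Rightarrow> complex ^ 'm"
  shows "integrable M F \<Longrightarrow> integrable M (\<lambda>v. F v $ i)"
  by (rule integrable_bounded_linear[OF bounded_linear_vec_nth])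

definition vfourier :: "(real \<Rightarrow> complex ^ 'm) \<Rightarrow> real \<Rightarrow> complex ^ 'm" where
  "vfourier F w = (\<chi> i. fourier (\<lambda>v. F v $ i) w)"

lemma vfourier_measurable [measurable]:
  assumes [measurable]: "F \<in> borel_measurable borel"
  shows "vfourier F \<in> borel_measurable borel"
  unfolding vfourier_def[abs_def] by measurable

text \<open>
  Written as one vector-valued integral, the transform satisfies the triangle inequality for
  integrals without a loss depending on the dimension.
\<close>

lemma norm_vfourier_le:
  assumes F: "integrable lborel F"
  shows "norm (vfourier F w) \<le> (LINT v|lborel. norm (F v)) / sqrt (2 * pi)"
proof -
  define H where "H v = exp (- \<i> * of_real (v * w)) *s F v" for v
  have [measurable]: "F \<in> borel_measurable borel" using F by auto
  have nH: "norm (H v) = norm (F v)" for v by (simp add: H_def norm_vector_smult)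
  have "H \<in> borel_measurable borel" unfolding H_def[abs_def] vector_scalar_mult_def by measurable
  then have H: "integrable lborel H"
    by (intro Bochner_Integration.integrable_bound[OF F]) (auto simp: nH)
  have "vfourier F w = (1 / sqrt (2 * pi)) *\<^sub>R (LINT v|lborel. H v)"
  proof (subst vec_eq_iff, intro allI)
    fix i
    have "(LINT v|lborel. H v) $ i = (LINT v|lborel. H v $ i)"
      by (rule integral_bounded_linear[OF bounded_linear_vec_nth H, symmetric])
    then show "vfourier F w $ i = ((1 / sqrt (2 * pi)) *\<^sub>R (LINT v|lborel. H v)) $ i"
      by (simp add: vfourier_def fourier_def H_def) (simp add: scaleR_conv_of_real)
  qed
  then have "norm (vfourier F w) = norm (LINT v|lborel. H v) / sqrt (2 * pi)" by simp
  also have "\<dots> \<le> (LINT v|lborel. norm (H v)) / sqrt (2 * pi)"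
    by (intro divide_right_mono integral_norm_bound) simp
  finally show ?thesis by (simp add: nH)
qed

lemma norm_vfourier_le':
  assumes F: "integrable lborel F"
  shows "norm (vfourier F w) \<le> (LINT v|lborel. norm (F v))"
proof -
  have "sqrt (2 * pi) \<ge> 1" using pi_ge_two by (intro real_le_rsqrt) auto
  then have "(LINT v|lborel. norm (F v)) / sqrt (2 * pi) \<le> (LINT v|lborel. norm (F v)) / 1"
    by (intro divide_left_mono) auto
  then show ?thesis using norm_vfourier_le[OF F, of w] by simp
qed

lemma vPlancherel_le:
  fixes F :: "real \<Rightarrow> complex ^ 'm"
  assumes F: "integrable lborel F"
  shows "(\<integral>\<^sup>+w. ennreal ((norm (vfourier F w))\<^sup>2) \<partial>lborel) \<le> (\<integral>\<^sup>+x. ennreal ((norm (F x))\<^sup>2) \<partial>lborel)"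
proof -
  have [measurable]: "F \<in> borel_measurable borel" using F by auto
  have "(\<integral>\<^sup>+w. ennreal ((norm (vfourier F w))\<^sup>2) \<partial>lborel) = (\<Sum>i\<in>UNIV. \<integral>\<^sup>+w. ennreal ((norm (fourier (\<lambda>v. F v $ i) w))\<^sup>2) \<partial>lborel)"
    by (subst nn_integral_sum[symmetric]) (auto simp: norm_vec_sq vfourier_def simp flip: sum_ennreal)
  also have "\<dots> \<le> (\<Sum>i\<in>UNIV. \<integral>\<^sup>+x. ennreal ((norm (F x $ i))\<^sup>2) \<partial>lborel)"
    by (intro sum_mono Plancherel_le integrable_vec_nth F)
  also have "\<dots> = (\<integral>\<^sup>+x. ennreal ((norm (F x))\<^sup>2) \<partial>lborel)"
    by (subst nn_integral_sum[symmetric]) (auto simp: norm_vec_sq simp flip: sum_ennreal)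
  finally show ?thesis .
qed

definition fourier_form :: "(real \<Rightarrow> complex ^ 'm) \<Rightarrow> (real \<Rightarrow> complex ^ 'm) \<Rightarrow> complex" where
  "fourier_form F G = (LINT w|lborel. cdot (vfourier F w) (G w))"

lemma cdot_measurable [measurable (raw)]:
  assumes [measurable]: "f \<in> borel_measurable M" "g \<in> borel_measurable M"
  shows "(\<lambda>x. cdot (f x) (g x)) \<in> borel_measurable M"
  unfolding cdot_def by measurable

lemma integrable_fourier_form:
  assumes F: "integrable lborel F" and G: "integrable lborel G"
  shows "integrable lborel (\<lambda>w. cdot (vfourier F w) (G w))"
proof -
  have [measurable]: "F \<in> borel_measurable borel" "G \<in> borel_measurable borel" using F G by auto
  have "AE w in lborel. norm (cdot (vfourier F w) (G w)) \<le> norm ((LINT v|lborel. norm (F v)) * norm (G w))"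
    by (intro AE_I2 order_trans[OF norm_cdot_le]) (auto simp: abs_mult intro!: mult_right_mono norm_vfourier_le' F)
  then show ?thesis
    by (rule Bochner_Integration.integrable_bound[OF integrable_mult_right[OF integrable_norm[OF G]], rotated]) measurable
qed

lemma fourier_form_L1:
  assumes F: "integrable lborel F" and G: "integrable lborel G"
  shows "norm (fourier_form F G) \<le> (LINT v|lborel. norm (F v)) * (LINT w|lborel. norm (G w))"
proof -
  have "norm (fourier_form F G) \<le> (LINT w|lborel. norm (cdot (vfourier F w) (G w)))"
    unfolding fourier_form_def by (rule integral_norm_bound)
  also have "\<dots> \<le> (LINT w|lborel. (LINT v|lborel. norm (F v)) * norm (G w))"
    using F G by (intro integral_mono integrable_norm integrable_fourier_form integrable_mult_right
      order_trans[OF norm_cdot_le] mult_right_mono norm_vfourier_le') auto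
  finally show ?thesis by simp
qed

lemma fourier_form_L2:
  assumes F: "integrable lborel F" and G: "integrable lborel G"
    and F2: "integrable lborel (\<lambda>v. (norm (F v))\<^sup>2)" and G2: "integrable lborel (\<lambda>v. (norm (G v))\<^sup>2)"
  shows "norm (fourier_form F G) \<le> sqrt (LINT v|lborel. (norm (F v))\<^sup>2) * sqrt (LINT w|lborel. (norm (G w))\<^sup>2)"
proof -
  have [measurable]: "F \<in> borel_measurable borel" "G \<in> borel_measurable borel" using F G by auto
  have "ennreal (norm (fourier_form F G)) \<le> (\<integral>\<^sup>+w. norm (cdot (vfourier F w) (G w)) \<partial>lborel)"
    unfolding fourier_form_def by (intro integral_norm_bound_ennreal integrable_fourier_form F G)
  also have "\<dots> \<le> (\<integral>\<^sup>+w. ennreal (norm (vfourier F w) * norm (G w)) \<partial>lborel)"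
    by (intro nn_integral_mono ennreal_leI norm_cdot_le)
  also have "\<dots> \<le> ennreal (sqrt (LINT v|lborel. (norm (F v))\<^sup>2) * sqrt (LINT w|lborel. (norm (G w))\<^sup>2))"
  proof (rule nn_integral_Holder[where r = 2 and s = 2])
    show "(\<integral>\<^sup>+w. ennreal (norm (vfourier F w) powr 2) \<partial>lborel) \<le> ennreal (sqrt (LINT v|lborel. (norm (F v))\<^sup>2) powr 2)"
      using vPlancherel_le[OF F] by (simp add: nn_integral_eq_integral[OF F2])
    show "(\<integral>\<^sup>+w. ennreal (norm (G w) powr 2) \<partial>lborel) \<le> ennreal (sqrt (LINT v|lborel. (norm (G v))\<^sup>2) powr 2)"
      by (simp add: nn_integral_eq_integral[OF G2])
  qed auto
  finally show ?thesis by simp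
qed

text \<open>
  A function of a simple function is integrated by summing over its nonzero values, whose level sets
  have finite measure by integrability.
\<close>

lemma integral_simple_comp:
  fixes F :: "'a \<Rightarrow> 'v :: {banach, second_countable_topology}" and \<phi> :: "'v \<Rightarrow> 'b :: {banach, second_countable_topology}"
  assumes sF: "simple_function M F" and F: "integrable M F" and 0: "\<phi> 0 = 0"
  defines "S \<equiv> F ` space M - {0}"
  shows "integrable M (\<lambda>v. \<phi> (F v))"
    and "(LINT v|M. \<phi> (F v)) = (\<Sum>x\<in>S. measure M (F -` {x} \<inter> space M) *\<^sub>R \<phi> x)"
proof -
  let ?E = "\<lambda>x. F -` {x} \<inter> space M"
  have fin: "finite S" using sF by (simp add: S_def simple_functionD)
  have E: "?E x \<in> sets M" for x using sF by (rule simple_functionD)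
  have fE: "emeasure M (?E x) < \<infinity>" if "x \<noteq> 0" for x
  proof -
    have "emeasure M (?E x) * ennreal (norm x) = (\<integral>\<^sup>+v. ennreal (norm x) * indicator (?E x) v \<partial>M)"
      using E by (simp add: nn_integral_cmult_indicator mult.commute)
    also have "\<dots> \<le> (\<integral>\<^sup>+v. ennreal (norm (F v)) \<partial>M)"
      by (intro nn_integral_mono) (auto simp: indicator_def)
    also have "\<dots> < \<infinity>" using F unfolding integrable_iff_bounded by blast
    finally show ?thesis using that by (auto simp: ennreal_mult_less_top)
  qed
  have eq: "\<phi> (F v) = (\<Sum>x\<in>S. indicator (?E x) v *\<^sub>R \<phi> x)" if "v \<in> space M" for v
  proof (cases "F v = 0")
    case True
    then have "(\<Sum>x\<in>S. indicator (?E x) v *\<^sub>R \<phi> x) = 0"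
      by (intro sum.neutral) (auto simp: S_def indicator_def)
    then show ?thesis using True 0 by simp
  next
    case False
    have "(\<Sum>x\<in>S. indicator (?E x) v *\<^sub>R \<phi> x) = (\<Sum>x\<in>S. if x = F v then \<phi> (F v) else 0)"
      using that by (intro sum.cong) (auto simp: indicator_def)
    also have "\<dots> = \<phi> (F v)" using False fin that by (simp add: S_def)
    finally show ?thesis ..
  qed
  have int: "integrable M (\<lambda>v. indicator (?E x) v *\<^sub>R \<phi> x)" if "x \<in> S" for x
    using E fE[of x] that by (intro integrable_indicator integrable_scaleR_left integrable_real_indicator) (auto simp: S_def)
  then have "integrable M (\<lambda>v. \<Sum>x\<in>S. indicator (?E x) v *\<^sub>R \<phi> x)" by auto
  then show "integrable M (\<lambda>v. \<phi> (F v))"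
    by (subst Bochner_Integration.integrable_cong[OF refl eq])
  have "(LINT v|M. \<phi> (F v)) = (LINT v|M. (\<Sum>x\<in>S. indicator (?E x) v *\<^sub>R \<phi> x))"
    by (intro Bochner_Integration.integral_cong refl eq)
  also have "\<dots> = (\<Sum>x\<in>S. LINT v|M. indicator (?E x) v *\<^sub>R \<phi> x)"
    by (rule Bochner_Integration.integral_sum[OF int])
  also have "\<dots> = (\<Sum>x\<in>S. measure M (?E x) *\<^sub>R \<phi> x)"
  proof (intro sum.cong refl)
    fix x assume "x \<in> S"
    then have "integrable M (indicator (?E x) :: _ \<Rightarrow> real)"
      using E fE[of x] by (intro integrable_real_indicator) (auto simp: S_def)
    then have "(LINT v|M. indicator (?E x) v *\<^sub>R \<phi> x) = (LINT v|M. indicator (?E x) v) *\<^sub>R \<phi> x"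
      by (intro integral_scaleR_left)
    then show "(LINT v|M. indicator (?E x) v *\<^sub>R \<phi> x) = measure M (?E x) *\<^sub>R \<phi> x"
      by (simp add: Int_assoc)
  qed
  finally show "(LINT v|M. \<phi> (F v)) = (\<Sum>x\<in>S. measure M (?E x) *\<^sub>R \<phi> x)" .
qed

text \<open>
  A simple function is determined by its level sets, the directions of its values and their moduli.
  Keeping level sets and directions fixed and varying only the moduli makes the Fourier pairing a
  scalar bilinear form in finitely many variables, so the vector-valued estimate reduces to scalar
  Riesz--Thorin interpolation.
\<close>

lemma Hausdorff_Young_form_simple:
  fixes F G :: "real \<Rightarrow> complex ^ 'm"
  assumes sF: "simple_function lborel F" and F: "integrable lborel F"
    and sG: "simple_function lborel G" and G: "integrable lborel G"
    and p: "1 \<le> p" "p \<le> 2"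
  shows "norm (fourier_form F G) \<le>
    (LINT v|lborel. norm (F v) powr p) powr (1 / p) * (LINT w|lborel. norm (G w) powr p) powr (1 / p)"
proof -
  define S where "S = F ` space lborel - {0}"
  define T where "T = G ` space lborel - {0}"
  define EF where "EF x = F -` {x} \<inter> space lborel" for x
  define EG where "EG x = G -` {x} \<inter> space lborel" for x
  define \<mu> where "\<mu> x = measure lborel (EF x)" for x
  define \<nu> where "\<nu> x = measure lborel (EG x)" for x
  define U :: "(complex ^ 'm \<Rightarrow> complex) \<Rightarrow> complex ^ 'm \<Rightarrow> complex ^ 'm"
    where
    \<comment> \<open>The direction of \<open>x\<close> with modulus \<open>a x\<close>; the value at \<open>0\<close> has no direction and must stay \<open>0\<close>.\<close>
    "U a x = (if x = 0 then 0 else (a x / of_real (norm x)) *s x)" for a x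
  have fin: "finite S" "finite T" using simple_functionD(1)[OF sF] simple_functionD(1)[OF sG] by (simp_all add: S_def T_def)
  have nU: "norm (U a x) = (if x = 0 then 0 else norm (a x))" for a x
    by (simp add: U_def norm_vector_smult norm_divide)
  have U0: "U a 0 = 0" for a by (simp add: U_def)
  note simpF = integral_simple_comp[OF sF F, folded S_def EF_def \<mu>_def]
  note simpG = integral_simple_comp[OF sG G, folded T_def EG_def \<nu>_def]
  have intU: "integrable lborel (\<lambda>v. U a (F v))" "integrable lborel (\<lambda>v. U a (G v))" for a
    by (rule simpF simpG; rule U0)+
  define c where "c x y = (LINT w|lborel. fourier (\<lambda>v. indicator (EF x) v) w * indicator (EG y) w)" for x y
  define K where "K x y = c x y * cdot x y / of_real (norm x * norm y)" for x y
  have form: "fourier_form (\<lambda>v. U a (F v)) (\<lambda>w. U b (G w)) = (\<Sum>x\<in>S. \<Sum>y\<in>T. K x y * a x * b y)" for a b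
  proof -
    have iF: "integrable lborel (\<lambda>v. indicator (EF x) v :: complex)" if "x \<in> S" for x
    proof -
      have "integrable lborel (\<lambda>v. if F v = 0 then 0 else if F v = x then 1 else 0 :: complex)"
        by (rule simpF(1)) simp
      then show ?thesis
        by (rule Bochner_Integration.integrable_cong[THEN iffD1, rotated 2])
          (use that in \<open>auto simp: EF_def S_def indicator_def\<close>)
    qed
    have iG: "integrable lborel (\<lambda>v. indicator (EG x) v :: complex)" if "x \<in> T" for x
    proof -
      have "integrable lborel (\<lambda>v. if G v = 0 then 0 else if G v = x then 1 else 0 :: complex)"
        by (rule simpG(1)) simp
      then show ?thesis
        by (rule Bochner_Integration.integrable_cong[THEN iffD1, rotated 2])
          (use that in \<open>auto simp: EG_def T_def indicator_def\<close>)
    qed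
    have UF: "U a (F v) $ i = (\<Sum>x\<in>S. indicator (EF x) v * U a x $ i)" for v i
    proof -
      have "(\<Sum>x\<in>S. indicator (EF x) v * U a x $ i) = (\<Sum>x\<in>S. if x = F v then U a (F v) $ i else 0)"
        by (intro sum.cong) (auto simp: indicator_def EF_def)
      also have "\<dots> = U a (F v) $ i" using fin by (auto simp: S_def U0)
      finally show ?thesis ..
    qed
    have UG: "U b (G v) $ i = (\<Sum>x\<in>T. indicator (EG x) v * U b x $ i)" for v i
    proof -
      have "(\<Sum>x\<in>T. indicator (EG x) v * U b x $ i) = (\<Sum>x\<in>T. if x = G v then U b (G v) $ i else 0)"
        by (intro sum.cong) (auto simp: indicator_def EG_def)
      also have "\<dots> = U b (G v) $ i" using fin by (auto simp: T_def U0)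
      finally show ?thesis ..
    qed
    have fUF: "fourier (\<lambda>v. U a (F v) $ i) w = (\<Sum>x\<in>S. fourier (\<lambda>v. indicator (EF x) v) w * U a x $ i)" for i w
    proof -
      have "(LINT v|lborel. exp (- \<i> * of_real (v * w)) * U a (F v) $ i)
         = (LINT v|lborel. (\<Sum>x\<in>S. exp (- \<i> * of_real (v * w)) * indicator (EF x) v * U a x $ i))"
        by (simp add: UF sum_distrib_left mult.assoc)
      also have "\<dots> = (\<Sum>x\<in>S. (LINT v|lborel. exp (- \<i> * of_real (v * w)) * indicator (EF x) v * U a x $ i))"
        using integrable_fourier_kernel[OF iF, of _ w]
        by (intro Bochner_Integration.integral_sum integrable_mult_left) simp
      finally show ?thesis by (simp add: fourier_def sum_divide_distrib)
    qed
    have "cdot (vfourier (\<lambda>v. U a (F v)) w) (U b (G w))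
        = (\<Sum>i\<in>UNIV. (\<Sum>x\<in>S. fourier (\<lambda>v. indicator (EF x) v) w * U a x $ i) * (\<Sum>y\<in>T. indicator (EG y) w * U b y $ i))" for w
      by (simp add: cdot_def vfourier_def fUF UG)
    also have "\<dots> w = (\<Sum>i\<in>UNIV. \<Sum>x\<in>S. \<Sum>y\<in>T. fourier (\<lambda>v. indicator (EF x) v) w * indicator (EG y) w * (U a x $ i * U b y $ i))" for w
      unfolding sum_product by (intro sum.cong refl) (simp only: mult_ac)
    also have "\<dots> w = (\<Sum>x\<in>S. \<Sum>y\<in>T. fourier (\<lambda>v. indicator (EF x) v) w * indicator (EG y) w * cdot (U a x) (U b y))" for w
      by (subst sum.swap, intro sum.cong refl, subst sum.swap) (simp add: cdot_def sum_distrib_left)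
    finally have "fourier_form (\<lambda>v. U a (F v)) (\<lambda>w. U b (G w))
      = (LINT w|lborel. (\<Sum>x\<in>S. \<Sum>y\<in>T. fourier (\<lambda>v. indicator (EF x) v) w * indicator (EG y) w * cdot (U a x) (U b y)))"
      by (simp add: fourier_form_def)
    also have "\<dots> = (\<Sum>x\<in>S. \<Sum>y\<in>T. (LINT w|lborel. fourier (\<lambda>v. indicator (EF x) v) w * indicator (EG y) w * cdot (U a x) (U b y)))"
    proof -
      have "integrable lborel (\<lambda>w. fourier (\<lambda>v. indicator (EF x) v) w * indicator (EG y) w)" if "x \<in> S" "y \<in> T" for x y
      proof (rule Bochner_Integration.integrable_bound[OF integrable_mult_right[OF iG[OF that(2)]]])
        have "(\<lambda>v. indicator (EF x) v :: complex) \<in> borel_measurable borel" "(\<lambda>v. indicator (EG y) v :: complex) \<in> borel_measurable borel"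
          using iF[OF that(1)] iG[OF that(2)] by auto
        then show "(\<lambda>w. fourier (\<lambda>v. indicator (EF x) v) w * indicator (EG y) w) \<in> borel_measurable lborel"
          by measurable
        show "AE w in lborel. norm (fourier (\<lambda>v. indicator (EF x) v) w * indicator (EG y) w :: complex) \<le>
          norm (of_real ((LINT v|lborel. norm (indicator (EF x) v :: complex)) / sqrt (2 * pi)) * indicator (EG y) w :: complex)"
          using norm_fourier_le[OF iF[OF that(1)]] unfolding norm_mult norm_of_real
          by (intro AE_I2 mult_right_mono order_trans[OF _ abs_ge_self]) auto
      qed
      then show ?thesis
        by (subst Bochner_Integration.integral_sum, fastforce, intro sum.cong refl Bochner_Integration.integral_sum) auto
    qed
    also have "\<dots> = (\<Sum>x\<in>S. \<Sum>y\<in>T. K x y * a x * b y)"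
    proof (intro sum.cong refl)
      fix x y assume xy: "x \<in> S" "y \<in> T"
      have "cdot (U a x) (U b y) = cdot x y / of_real (norm x * norm y) * a x * b y"
        using xy by (simp add: S_def T_def U_def cdot_def sum_distrib_left sum_divide_distrib mult_ac)
      then show "(LINT w|lborel. fourier (\<lambda>v. indicator (EF x) v) w * indicator (EG y) w * cdot (U a x) (U b y)) = K x y * a x * b y"
        by (simp add: K_def c_def)
    qed
    finally show ?thesis .
  qed
  have ev: "(LINT v|lborel. h (norm (U a (F v)))) = (\<Sum>x\<in>S. \<mu> x * h (norm (a x)))"
      "(LINT v|lborel. h (norm (U a (G v)))) = (\<Sum>x\<in>T. \<nu> x * h (norm (a x)))"
      "integrable lborel (\<lambda>v. h (norm (U a (F v))))"
      "integrable lborel (\<lambda>v. h (norm (U a (G v))))" if "h 0 = 0" for a and h :: "real \<Rightarrow> real"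
  proof -
    let ?\<phi> = "\<lambda>x. h (norm (U a x))"
    have 0: "?\<phi> 0 = 0" using that by (simp add: U0)
    show "(LINT v|lborel. h (norm (U a (F v)))) = (\<Sum>x\<in>S. \<mu> x * h (norm (a x)))"
      by (subst simpF(2)[of ?\<phi>, OF 0]) (auto simp: nU S_def intro!: sum.cong)
    show "(LINT v|lborel. h (norm (U a (G v)))) = (\<Sum>x\<in>T. \<nu> x * h (norm (a x)))"
      by (subst simpG(2)[of ?\<phi>, OF 0]) (auto simp: nU T_def intro!: sum.cong)
    show "integrable lborel (\<lambda>v. h (norm (U a (F v))))" by (rule simpF(1)[of ?\<phi>, OF 0])
    show "integrable lborel (\<lambda>v. h (norm (U a (G v))))" by (rule simpG(1)[of ?\<phi>, OF 0])
  qed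
  have U_norm: "U (\<lambda>x. of_real (norm x)) x = x" for x by (simp add: U_def)
  have "norm (\<Sum>x\<in>S. \<Sum>y\<in>T. K x y * of_real (norm x) * of_real (norm y))
    \<le> (\<Sum>x\<in>S. \<mu> x * norm x powr p) powr (1 / p) * (\<Sum>y\<in>T. \<nu> y * norm y powr p) powr (1 / p)"
  proof (rule Riesz_Thorin_finite[OF fin _ _ _ _ _ _ p])
    show "norm (\<Sum>s\<in>S. \<Sum>t\<in>T. K s t * a s * b t) \<le> (\<Sum>s\<in>S. \<mu> s * norm (a s)) * (\<Sum>t\<in>T. \<nu> t * norm (b t))" for a b
      using fourier_form_L1[OF intU(1)[of a] intU(2)[of b]] ev(1)[of "\<lambda>x. x" a] ev(2)[of "\<lambda>x. x" b] by (simp add: form)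
    show "norm (\<Sum>s\<in>S. \<Sum>t\<in>T. K s t * a s * b t) \<le> sqrt (\<Sum>s\<in>S. \<mu> s * (norm (a s))\<^sup>2) * sqrt (\<Sum>t\<in>T. \<nu> t * (norm (b t))\<^sup>2)" for a b
      using fourier_form_L2[OF intU(1)[of a] intU(2)[of b] ev(3)[of "\<lambda>x. x\<^sup>2" a] ev(4)[of "\<lambda>x. x\<^sup>2" b]]
        ev(1)[of "\<lambda>x. x\<^sup>2" a] ev(2)[of "\<lambda>x. x\<^sup>2" b] by (simp add: form)
  qed (auto simp: S_def T_def \<mu>_def \<nu>_def)
  moreover have "fourier_form F G = (\<Sum>x\<in>S. \<Sum>y\<in>T. K x y * of_real (norm x) * of_real (norm y))"
    using form[of "\<lambda>x. of_real (norm x)" "\<lambda>x. of_real (norm x)"] by (simp add: U_norm)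
  moreover have "(LINT v|lborel. norm (F v) powr p) = (\<Sum>x\<in>S. \<mu> x * norm x powr p)"
    using ev(1)[of "\<lambda>x. x powr p" "\<lambda>x. of_real (norm x)"] by (simp add: U_norm)
  moreover have "(LINT v|lborel. norm (G v) powr p) = (\<Sum>x\<in>T. \<nu> x * norm x powr p)"
    using ev(2)[of "\<lambda>x. x powr p" "\<lambda>x. of_real (norm x)"] by (simp add: U_norm)
  ultimately show ?thesis by simp
qed

text \<open>
  One sequence of simple functions that converges both in \<open>L\<^sup>1\<close>, which makes the Fourier transforms
  converge pointwise, and in \<open>L\<^sup>p\<close> norm.
\<close>

lemma integrable_simple_approx:
  fixes F :: "real \<Rightarrow> complex ^ 'm"
  assumes F: "integrable lborel F" and Fp: "integrable lborel (\<lambda>v. norm (F v) powr p)" and p: "1 \<le> p"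
  obtains s where "\<And>n. simple_function lborel (s n)" "\<And>n. integrable lborel (s n)"
    "\<And>v. (\<lambda>n. s n v) \<longlonglongrightarrow> F v" "\<And>n v. norm (s n v) \<le> 2 * norm (F v)"
    "(\<lambda>n. (LINT v|lborel. norm (s n v - F v))) \<longlonglongrightarrow> 0"
    "(\<lambda>n. (LINT v|lborel. norm (s n v) powr p)) \<longlonglongrightarrow> (LINT v|lborel. norm (F v) powr p)"
proof -
  have [measurable]: "F \<in> borel_measurable borel" using F by auto
  then have "F \<in> borel_measurable lborel" by simp
  from borel_measurable_implies_sequence_metric[OF this, of 0] obtain s where
    s: "\<And>n. simple_function lborel (s n)" "\<And>v. (\<lambda>n. s n v) \<longlonglongrightarrow> F v" "\<And>n v. norm (s n v) \<le> 2 * norm (F v)"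
    by auto
  have [measurable]: "s n \<in> borel_measurable borel" for n using borel_measurable_simple_function[OF s(1)[of n]] by simp
  show ?thesis
  proof
    show "simple_function lborel (s n)" for n by (rule s)
    show "(\<lambda>n. s n v) \<longlonglongrightarrow> F v" for v by (rule s)
    show "norm (s n v) \<le> 2 * norm (F v)" for n v by (rule s)
    show "integrable lborel (s n)" for n
      by (rule Bochner_Integration.integrable_bound[OF integrable_mult_right[OF integrable_norm[OF F], of 2]]) (auto simp: s)
    have "(\<lambda>n. (LINT v|lborel. norm (s n v - F v))) \<longlonglongrightarrow> (LINT v::real|lborel. 0)"
    proof (rule integral_dominated_convergence[where w = "\<lambda>v. 3 * norm (F v)"])
      show "AE v in lborel. (\<lambda>n. norm (s n v - F v)) \<longlonglongrightarrow> 0"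
        using s(2) by (intro AE_I2 tendsto_norm_zero) (simp add: LIM_zero)
      show "AE v in lborel. norm (norm (s n v - F v)) \<le> 3 * norm (F v)" for n
      proof (intro AE_I2)
        show "norm (norm (s n v - F v)) \<le> 3 * norm (F v)" for v
          using norm_triangle_ineq4[of "s n v" "F v"] s(3)[of n v] by simp
      qed
    qed (use F in auto)
    then show "(\<lambda>n. (LINT v|lborel. norm (s n v - F v))) \<longlonglongrightarrow> 0" by simp
    show "(\<lambda>n. (LINT v|lborel. norm (s n v) powr p)) \<longlonglongrightarrow> (LINT v|lborel. norm (F v) powr p)"
    proof (rule integral_dominated_convergence[where w = "\<lambda>v. 2 powr p * norm (F v) powr p"])
      show "AE v in lborel. (\<lambda>n. norm (s n v) powr p) \<longlonglongrightarrow> norm (F v) powr p"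
        using p by (intro AE_I2 tendsto_powr' tendsto_norm s tendsto_const) auto
      show "AE v in lborel. norm (norm (s n v) powr p) \<le> 2 powr p * norm (F v) powr p" for n
      proof (intro AE_I2)
        show "norm (norm (s n v) powr p) \<le> 2 powr p * norm (F v) powr p" for v
          using powr_mono2[OF _ _ s(3)[of n v], of p] p by (simp add: powr_mult)
      qed
    qed (use Fp in auto)
  qed
qed

lemma vfourier_diff:
  assumes "integrable lborel F" "integrable lborel G"
  shows "vfourier (\<lambda>v. F v - G v) w = vfourier F w - vfourier G w"
  using assms
  by (simp add: vec_eq_iff vfourier_def fourier_def right_diff_distrib diff_divide_distrib
      Bochner_Integration.integral_diff integrable_fourier_kernel[simplified] integrable_vec_nth)

lemma Hausdorff_Young_form:
  fixes F G :: "real \<Rightarrow> complex ^ 'm"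
  assumes F: "integrable lborel F" and G: "integrable lborel G"
    and Fp: "integrable lborel (\<lambda>v. norm (F v) powr p)" and Gp: "integrable lborel (\<lambda>v. norm (G v) powr p)"
    and p: "1 \<le> p" "p \<le> 2"
  shows "norm (fourier_form F G) \<le>
    (LINT v|lborel. norm (F v) powr p) powr (1 / p) * (LINT w|lborel. norm (G w) powr p) powr (1 / p)"
proof -
  obtain s where s: "\<And>n. simple_function lborel (s n)" "\<And>n. integrable lborel (s n)"
    "\<And>v. (\<lambda>n. s n v) \<longlonglongrightarrow> F v" "\<And>n v. norm (s n v) \<le> 2 * norm (F v)"
    "(\<lambda>n. (LINT v|lborel. norm (s n v - F v))) \<longlonglongrightarrow> 0"
    "(\<lambda>n. (LINT v|lborel. norm (s n v) powr p)) \<longlonglongrightarrow> (LINT v|lborel. norm (F v) powr p)"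
    by (rule integrable_simple_approx[OF F Fp p(1)]) (rule that)
  obtain t where t: "\<And>n. simple_function lborel (t n)" "\<And>n. integrable lborel (t n)"
    "\<And>v. (\<lambda>n. t n v) \<longlonglongrightarrow> G v" "\<And>n v. norm (t n v) \<le> 2 * norm (G v)"
    "(\<lambda>n. (LINT v|lborel. norm (t n v - G v))) \<longlonglongrightarrow> 0"
    "(\<lambda>n. (LINT v|lborel. norm (t n v) powr p)) \<longlonglongrightarrow> (LINT v|lborel. norm (G v) powr p)"
    by (rule integrable_simple_approx[OF G Gp p(1)]) (rule that)
  have [measurable]: "F \<in> borel_measurable borel" "G \<in> borel_measurable borel"
    "s n \<in> borel_measurable borel" "t n \<in> borel_measurable borel" for n using F G s(2)[of n] t(2)[of n] by auto
  define C where "C = (LINT v|lborel. norm (F v))"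
  have C0: "C \<ge> 0" by (simp add: C_def)
  have conv: "(\<lambda>n. vfourier (s n) w) \<longlonglongrightarrow> vfourier F w" for w
  proof (rule LIM_zero_cancel, rule tendsto_norm_zero_cancel, rule tendsto_sandwich[OF _ _ tendsto_const s(5)])
    show "\<forall>\<^sub>F n in sequentially. norm (vfourier (s n) w - vfourier F w) \<le> (LINT v|lborel. norm (s n v - F v))"
      using norm_vfourier_le'[of "\<lambda>v. s _ v - F v" w] s(2) F by (simp add: vfourier_diff)
  qed simp
  have "(\<lambda>n. fourier_form (s n) (t n)) \<longlonglongrightarrow> fourier_form F G"
    unfolding fourier_form_def
  proof (rule integral_dominated_convergence[where w = "\<lambda>w. 2 * C * (2 * norm (G w))"])
    show "AE w in lborel. (\<lambda>n. cdot (vfourier (s n) w) (t n w)) \<longlonglongrightarrow> cdot (vfourier F w) (G w)"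
      unfolding cdot_def by (intro AE_I2 tendsto_intros conv t)
    show "AE w in lborel. norm (cdot (vfourier (s n) w) (t n w)) \<le> 2 * C * (2 * norm (G w))" for n
    proof (intro AE_I2)
      fix w
      have "norm (vfourier (s n) w) \<le> (LINT v|lborel. norm (s n v))" by (rule norm_vfourier_le'[OF s(2)])
      also have "\<dots> \<le> (LINT v|lborel. 2 * norm (F v))"
        using s(2)[of n] F s(4) by (intro integral_mono) auto
      finally have "norm (vfourier (s n) w) \<le> 2 * C" by (simp add: C_def)
      then show "norm (cdot (vfourier (s n) w) (t n w)) \<le> 2 * C * (2 * norm (G w))"
        using t(4)[of n w] C0 by (intro order_trans[OF norm_cdot_le] mult_mono) auto
    qed
  qed (use G in auto)
  then have "(\<lambda>n. norm (fourier_form (s n) (t n))) \<longlonglongrightarrow> norm (fourier_form F G)"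
    by (rule tendsto_norm)
  moreover have "(\<lambda>n. (LINT v|lborel. norm (s n v) powr p) powr (1 / p) * (LINT w|lborel. norm (t n w) powr p) powr (1 / p)) \<longlonglongrightarrow>
    (LINT v|lborel. norm (F v) powr p) powr (1 / p) * (LINT w|lborel. norm (G w) powr p) powr (1 / p)"
    using p by (intro tendsto_mult tendsto_powr' s(6) t(6) tendsto_const) (auto intro!: always_eventually)
  ultimately show ?thesis
    by (rule LIMSEQ_le) (use Hausdorff_Young_form_simple[OF s(1,2) t(1,2) p] in auto)
qed

text \<open>
  The norm of the transform is recovered from the pairing by testing against the conjugate direction
  \<open>|V|\<^bsup>q-2\<^esup> cnj V\<close>, cut off to a bounded interval so that the test function is integrable and the
  integral \<open>X\<close> of \<open>|V|\<^sup>q\<close> is finite; then \<open>X \<le> A\<^bsup>1/p\<^esup> X\<^bsup>1/p\<^esup>\<close>.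
\<close>

theorem Hausdorff_Young:
  fixes F :: "real \<Rightarrow> complex ^ 'm"
  assumes F: "integrable lborel F" and Fp: "integrable lborel (\<lambda>v. norm (F v) powr p)"
    and p: "1 < p" "p \<le> 2" and q: "1 / p + 1 / q = 1"
  shows "(\<integral>\<^sup>+w. ennreal (norm (vfourier F w) powr q) \<partial>lborel)
    \<le> ennreal ((LINT v|lborel. norm (F v) powr p) powr (q / p))"
proof -
  have [measurable]: "F \<in> borel_measurable borel" using F by auto
  have q1: "q > 1" using conjugate_exponent_gt_1 p q by blast
  define A where "A = (LINT v|lborel. norm (F v) powr p)"
  have A0: "A \<ge> 0" by (simp add: A_def)
  define C where "C = (LINT v|lborel. norm (F v))"
  have C: "norm (vfourier F w) \<le> C" for w unfolding C_def by (rule norm_vfourier_le'[OF F])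
  have C0: "C \<ge> 0" by (simp add: C_def)
  have pq: "p * (q - 1) = q" using p q q1 by (simp add: field_simps)
  define V where "V = vfourier F"
  have [measurable]: "V \<in> borel_measurable borel" unfolding V_def by measurable
  have le: "(\<integral>\<^sup>+w. ennreal (norm (V w) powr q * indicator {-real N..real N} w) \<partial>lborel) \<le> ennreal (A powr (q / p))" for N
  proof -
    define G where "G w = of_real (indicator {-real N..real N} w * norm (V w) powr (q - 2)) *s (\<chi> i. cnj (V w $ i))" for w
    have [measurable]: "cnj \<in> borel_measurable borel"
      by (intro borel_measurable_continuous_onI continuous_intros)
    have [measurable]: "G \<in> borel_measurable borel"
      unfolding G_def[abs_def] vector_scalar_mult_def by measurable
    have nG: "norm (G w) = indicator {-real N..real N} w * norm (V w) powr (q - 1)" for w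
    proof (cases "V w = 0")
      case True
      then have "(\<chi> i. cnj (V w $ i)) = 0" by (simp add: vec_eq_iff)
      then show ?thesis using True by (simp add: G_def)
    next
      case False
      have "norm (V w) powr (q - 2) * norm (V w) = norm (V w) powr (q - 2) * norm (V w) powr 1" using False by simp
      also have "\<dots> = norm (V w) powr (q - 1)" by (subst powr_add[symmetric]) simp
      finally show ?thesis by (simp add: G_def norm_vector_smult norm_vec_cnj norm_mult mult.assoc del: of_real_mult)
    qed
    have nGp: "norm (G w) powr p = indicator {-real N..real N} w * norm (V w) powr q" for w
      using pq p by (simp add: nG powr_mult powr_powr indicator_def mult.commute)
    have cG: "cdot (V w) (G w) = of_real (indicator {-real N..real N} w * norm (V w) powr q)" for w
    proof -
      have "cdot (V w) (G w) = of_real (indicator {-real N..real N} w * norm (V w) powr (q - 2)) * cdot (V w) (\<chi> i. cnj (V w $ i))"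
        by (simp add: G_def cdot_def sum_distrib_left mult_ac)
      also have "\<dots> = of_real (indicator {-real N..real N} w * (norm (V w) powr (q - 2) * (norm (V w))\<^sup>2))"
        by (simp add: cdot_cnj)
      also have "norm (V w) powr (q - 2) * (norm (V w))\<^sup>2 = norm (V w) powr q"
      proof (cases "V w = 0")
        case False
        have "norm (V w) powr (q - 2) * (norm (V w))\<^sup>2 = norm (V w) powr (q - 2) * norm (V w) powr 2" using False by simp
        also have "\<dots> = norm (V w) powr q" by (subst powr_add[symmetric]) simp
        finally show ?thesis .
      qed simp
      finally show ?thesis .
    qed
    have int: "integrable lborel (\<lambda>w. indicator {-real N..real N} w * norm (V w) powr r)" if "r > 0" for r
    proof (rule Bochner_Integration.integrable_bound[where f = "\<lambda>w. C powr r * indicator {-real N..real N} w"])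
      show "AE w in lborel. norm (indicator {-real N..real N} w * norm (V w) powr r) \<le> norm (C powr r * indicator {-real N..real N} w)"
        using C that by (intro AE_I2) (auto simp: V_def indicator_def intro!: powr_mono2)
    qed auto
    have G: "integrable lborel G"
      by (rule Bochner_Integration.integrable_bound[OF int[of "q - 1"]]) (use q1 in \<open>auto simp: nG\<close>)
    have Gp: "integrable lborel (\<lambda>w. norm (G w) powr p)" unfolding nGp using int[of q] q1 by simp
    define X where "X = (LINT w|lborel. indicator {-real N..real N} w * norm (V w) powr q)"
    have X0: "X \<ge> 0" by (simp add: X_def)
    have "fourier_form F G = of_real X"
      unfolding fourier_form_def X_def by (simp add: cG[unfolded V_def] V_def integral_complex_of_real flip: of_real_mult)
    then have "X \<le> A powr (1 / p) * X powr (1 / p)"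
      using Hausdorff_Young_form[OF F G Fp Gp] p X0 by (simp add: nGp A_def X_def)
    have "X \<le> A powr (q / p)"
    proof (cases "X = 0")
      case False
      then have "X > 0" using X0 by simp
      have "X = X powr (1 / q) * X powr (1 / p)"
        using \<open>X > 0\<close> q by (simp add: add.commute flip: powr_add)
      then have "X powr (1 / q) \<le> A powr (1 / p)"
        using \<open>X \<le> A powr (1 / p) * X powr (1 / p)\<close> \<open>X > 0\<close> by (metis mult_le_cancel_right_pos powr_gt_zero less_irrefl)
      then have "(X powr (1 / q)) powr q \<le> (A powr (1 / p)) powr q"
        using q1 by (intro powr_mono2) auto
      then show ?thesis using \<open>X > 0\<close> q1 by (simp add: powr_powr)
    qed simp
    moreover have "(\<integral>\<^sup>+w. ennreal (norm (V w) powr q * indicator {-real N..real N} w) \<partial>lborel) = ennreal X"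
      unfolding X_def using int[of q] q1 by (subst nn_integral_eq_integral[symmetric]) (auto simp: mult.commute)
    ultimately show ?thesis by (simp add: ennreal_leI)
  qed
  have "(\<integral>\<^sup>+w. ennreal (norm (V w) powr q) \<partial>lborel) = (\<integral>\<^sup>+w. (SUP N. ennreal (norm (V w) powr q * indicator {-real N..real N} w)) \<partial>lborel)"
  proof (intro nn_integral_cong)
    fix w
    obtain N where "\<bar>w\<bar> \<le> real N" using real_arch_simple by blast
    then show "ennreal (norm (V w) powr q) = (SUP N. ennreal (norm (V w) powr q * indicator {-real N..real N} w))"
      by (intro antisym SUP_least SUP_upper2[of N]) (auto simp: indicator_def)
  qed
  also have "\<dots> = (SUP N. \<integral>\<^sup>+w. ennreal (norm (V w) powr q * indicator {-real N..real N} w) \<partial>lborel)"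
    by (intro nn_integral_monotone_convergence_SUP incseq_SucI le_funI ennreal_leI mult_left_mono)
      (auto simp: indicator_def)
  also have "\<dots> \<le> ennreal (A powr (q / p))" by (intro SUP_least le)
  finally show ?thesis by (simp add: A_def V_def)
qed

section \<open>A Paley--Wiener theorem for integrable holomorphic functions on a half-plane\<close>

lemma Complex_measurable [measurable (raw)]:
  assumes [measurable]: "f \<in> borel_measurable M" "g \<in> borel_measurable M"
  shows "(\<lambda>x. Complex (f x) (g x)) \<in> borel_measurable M"
  unfolding Complex_eq by measurable

abbreviation (input) area_L1 :: "(complex \<Rightarrow> 'b :: real_normed_vector) \<Rightarrow> ennreal" where
  "area_L1 h \<equiv> \<integral>\<^sup>+u. \<integral>\<^sup>+v. ennreal (norm (h (Complex u v))) \<partial>lborel \<partial>lborel"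

lemma symmetric_integral_tendsto:
  fixes f :: "real \<Rightarrow> complex"
  assumes f: "integrable lborel f"
  shows "((\<lambda>R. LINT v:{y-R..y+R}|lborel. f v) \<longlongrightarrow> (LINT v|lborel. f v)) at_top"
  unfolding set_lebesgue_integral_def
proof (rule integral_dominated_convergence_at_top[where w = "\<lambda>v. norm (f v)"])
  have [measurable]: "f \<in> borel_measurable borel" using f by auto
  show "f \<in> borel_measurable lborel" "(\<lambda>v. indicat_real {y-R..y+R} v *\<^sub>R f v) \<in> borel_measurable lborel" for R
    by measurable
  show "integrable lborel (\<lambda>v. norm (f v))" using f by simp
  show "AE v in lborel. ((\<lambda>R. indicat_real {y-R..y+R} v *\<^sub>R f v) \<longlongrightarrow> f v) at_top"
  proof (intro AE_I2 tendsto_eventually)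
    show "\<forall>\<^sub>F R in at_top. indicat_real {y-R..y+R} v *\<^sub>R f v = f v" for v
      using eventually_ge_at_top[of "\<bar>v - y\<bar>"] by eventually_elim (auto simp: indicator_def)
  qed
  show "\<forall>\<^sub>F R in at_top. AE v in lborel. norm (indicat_real {y-R..y+R} v *\<^sub>R f v) \<le> norm (f v)"
    by (intro always_eventually allI AE_I2) (auto simp: indicator_def)
qed

text \<open>
  An integrable function on a half-line is small at arbitrarily large arguments.  This replaces
  pointwise decay estimates when contours are pushed to infinity.
\<close>

lemma limit_0_of_integrable_bound:
  fixes V :: "real \<Rightarrow> complex" and \<rho> \<delta> :: "real \<Rightarrow> real"
  assumes V: "(V \<longlongrightarrow> L) at_top" and \<delta>: "(\<delta> \<longlongrightarrow> 0) at_top"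
    and le: "\<forall>\<^sub>F R in at_top. norm (V R) \<le> \<rho> R + \<delta> R"
    and \<rho>: "(\<integral>\<^sup>+R. ennreal (\<rho> R) \<partial>lborel) < \<infinity>"
  shows "L = 0"
proof (rule ccontr)
  assume "L \<noteq> 0"
  then have L: "norm L > 0" by simp
  have "\<forall>\<^sub>F R in at_top. norm (V R) > norm L / 2"
    using tendsto_norm[OF V] L by (intro order_tendstoD) auto
  moreover have "\<forall>\<^sub>F R in at_top. \<delta> R < norm L / 4"
    using \<delta> L by (intro order_tendstoD) auto
  ultimately have "\<forall>\<^sub>F R in at_top. norm L / 4 \<le> \<rho> R"
    using le by eventually_elim auto
  then obtain R0 where R0: "\<And>R. R \<ge> R0 \<Longrightarrow> norm L / 4 \<le> \<rho> R"
    by (auto simp: eventually_at_top_linorder)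
  obtain I where I: "(\<integral>\<^sup>+R. ennreal (\<rho> R) \<partial>lborel) = ennreal I" "I \<ge> 0"
    using \<rho> by (cases "\<integral>\<^sup>+R. ennreal (\<rho> R) \<partial>lborel") auto
  obtain n where n: "I < real n * (norm L / 4)"
    using reals_Archimedean3[of "norm L / 4"] L by auto
  have "ennreal (real n * (norm L / 4)) = (\<integral>\<^sup>+R. ennreal (norm L / 4) * indicator {R0..R0 + real n} R \<partial>lborel)"
    by (simp add: nn_integral_cmult_indicator mult.commute flip: ennreal_mult)
  also have "\<dots> \<le> (\<integral>\<^sup>+R. ennreal (\<rho> R) \<partial>lborel)"
    using R0 by (intro nn_integral_mono) (auto simp: indicator_def intro!: ennreal_leI)
  finally show False using n I by simp
qed

abbreviation RHP :: "complex set" where "RHP \<equiv> {z. 0 < Re z}"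

lemma convex_RHP: "convex RHP" and open_RHP: "open RHP"
  by (auto simp: convex_halfspace_Re_gt open_halfspace_Re_gt)

text \<open>
  Cauchy's theorem for a rectangle, in terms of a primitive \<open>K\<close>: the difference of the vertical
  integrals equals the difference of the horizontal ones.
\<close>

lemma rectangle_estimate:
  assumes k: "k holomorphic_on RHP" and ab: "0 < a" "a \<le> b" and \<alpha>\<beta>: "\<alpha> \<le> \<beta>"
  shows "norm ((LINT v:{\<alpha>..\<beta>}|lborel. k (Complex b v)) - (LINT v:{\<alpha>..\<beta>}|lborel. k (Complex a v)))
    \<le> (LINT x:{a..b}|lborel. norm (k (Complex x \<alpha>))) + (LINT x:{a..b}|lborel. norm (k (Complex x \<beta>)))"
proof -
  obtain K where K: "\<And>z. z \<in> RHP \<Longrightarrow> (K has_field_derivative k z) (at z within RHP)"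
    using holomorphic_convex_primitive'[OF convex_RHP open_RHP k] by metis
  have K': "(K has_field_derivative k z) (at z)" if "Re z > 0" for z
    using K[of z] that at_within_open[OF _ open_RHP, of z] by auto
  have contk: "continuous_on RHP k" using k by (rule holomorphic_on_imp_continuous_on)
  have vert: "(LINT v:{\<alpha>..\<beta>}|lborel. k (Complex c v)) = (K (Complex c \<beta>) - K (Complex c \<alpha>)) / \<i>" if "c > 0" for c
  proof -
    have d: "((\<lambda>v. K (Complex c v) / \<i>) has_vector_derivative k (Complex c v)) (at v within {\<alpha>..\<beta>})" for v
    proof -
      have "((\<lambda>v. Complex c v) has_vector_derivative \<i>) (at v within {\<alpha>..\<beta>})"
        unfolding Complex_eq by (auto intro!: derivative_eq_intros)
      moreover have "(K has_field_derivative k (Complex c v)) (at (Complex c v))" using that by (intro K') simp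
      ultimately have "(K \<circ> (\<lambda>v. Complex c v) has_vector_derivative \<i> * k (Complex c v)) (at v within {\<alpha>..\<beta>})"
        by (rule field_vector_diff_chain_at[rotated, THEN has_vector_derivative_at_within] field_vector_diff_chain_within[OF _ has_field_derivative_at_within])
      then have "((\<lambda>v. K (Complex c v) / \<i>) has_vector_derivative (\<i> * k (Complex c v)) / \<i>) (at v within {\<alpha>..\<beta>})"
        unfolding comp_def by (rule has_vector_derivative_divide)
      then show ?thesis by simp
    qed
    have cont: "continuous_on {\<alpha>..\<beta>} (\<lambda>v. k (Complex c v))"
      using that unfolding Complex_eq by (intro continuous_on_compose2[OF contk] continuous_intros) auto
    show ?thesis
      unfolding set_lebesgue_integral_def
      by (subst integral_FTC_Icc[OF \<alpha>\<beta> d cont]) (simp add: algebra_simps)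
  qed
  have horiz: "norm (K (Complex b y) - K (Complex a y)) \<le> (LINT x:{a..b}|lborel. norm (k (Complex x y)))" for y
  proof -
    have d: "((\<lambda>x. K (Complex x y)) has_vector_derivative k (Complex x y)) (at x within {a..b})" if "a \<le> x" for x
    proof -
      have "((\<lambda>x. Complex x y) has_vector_derivative 1) (at x within {a..b})"
        unfolding Complex_eq by (auto intro!: derivative_eq_intros)
      moreover have "(K has_field_derivative k (Complex x y)) (at (Complex x y))" using that ab by (intro K') simp
      ultimately have "(K \<circ> (\<lambda>x. Complex x y) has_vector_derivative 1 * k (Complex x y)) (at x within {a..b})"
        by (rule field_vector_diff_chain_at[rotated, THEN has_vector_derivative_at_within] field_vector_diff_chain_within[OF _ has_field_derivative_at_within])
      then show ?thesis by (simp add: comp_def)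
    qed
    have cont: "continuous_on {a..b} (\<lambda>x. k (Complex x y))"
      using ab unfolding Complex_eq by (intro continuous_on_compose2[OF contk] continuous_intros) auto
    have "K (Complex b y) - K (Complex a y) = (LINT x:{a..b}|lborel. k (Complex x y))"
      unfolding set_lebesgue_integral_def using ab by (intro integral_FTC_Icc[symmetric] d cont) auto
    also have "norm \<dots> \<le> (LINT x|lborel. norm (indicator {a..b} x *\<^sub>R k (Complex x y)))"
      unfolding set_lebesgue_integral_def by (rule integral_norm_bound)
    finally show ?thesis by (simp add: set_lebesgue_integral_def)
  qed
  have "(LINT v:{\<alpha>..\<beta>}|lborel. k (Complex b v)) - (LINT v:{\<alpha>..\<beta>}|lborel. k (Complex a v)) =
      ((K (Complex b \<beta>) - K (Complex a \<beta>)) - (K (Complex b \<alpha>) - K (Complex a \<alpha>))) / \<i>"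
    using ab by (simp add: vert algebra_simps)
  then show ?thesis
    using norm_triangle_ineq4[of "K (Complex b \<beta>) - K (Complex a \<beta>)" "K (Complex b \<alpha>) - K (Complex a \<alpha>)"] horiz[of \<alpha>] horiz[of \<beta>]
    by (simp add: norm_divide norm_mult)
qed

definition horizontal_L1 :: "real \<Rightarrow> real \<Rightarrow> (complex \<Rightarrow> complex) \<Rightarrow> real \<Rightarrow> real" where
  "horizontal_L1 a b h y = (LINT x:{a..b}|lborel. norm (h (Complex x y)))"

lemma horizontal_L1_nonneg: "horizontal_L1 a b h y \<ge> 0"
  unfolding horizontal_L1_def set_lebesgue_integral_def by (intro Bochner_Integration.integral_nonneg) simp

lemma horizontal_L1_measurable [measurable]:
  assumes [measurable]: "h \<in> borel_measurable borel"
  shows "horizontal_L1 a b h \<in> borel_measurable borel"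
  unfolding horizontal_L1_def[abs_def] set_lebesgue_integral_def by measurable

lemma horizontal_L1_two_sided:
  assumes [measurable]: "h \<in> borel_measurable borel" and "(\<integral>\<^sup>+y. ennreal (horizontal_L1 a b h y) \<partial>lborel) < \<infinity>"
  shows "(\<integral>\<^sup>+R. ennreal (horizontal_L1 a b h (y - R) + horizontal_L1 a b h (y + R)) \<partial>lborel) < \<infinity>"
proof -
  have "(\<integral>\<^sup>+R. ennreal (horizontal_L1 a b h (y - R)) \<partial>lborel) = (\<integral>\<^sup>+y. ennreal (horizontal_L1 a b h y) \<partial>lborel)"
    using nn_integral_real_affine[of "\<lambda>y. ennreal (horizontal_L1 a b h y)" "-1" y] by simp
  moreover have "(\<integral>\<^sup>+R. ennreal (horizontal_L1 a b h (y + R)) \<partial>lborel) = (\<integral>\<^sup>+y. ennreal (horizontal_L1 a b h y) \<partial>lborel)"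
    using nn_integral_real_affine[of "\<lambda>y. ennreal (horizontal_L1 a b h y)" 1 y] by simp
  ultimately show ?thesis
    using assms(2) by (simp add: horizontal_L1_nonneg nn_integral_add)
qed

text \<open>
  The horizontal sides contribute an integrable function of the height, so they vanish along a
  sequence of heights.
\<close>

lemma vertical_integrals_equal:
  assumes k: "k holomorphic_on RHP" and [measurable]: "k \<in> borel_measurable borel" and ab: "0 < a" "a \<le> b"
    and ia: "integrable lborel (\<lambda>v. k (Complex a v))" and ib: "integrable lborel (\<lambda>v. k (Complex b v))"
    and fin: "(\<integral>\<^sup>+y. ennreal (horizontal_L1 a b k y) \<partial>lborel) < \<infinity>"
  shows "(LINT v|lborel. k (Complex b v)) = (LINT v|lborel. k (Complex a v))"
proof -
  let ?V = "\<lambda>R. (LINT v:{0-R..0+R}|lborel. k (Complex b v)) - (LINT v:{0-R..0+R}|lborel. k (Complex a v))"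
  have "(LINT v|lborel. k (Complex b v)) - (LINT v|lborel. k (Complex a v)) = 0"
  proof (rule limit_0_of_integrable_bound[OF _ tendsto_const[of 0]])
    show "(?V \<longlongrightarrow> (LINT v|lborel. k (Complex b v)) - (LINT v|lborel. k (Complex a v))) at_top"
      by (intro tendsto_diff symmetric_integral_tendsto ia ib)
    show "(\<integral>\<^sup>+R. ennreal (horizontal_L1 a b k (0 - R) + horizontal_L1 a b k (0 + R)) \<partial>lborel) < \<infinity>"
      by (intro horizontal_L1_two_sided fin) measurable
    show "\<forall>\<^sub>F R in at_top. norm (?V R) \<le> horizontal_L1 a b k (0 - R) + horizontal_L1 a b k (0 + R) + 0"
      using eventually_ge_at_top[of 0]
      by eventually_elim (use rectangle_estimate[OF k ab] in \<open>auto simp: horizontal_L1_def\<close>)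
  qed
  then show ?thesis by simp
qed

text \<open>
  The real part of the antiderivative is an arctangent; its imaginary part, a logarithm, is symmetric
  about \<open>y\<close> and cancels.
\<close>

lemma Cauchy_kernel_vertical:
  fixes c y R :: real
  assumes c: "c \<noteq> 0" and R: "R \<ge> 0"
  shows "(LINT v:{y-R..y+R}|lborel. 1 / Complex c (v - y)) = of_real (2 * arctan (R / c))"
    and "set_integrable lborel {y-R..y+R} (\<lambda>v. 1 / Complex c (v - y))"
proof -
  define A where "A v = Complex (arctan ((v - y) / c)) (- ln (c\<^sup>2 + (v - y)\<^sup>2) / 2)" for v
  have pos: "c\<^sup>2 + (v - y)\<^sup>2 > 0" for v using c by (intro add_pos_nonneg) auto
  have d: "(A has_vector_derivative 1 / Complex c (v - y)) (at v within {y-R..y+R})" for v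
  proof -
    have 1: "((\<lambda>v. arctan ((v - y) / c)) has_real_derivative c / (c\<^sup>2 + (v - y)\<^sup>2)) (at v within {y-R..y+R})"
      using c by (auto intro!: derivative_eq_intros simp: field_simps power2_eq_square)
    have 2: "((\<lambda>v. - ln (c\<^sup>2 + (v - y)\<^sup>2) / 2) has_real_derivative - (v - y) / (c\<^sup>2 + (v - y)\<^sup>2)) (at v within {y-R..y+R})"
      using pos[of v] by (auto intro!: derivative_eq_intros simp: divide_simps) (simp_all add: algebra_simps)
    have "(A has_vector_derivative Complex (c / (c\<^sup>2 + (v - y)\<^sup>2)) (- (v - y) / (c\<^sup>2 + (v - y)\<^sup>2))) (at v within {y-R..y+R})"
      unfolding A_def has_vector_derivative_complex_iff using 1 2 by (simp add: has_real_derivative_iff_has_vector_derivative)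
    also have "Complex (c / (c\<^sup>2 + (v - y)\<^sup>2)) (- (v - y) / (c\<^sup>2 + (v - y)\<^sup>2)) = 1 / Complex c (v - y)"
      by (simp add: complex_eq_iff Re_divide Im_divide)
    finally show ?thesis .
  qed
  have nz: "Complex c (v - y) \<noteq> 0" for v using c by (simp add: complex_eq_iff)
  then have cont: "continuous_on {y-R..y+R} (\<lambda>v. 1 / Complex c (v - y))"
    unfolding Complex_eq by (intro continuous_intros) auto
  note F = has_bochner_integral_FTC_Icc[OF _ d cont]
  have "(LINT v:{y-R..y+R}|lborel. 1 / Complex c (v - y)) = A (y + R) - A (y - R)"
    unfolding set_lebesgue_integral_def using R by (intro has_bochner_integral_integral_eq F) simp
  also have "\<dots> = of_real (2 * arctan (R / c))"
    by (simp add: A_def complex_eq_iff arctan_minus)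
  finally show "(LINT v:{y-R..y+R}|lborel. 1 / Complex c (v - y)) = of_real (2 * arctan (R / c))" .
  show "set_integrable lborel {y-R..y+R} (\<lambda>v. 1 / Complex c (v - y))"
    unfolding set_integrable_def using R F by (simp add: has_bochner_integral_iff)
qed

lemma tendsto_arctan_ratio:
  assumes "c \<noteq> (0::real)"
  shows "((\<lambda>R. 2 * arctan (R / c)) \<longlongrightarrow> sgn c * pi) at_top"
proof (cases "c > 0")
  case True
  have "((\<lambda>R. 2 * arctan (R / c)) \<longlongrightarrow> 2 * (pi / 2)) at_top"
    by (intro tendsto_mult tendsto_const filterlim_compose[OF tendsto_arctan_at_top])
      (use True in real_asymp)
  then show ?thesis using True by simp
next
  case False
  have "((\<lambda>R. 2 * arctan (R / c)) \<longlongrightarrow> 2 * (- (pi / 2))) at_top"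
    by (intro tendsto_mult tendsto_const filterlim_compose[OF tendsto_arctan_at_bot])
      (use False assms in real_asymp)
  then show ?thesis using False assms by (simp add: sgn_if)
qed

text \<open>
  The difference quotient \<open>(h \<zeta> - h z) / (\<zeta> - z)\<close> is holomorphic, so its rectangle integrals vanish
  in the limit.  The constant \<open>h z\<close> contributes \<open>\<plusminus> \<pi> h z\<close> on each vertical side by the
  arctangent formula, and \<open>O(1/R)\<close> on the horizontal sides.
\<close>

lemma Cauchy_formula_vertical:
  assumes h: "h holomorphic_on RHP" and [measurable]: "h \<in> borel_measurable borel"
    and a: "0 < a" "a < Re z" and b: "Re z < b"
    and ia: "integrable lborel (\<lambda>v. h (Complex a v))" and ib: "integrable lborel (\<lambda>v. h (Complex b v))"
    and fin: "(\<integral>\<^sup>+y. ennreal (horizontal_L1 a b h y) \<partial>lborel) < \<infinity>"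
  shows "(LINT v|lborel. h (Complex b v) / (Complex b v - z)) - (LINT v|lborel. h (Complex a v) / (Complex a v - z))
    = of_real (2 * pi) * h z"
proof -
  define x y where "x = Re z" and "y = Im z"
  have xy: "0 < a" "a < x" "x < b" and z: "z = Complex x y" using a b by (auto simp: x_def y_def)
  define k where "k \<zeta> = (if \<zeta> = z then deriv h z else (h \<zeta> - h z) / (\<zeta> - z))" for \<zeta>
  have "k holomorphic_on RHP"
    unfolding k_def[abs_def] by (rule pole_lemma[OF h]) (use a open_RHP in \<open>auto simp: interior_open\<close>)
  note rect = rectangle_estimate[OF this, of a b "y - R" "y + R" for R]
  have conth: "continuous_on RHP h" using h by (rule holomorphic_on_imp_continuous_on)
  define Q where "Q c v = h (Complex c v) / (Complex c v - z)" for c v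
  have shift: "Complex c v - z = Complex (c - x) (v - y)" for c v by (simp add: z complex_eq_iff)
  have iQ: "integrable lborel (Q c)" if "c \<noteq> x" "integrable lborel (\<lambda>v. h (Complex c v))" for c
  proof (rule Bochner_Integration.integrable_bound[OF integrable_divide[OF that(2), of "of_real \<bar>c - x\<bar>"]])
    show "Q c \<in> borel_measurable lborel" unfolding Q_def[abs_def] by measurable
    have "\<bar>c - x\<bar> \<le> norm (Complex c v - z)" for v
      using abs_Re_le_cmod[of "Complex c v - z"] by (simp add: shift)
    then show "AE v in lborel. norm (Q c v) \<le> norm (h (Complex c v) / of_real \<bar>c - x\<bar>)"
      using that(1) by (intro AE_I2) (simp add: Q_def norm_divide frac_le)
  qed
  have vert: "(LINT v:{y-R..y+R}|lborel. k (Complex c v)) = (LINT v:{y-R..y+R}|lborel. Q c v) - h z * of_real (2 * arctan (R / (c - x)))"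
    if c: "c \<noteq> x" "integrable lborel (\<lambda>v. h (Complex c v))" and R: "R \<ge> 0" for c R
  proof -
    have "k (Complex c v) = Q c v - h z * (1 / Complex (c - x) (v - y))" for v
      using c unfolding k_def Q_def shift by (auto simp: diff_divide_distrib z)
    then have "(LINT v:{y-R..y+R}|lborel. k (Complex c v)) = (LINT v:{y-R..y+R}|lborel. Q c v - h z * (1 / Complex (c - x) (v - y)))"
      by simp
    also have "\<dots> = (LINT v:{y-R..y+R}|lborel. Q c v) - (LINT v:{y-R..y+R}|lborel. h z * (1 / Complex (c - x) (v - y)))"
    proof (rule set_integral_diff(2))
      show "set_integrable lborel {y-R..y+R} (Q c)"
        by (rule set_integrable_subset[of _ UNIV]) (use iQ[OF c] in \<open>auto simp: set_integrable_def\<close>)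
      show "set_integrable lborel {y-R..y+R} (\<lambda>v. h z * (1 / Complex (c - x) (v - y)))"
        using c R by (intro set_integrable_mult_right Cauchy_kernel_vertical(2)) auto
    qed
    also have "(LINT v:{y-R..y+R}|lborel. h z * (1 / Complex (c - x) (v - y))) = h z * (LINT v:{y-R..y+R}|lborel. 1 / Complex (c - x) (v - y))"
      by (rule set_integral_mult_right)
    finally show ?thesis using c R by (simp only: Cauchy_kernel_vertical(1))
  qed
  let ?V = "\<lambda>R. ((LINT v:{y-R..y+R}|lborel. Q b v) - h z * of_real (2 * arctan (R / (b - x)))) -
    ((LINT v:{y-R..y+R}|lborel. Q a v) - h z * of_real (2 * arctan (R / (a - x))))"
  have "((LINT v|lborel. Q b v) - h z * of_real (sgn (b - x) * pi)) - ((LINT v|lborel. Q a v) - h z * of_real (sgn (a - x) * pi)) = 0"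
  proof (rule limit_0_of_integrable_bound)
    show "(?V \<longlongrightarrow> ((LINT v|lborel. Q b v) - h z * of_real (sgn (b - x) * pi)) - ((LINT v|lborel. Q a v) - h z * of_real (sgn (a - x) * pi))) at_top"
      using xy ia ib by (intro tendsto_diff tendsto_mult tendsto_const tendsto_of_real tendsto_arctan_ratio symmetric_integral_tendsto iQ) auto
    show "(\<integral>\<^sup>+R. ennreal (horizontal_L1 a b h (y - R) + horizontal_L1 a b h (y + R)) \<partial>lborel) < \<infinity>"
      by (intro horizontal_L1_two_sided fin) measurable
    show "((\<lambda>R. 2 * ((b - a) * norm (h z)) / R) \<longlongrightarrow> 0) at_top"
      by real_asymp
    show "\<forall>\<^sub>F R in at_top. norm (?V R) \<le> horizontal_L1 a b h (y - R) + horizontal_L1 a b h (y + R) + 2 * ((b - a) * norm (h z)) / R"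
      using eventually_ge_at_top[of 1]
    proof eventually_elim
      case (elim R)
      have seg: "(LINT t:{a..b}|lborel. norm (k (Complex t s))) \<le> horizontal_L1 a b h s + (b - a) * norm (h z) / R"
        if s: "\<bar>s - y\<bar> = R" for s
      proof -
        have pt: "norm (k (Complex t s)) \<le> norm (h (Complex t s)) + norm (h z) / R" for t
        proof -
          have ne: "Complex t s \<noteq> z" using s elim by (auto simp: z)
          have "R \<le> norm (Complex t s - z)"
            using abs_Im_le_cmod[of "Complex t s - z"] s by (simp add: shift)
          then have "norm (k (Complex t s)) \<le> norm (h (Complex t s) - h z) / R"
            using ne elim by (auto simp: k_def norm_divide intro!: divide_left_mono mult_pos_pos)
          also have "\<dots> \<le> (norm (h (Complex t s)) + norm (h z)) / R"
            using elim by (intro divide_right_mono norm_triangle_ineq4) auto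
          also have "\<dots> \<le> norm (h (Complex t s)) + norm (h z) / R"
            using elim by (simp add: add_divide_distrib divide_le_eq mult_le_cancel_left1)
          finally show ?thesis .
        qed
        have c: "continuous_on {a..b} (\<lambda>t. norm (h (Complex t s)))"
          using a unfolding Complex_eq by (intro continuous_intros continuous_on_compose2[OF conth]) auto
        have ih: "set_integrable lborel {a..b} (\<lambda>t. norm (h (Complex t s)))"
          by (rule borel_integrable_atLeastAtMost'[OF c])
        have ic: "set_integrable lborel {a..b} (\<lambda>t. norm (h z) / R)"
          by (rule borel_integrable_atLeastAtMost') (intro continuous_intros)
        have contk: "continuous_on RHP k" using \<open>k holomorphic_on RHP\<close> by (rule holomorphic_on_imp_continuous_on)
        have "continuous_on {a..b} (\<lambda>t. norm (k (Complex t s)))"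
          using a unfolding Complex_eq by (intro continuous_on_norm continuous_on_compose2[OF contk] continuous_intros) auto
        then have ik: "set_integrable lborel {a..b} (\<lambda>t. norm (k (Complex t s)))"
          by (rule borel_integrable_atLeastAtMost')
        have "(LINT t:{a..b}|lborel. norm (k (Complex t s))) \<le> (LINT t:{a..b}|lborel. norm (h (Complex t s)) + norm (h z) / R)"
          by (rule set_integral_mono[OF ik set_integral_add(1)[OF ih ic] pt])
        also have "\<dots> = horizontal_L1 a b h s + (LINT t:{a..b}|lborel. norm (h z) / R)"
          unfolding horizontal_L1_def by (rule set_integral_add(2)[OF ih ic])
        also have "(LINT t:{a..b}|lborel. norm (h z) / R) = (b - a) * norm (h z) / R"
          using xy by (simp add: set_lebesgue_integral_def)
        finally show ?thesis .
      qed
      have "norm (?V R) = norm ((LINT v:{y-R..y+R}|lborel. k (Complex b v)) - (LINT v:{y-R..y+R}|lborel. k (Complex a v)))"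
        using elim xy ia ib by (subst (1 2) vert) auto
      also have "\<dots> \<le> (LINT t:{a..b}|lborel. norm (k (Complex t (y - R)))) + (LINT t:{a..b}|lborel. norm (k (Complex t (y + R))))"
        using elim xy by (intro rect) auto
      finally show ?case using seg[of "y - R"] seg[of "y + R"] elim by (simp add: add_divide_distrib)
    qed
  qed
  then have "(LINT v|lborel. Q b v) - (LINT v|lborel. Q a v) = of_real (2 * pi) * h z"
    using xy by (simp add: algebra_simps)
  then show ?thesis by (simp add: Q_def)
qed

lemma horizontal_L1_finite:
  assumes [measurable]: "h \<in> borel_measurable borel" and h: "h holomorphic_on RHP" and ab: "0 < a" "a \<le> b"
    and fin: "area_L1 h < \<infinity>"
  shows "(\<integral>\<^sup>+y. ennreal (horizontal_L1 a b h y) \<partial>lborel) < \<infinity>"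
proof -
  have "(\<integral>\<^sup>+y. ennreal (horizontal_L1 a b h y) \<partial>lborel) \<le> (\<integral>\<^sup>+y. \<integral>\<^sup>+x. ennreal (norm (h (Complex x y))) \<partial>lborel \<partial>lborel)"
  proof (intro nn_integral_mono)
    fix y
    have "continuous_on {a..b} (\<lambda>t. norm (h (Complex t y)))"
      using ab unfolding Complex_eq
      by (intro continuous_on_norm continuous_on_compose2[OF holomorphic_on_imp_continuous_on[OF h]] continuous_intros) auto
    then have "set_integrable lborel {a..b} (\<lambda>t. norm (h (Complex t y)))"
      by (rule borel_integrable_atLeastAtMost')
    then have "ennreal (horizontal_L1 a b h y) = (\<integral>\<^sup>+x. ennreal (indicator {a..b} x *\<^sub>R norm (h (Complex x y))) \<partial>lborel)"
      unfolding horizontal_L1_def set_lebesgue_integral_def set_integrable_def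
      by (intro nn_integral_eq_integral[symmetric]) auto
    also have "\<dots> \<le> (\<integral>\<^sup>+x. ennreal (norm (h (Complex x y))) \<partial>lborel)"
      by (intro nn_integral_mono ennreal_leI) (auto simp: indicator_def)
    finally show "ennreal (horizontal_L1 a b h y) \<le> (\<integral>\<^sup>+x. ennreal (norm (h (Complex x y))) \<partial>lborel)" .
  qed
  also have "\<dots> = area_L1 h"
    by (intro lborel_pair.Fubini') measurable
  finally show ?thesis using fin by simp
qed

lemma AE_vertical_integrable:
  fixes h :: "complex \<Rightarrow> 'b :: {banach, second_countable_topology}"
  assumes [measurable]: "h \<in> borel_measurable borel"
    and fin: "area_L1 h < \<infinity>"
  shows "AE u in lborel. integrable lborel (\<lambda>v. h (Complex u v))"
proof -
  have "AE u in lborel. (\<integral>\<^sup>+v. ennreal (norm (h (Complex u v))) \<partial>lborel) \<noteq> \<infinity>"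
    by (rule nn_integral_PInf_AE) (use fin in auto)
  then show ?thesis
    by eventually_elim (auto simp: integrable_iff_bounded top.not_eq_extremum)
qed

lemma AE_lborel_obtain:
  assumes "AE u in lborel. P u" and "\<alpha> < (\<beta> :: real)"
  obtains u where "\<alpha> < u" "u < \<beta>" "P u"
proof -
  have "\<exists>u. \<alpha> < u \<and> u < \<beta> \<and> P u"
  proof (rule ccontr)
    assume "\<not> ?thesis"
    then have "AE u in lborel. u \<notin> {\<alpha><..<\<beta>}"
      using assms(1) by (auto elim!: eventually_mono)
    then have "{\<alpha><..<\<beta>} \<in> null_sets lborel"
      by (subst (asm) AE_iff_null_sets[symmetric]) auto
    then show False using assms(2) by (simp add: null_sets_def)
  qed
  then show ?thesis using that by blast
qed

text \<open>
  The \<open>L\<^sup>1\<close> norms on vertical lines are integrable in the abscissa.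
\<close>

lemma obtain_small_vertical:
  fixes h :: "complex \<Rightarrow> complex"
  assumes [measurable]: "h \<in> borel_measurable borel"
    and fin: "area_L1 h < \<infinity>"
  obtains b where "b > B" "integrable lborel (\<lambda>v. h (Complex b v))" "(LINT v|lborel. norm (h (Complex b v))) \<le> 1"
proof -
  let ?N = "\<lambda>u. \<integral>\<^sup>+v. ennreal (norm (h (Complex u v))) \<partial>lborel"
  have "\<exists>b>B. ?N b \<le> 1"
  proof (rule ccontr)
    assume *: "\<not> ?thesis"
    obtain I where I: "(\<integral>\<^sup>+u. ?N u \<partial>lborel) = ennreal I" "I \<ge> 0"
      using fin by (cases "\<integral>\<^sup>+u. ?N u \<partial>lborel") auto
    obtain n where n: "I < real n" using reals_Archimedean2 by blast
    have "ennreal (real n) = (\<integral>\<^sup>+u. indicator {B<..B + real n} u \<partial>lborel)"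
      by simp
    also have "\<dots> \<le> (\<integral>\<^sup>+u. ?N u \<partial>lborel)"
      using * by (intro nn_integral_mono) (auto simp: indicator_def not_le intro: less_imp_le)
    finally show False using n I by simp
  qed
  then obtain b where b: "b > B" "?N b \<le> 1" by blast
  then have "integrable lborel (\<lambda>v. h (Complex b v))"
    by (auto simp: integrable_iff_bounded intro: le_less_trans)
  moreover from this have "ennreal (LINT v|lborel. norm (h (Complex b v))) \<le> 1"
    using b by (subst nn_integral_eq_integral[symmetric]) auto
  ultimately show ?thesis using b by (intro that[of b]) auto
qed

text \<open>
  The right-hand line is moved to infinity through abscissae on which the \<open>L\<^sup>1\<close> norm is at most \<open>1\<close>;
  there the Cauchy kernel tends to \<open>0\<close>.
\<close>

lemma Cauchy_formula_half_plane:
  assumes h: "h holomorphic_on RHP" and [measurable]: "h \<in> borel_measurable borel"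
    and a: "0 < a" "a < Re z"
    and ia: "integrable lborel (\<lambda>v. h (Complex a v))"
    and fin: "area_L1 h < \<infinity>"
  shows "of_real (2 * pi) * h z = (LINT v|lborel. h (Complex a v) / (z - Complex a v))"
proof -
  let ?D = "of_real (2 * pi) * h z + (LINT v|lborel. h (Complex a v) / (Complex a v - z))"
  have small: "norm ?D \<le> 1 / n" if n: "n > 0" for n :: real
  proof -
    obtain b where b: "b > Re z + n" "integrable lborel (\<lambda>v. h (Complex b v))" "(LINT v|lborel. norm (h (Complex b v))) \<le> 1"
      by (rule obtain_small_vertical[OF _ fin]) (auto intro: that)
    have "?D = (LINT v|lborel. h (Complex b v) / (Complex b v - z))"
      using Cauchy_formula_vertical[OF h _ a _ ia b(2) horizontal_L1_finite[OF _ h _ _ fin]] a b n by (simp add: algebra_simps)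
    also have "norm \<dots> \<le> (LINT v|lborel. norm (h (Complex b v)) / n)"
    proof (rule order_trans[OF integral_norm_bound integral_mono'])
      show "integrable lborel (\<lambda>v. norm (h (Complex b v)) / n)" using b by auto
      show "norm (h (Complex b v) / (Complex b v - z)) \<le> norm (h (Complex b v)) / n" for v
      proof -
        have "n \<le> norm (Complex b v - z)"
          using b(1) abs_Re_le_cmod[of "Complex b v - z"] by simp
        then show ?thesis using n by (simp add: norm_divide frac_le)
      qed
    qed (use n in auto)
    also have "\<dots> \<le> 1 / n" using b(3) n by (simp add: divide_right_mono)
    finally show ?thesis .
  qed
  have "norm ?D \<le> 0"
  proof (rule field_le_epsilon)
    fix e :: real assume "e > 0"
    then show "norm ?D \<le> 0 + e" using small[of "1 / e"] by simp
  qed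
  then have "?D = 0" by simp
  then have "of_real (2 * pi) * h z = - (LINT v|lborel. h (Complex a v) / (Complex a v - z))"
    by (simp add: add_eq_0_iff)
  also have "\<dots> = (LINT v|lborel. - (h (Complex a v) / (Complex a v - z)))" by simp
  also have "\<dots> = (LINT v|lborel. h (Complex a v) / (z - Complex a v))"
    by (intro Bochner_Integration.integral_cong refl) (metis minus_diff_eq divide_minus_right)
  finally show ?thesis .
qed

text \<open>
  On bounded intervals the complex integral follows from the fundamental theorem; the real case
  supplies the dominating function for the limit.
\<close>

lemma exp_integral_neg_line:
  fixes c :: complex
  assumes c: "Re c > 0"
  shows "integrable lborel (\<lambda>w. indicator {..<0} w *\<^sub>R exp (c * of_real w))" (is ?A)
    and "(LINT w|lborel. indicator {..<0} w *\<^sub>R exp (c * of_real w)) = 1 / c" (is ?B)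
    and "integrable lborel (\<lambda>w. indicator {..<0} w * exp (Re c * w))" (is ?C)
    and "(LINT w|lborel. indicator {..<0} w * exp (Re c * w)) = 1 / Re c" (is ?D)
proof -
  have *: "integrable lborel (\<lambda>w. indicator {..<0} w * exp (r * w))
    \<and> (LINT w|lborel. indicator {..<0} w * exp (r * w)) = 1 / r" if r: "r > 0" for r :: real
  proof -
    have "(\<integral>\<^sup>+w. ennreal (indicator {..<0} w * exp (r * w)) \<partial>lborel) = (\<integral>\<^sup>+x. ennreal (indicator {..<0} (-x) * exp (r * (-x))) \<partial>lborel)"
      by (subst nn_integral_real_affine[where c = "-1" and t = 0]) auto
    also have "\<dots> = (\<integral>\<^sup>+x. ennreal (exp (- r * x)) * indicator {0..} x \<partial>lborel)"
      by (intro nn_integral_cong_AE) (use AE_lborel_singleton[of "0::real"] in eventually_elim, auto simp: indicator_def)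
    also have "\<dots> = ennreal (0 - (- exp (- r * 0) / r))"
    proof (rule nn_integral_FTC_atLeast)
      show "DERIV (\<lambda>x. - exp (- r * x) / r) x :> exp (- r * x)" for x
        using r by (auto intro!: derivative_eq_intros)
      show "((\<lambda>x. - exp (- r * x) / r) \<longlongrightarrow> 0) at_top" using r by real_asymp
    qed auto
    finally have nn: "(\<integral>\<^sup>+w. ennreal (indicator {..<0} w * exp (r * w)) \<partial>lborel) = ennreal (1 / r)" by simp
    have "integrable lborel (\<lambda>w. indicator {..<0} w * exp (r * w))"
      by (rule integrableI_nonneg) (auto simp: nn)
    moreover have "(LINT w|lborel. indicator {..<0} w * exp (r * w)) = 1 / r"
      using r by (subst integral_eq_nn_integral) (auto simp: nn)
    ultimately show ?thesis by blast
  qed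
  show C: ?C and ?D using *[OF c] by auto
  show ?A
    by (rule Bochner_Integration.integrable_bound[OF C]) auto
  have c0: "c \<noteq> 0" using c by auto
  let ?s = "\<lambda>R w. indicator {-R..0} w *\<^sub>R exp (c * of_real w)"
  have "((\<lambda>R. LINT w|lborel. ?s R w) \<longlongrightarrow> (LINT w|lborel. indicator {..<0} w *\<^sub>R exp (c * of_real w))) at_top"
  proof (rule integral_dominated_convergence_at_top[where w = "\<lambda>w. indicator {..<0} w * exp (Re c * w)"])
    have ne: "AE w in lborel. w \<noteq> (0::real)" by (rule AE_lborel_singleton)
    show "AE w in lborel. ((\<lambda>R. ?s R w) \<longlongrightarrow> indicator {..<0} w *\<^sub>R exp (c * of_real w)) at_top"
      using ne
    proof eventually_elim
      case (elim w)
      show ?case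
        by (intro tendsto_eventually eventually_mono[OF eventually_ge_at_top[of "\<bar>w\<bar>"]])
          (use elim in \<open>auto simp: indicator_def\<close>)
    qed
    show "\<forall>\<^sub>F R in at_top. AE w in lborel. norm (?s R w) \<le> indicator {..<0} w * exp (Re c * w)"
    proof (rule always_eventually, rule allI)
      fix R show "AE w in lborel. norm (?s R w) \<le> indicator {..<0} w * exp (Re c * w)"
        using ne by eventually_elim (auto simp: indicator_def)
    qed
  qed (use C in auto)
  moreover have "((\<lambda>R. LINT w|lborel. ?s R w) \<longlongrightarrow> 1 / c) at_top"
  proof -
    have "(LINT w|lborel. ?s R w) = exp (c * of_real 0) / c - exp (c * of_real (- R)) / c" if "R \<ge> 0" for R
    proof (rule integral_FTC_Icc)
      show "((\<lambda>w. exp (c * of_real w) / c) has_vector_derivative exp (c * of_real x)) (at x within {-R..0})" for x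
      proof -
        have "((\<lambda>w. exp (c * w) / c) has_field_derivative exp (c * of_real x)) (at (of_real x))"
          using c0 by (auto intro!: derivative_eq_intros)
        moreover have "(complex_of_real has_vector_derivative 1) (at x within {-R..0})"
          by (auto intro!: derivative_eq_intros)
        ultimately have "((\<lambda>w. exp (c * w) / c) \<circ> complex_of_real has_vector_derivative 1 * exp (c * of_real x)) (at x within {-R..0})"
          by (rule field_vector_diff_chain_within[OF _ has_field_derivative_at_within, rotated])
        then show ?thesis by (simp add: comp_def)
      qed
      show "continuous_on {-R..0} (\<lambda>x. exp (c * complex_of_real x))" by (intro continuous_intros)
    qed (use that in auto)
    then have "\<forall>\<^sub>F R in at_top. 1 / c - exp (c * of_real (- R)) / c = (LINT w|lborel. ?s R w)"
      by (intro eventually_mono[OF eventually_ge_at_top[of 0]]) auto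
    moreover have "((\<lambda>R. 1 / c - exp (c * of_real (- R)) / c) \<longlongrightarrow> 1 / c - 0) at_top"
    proof (intro tendsto_diff tendsto_const tendsto_divide_zero)
      have "((\<lambda>R. norm (exp (c * complex_of_real (- R)))) \<longlongrightarrow> 0) at_top"
        using c by (simp, real_asymp)
      then show "((\<lambda>R. exp (c * complex_of_real (- R))) \<longlongrightarrow> 0) at_top"
        by (rule tendsto_norm_zero_cancel)
    qed
    ultimately show ?thesis by (auto intro: Lim_transform_eventually)
  qed
  ultimately show ?B by (rule tendsto_unique[rotated]) simp
qed

text \<open>
  Insert \<open>1 / (z - \<zeta>) = \<integral>e\<^bsup>(z - \<zeta>) w\<^esup> dw\<close>, over \<open>w < 0\<close>, into Cauchy's formula on the line through \<open>a\<close>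
  and exchange the integrals, which converge absolutely because \<open>Re z > a\<close>.
\<close>

lemma Laplace_representation:
  assumes h: "h holomorphic_on RHP" and [measurable]: "h \<in> borel_measurable borel"
    and a: "0 < a" "a < Re z"
    and ia: "integrable lborel (\<lambda>v. h (Complex a v))"
    and fin: "area_L1 h < \<infinity>"
  defines "g \<equiv> (\<lambda>w. of_real (exp (- (a * w))) * fourier (\<lambda>v. h (Complex a v)) w)"
  shows "set_integrable lborel {..<0} (\<lambda>w. exp (z * of_real w) * g w)"
    and "h z = (LINT w:{..<0}|lborel. exp (z * of_real w) * g w) / of_real (sqrt (2 * pi))"
proof -
  define H where "H v = h (Complex a v)" for v
  have [measurable]: "H \<in> borel_measurable borel" unfolding H_def[abs_def] by measurable
  have iH: "integrable lborel H" using ia by (simp add: H_def[abs_def])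
  define F where "F w v = indicator {..<0} w *\<^sub>R exp ((z - Complex a v) * of_real w) * H v" for w v
  have [measurable]: "(\<lambda>(w,v). F w v) \<in> borel_measurable (borel \<Otimes>\<^sub>M borel)"
    unfolding F_def by measurable
  have nF: "norm (F w v) = (indicator {..<0} w * exp ((Re z - a) * w)) * norm (H v)" for v w
    by (simp add: F_def norm_mult)
  note ex = exp_integral_neg_line[of "of_real (Re z - a)"]
  have int: "integrable (lborel \<Otimes>\<^sub>M lborel) (\<lambda>(w,v). F w v)"
  proof (rule lborel_pair.Fubini_integrable)
    show "integrable lborel (\<lambda>w. LINT v|lborel. norm (case (w, v) of (w, v) \<Rightarrow> F w v))"
      using ex(3) a by (simp add: nF)
    show "AE w in lborel. integrable lborel (\<lambda>v. case (w, v) of (w, v) \<Rightarrow> F w v)"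
    proof (intro AE_I2)
      fix w
      show "integrable lborel (\<lambda>v. case (w, v) of (w, v) \<Rightarrow> F w v)"
        by (rule Bochner_Integration.integrable_bound[OF integrable_mult_right[OF integrable_norm[OF iH], of "indicator {..<0} w * exp ((Re z - a) * w)"]])
          (auto simp: nF)
    qed
  qed simp
  have inner: "(LINT v|lborel. F w v) = of_real (sqrt (2 * pi)) * (indicator {..<0} w *\<^sub>R (exp (z * of_real w) * g w))" for w
  proof -
    have "F w v = (indicator {..<0} w *\<^sub>R (exp (z * of_real w) * of_real (exp (- (a * w))))) * (exp (- \<i> * of_real (v * w)) * H v)" for v
    proof -
      have "exp ((z - Complex a v) * of_real w) = exp (z * of_real w) * (exp (of_real (- (a * w))) * exp (- \<i> * of_real (v * w)))"
        unfolding exp_add[symmetric] by (simp add: Complex_eq algebra_simps)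
      then show ?thesis unfolding F_def exp_of_real by simp
    qed
    then have "(LINT v|lborel. F w v) = (indicator {..<0} w *\<^sub>R (exp (z * of_real w) * of_real (exp (- (a * w))))) * (LINT v|lborel. exp (- \<i> * of_real (v * w)) * H v)"
      by (simp only: integral_mult_right_zero)
    then show ?thesis by (simp add: g_def fourier_def H_def[abs_def])
  qed
  have "integrable lborel (\<lambda>w. LINT v|lborel. F w v)"
    using lborel_pair.integrable_fst'[OF int] by simp
  then have "integrable lborel (\<lambda>w. of_real (sqrt (2 * pi)) * (indicator {..<0} w *\<^sub>R (exp (z * of_real w) * g w)))"
    unfolding inner .
  from integrable_mult_right[OF this, of "1 / of_real (sqrt (2 * pi))"]
  show "set_integrable lborel {..<0} (\<lambda>w. exp (z * of_real w) * g w)"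
    by (simp add: set_integrable_def)
  have "of_real (2 * pi) * h z = (LINT v|lborel. H v / (z - Complex a v))"
    unfolding H_def by (rule Cauchy_formula_half_plane) fact+
  also have "\<dots> = (LINT v|lborel. LINT w|lborel. F w v)"
  proof (intro Bochner_Integration.integral_cong refl)
    fix v
    have "(LINT w|lborel. F w v) = (LINT w|lborel. indicator {..<0} w *\<^sub>R exp ((z - Complex a v) * of_real w)) * H v"
      unfolding F_def by (rule integral_mult_left_zero)
    also have "\<dots> = (1 / (z - Complex a v)) * H v"
      using a by (subst exp_integral_neg_line(2)) auto
    finally show "H v / (z - Complex a v) = (LINT w|lborel. F w v)" by simp
  qed
  also have "\<dots> = (LINT w|lborel. LINT v|lborel. F w v)"
    by (rule lborel_pair.Fubini_integral[OF int])
  also have "\<dots> = of_real (sqrt (2 * pi)) * (LINT w:{..<0}|lborel. exp (z * of_real w) * g w)"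
    unfolding inner set_lebesgue_integral_def by (rule integral_mult_right_zero)
  finally have "of_real (2 * pi) * h z = of_real (sqrt (2 * pi)) * (LINT w:{..<0}|lborel. exp (z * of_real w) * g w)" .
  moreover have "complex_of_real (2 * pi) = of_real (sqrt (2 * pi)) * of_real (sqrt (2 * pi))"
    by (subst of_real_mult[symmetric]) simp
  ultimately show "h z = (LINT w:{..<0}|lborel. exp (z * of_real w) * g w) / of_real (sqrt (2 * pi))"
    by (simp add: field_simps del: of_real_mult real_sqrt_mult)
qed

text \<open>
  Cauchy's theorem for \<open>e\<^bsup>- \<zeta> w\<^esup> h \<zeta>\<close> on the strip between the two lines, where the exponential
  is bounded.
\<close>

lemma fourier_independent:
  assumes h: "h holomorphic_on RHP" and [measurable]: "h \<in> borel_measurable borel"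
    and ab: "0 < a" "a \<le> b"
    and ia: "integrable lborel (\<lambda>v. h (Complex a v))" and ib: "integrable lborel (\<lambda>v. h (Complex b v))"
    and fin: "area_L1 h < \<infinity>"
  shows "of_real (exp (- (a * w))) * fourier (\<lambda>v. h (Complex a v)) w = of_real (exp (- (b * w))) * fourier (\<lambda>v. h (Complex b v)) w"
proof -
  define k where "k \<zeta> = exp (- (\<zeta> * of_real w)) * h \<zeta>" for \<zeta>
  have [measurable]: "k \<in> borel_measurable borel" unfolding k_def[abs_def] by measurable
  have kc: "k (Complex c v) = of_real (exp (- (c * w))) * (exp (- \<i> * of_real (v * w)) * h (Complex c v))" for c v
  proof -
    have "exp (- (Complex c v * of_real w)) = exp (of_real (- (c * w))) * exp (- \<i> * of_real (v * w))"
      unfolding exp_add[symmetric] by (simp add: Complex_eq algebra_simps)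
    then show ?thesis unfolding k_def exp_of_real by simp
  qed
  have ik: "integrable lborel (\<lambda>v. k (Complex c v))" if "integrable lborel (\<lambda>v. h (Complex c v))" for c
    unfolding kc using integrable_fourier_kernel[OF that, of w] by (intro integrable_mult_right) simp
  have "(LINT v|lborel. k (Complex b v)) = (LINT v|lborel. k (Complex a v))"
  proof (rule vertical_integrals_equal)
    show hk: "k holomorphic_on RHP" unfolding k_def[abs_def] by (intro holomorphic_intros h)
    define C where "C = exp (b * \<bar>w\<bar>)"
    have nk: "norm (k (Complex x y)) \<le> C * norm (h (Complex x y))" if "x \<in> {a..b}" for x y
    proof -
      have "- (x * w) \<le> x * \<bar>w\<bar>" using that ab by (simp add: abs_if mult_le_0_iff)
      also have "\<dots> \<le> b * \<bar>w\<bar>" using that by (intro mult_right_mono) auto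
      finally show ?thesis unfolding kc C_def by (auto simp: norm_mult intro!: mult_right_mono)
    qed
    have "(\<integral>\<^sup>+y. ennreal (horizontal_L1 a b k y) \<partial>lborel) \<le> (\<integral>\<^sup>+y. ennreal C * ennreal (horizontal_L1 a b h y) \<partial>lborel)"
    proof (intro nn_integral_mono)
      fix y
      have ih: "set_integrable lborel {a..b} (\<lambda>x. norm (h (Complex x y)))"
        using ab unfolding Complex_eq
        by (intro borel_integrable_atLeastAtMost' continuous_on_norm continuous_on_compose2[OF holomorphic_on_imp_continuous_on[OF h]] continuous_intros) auto
      have ikk: "set_integrable lborel {a..b} (\<lambda>x. norm (k (Complex x y)))"
        using ab unfolding Complex_eq
        by (intro borel_integrable_atLeastAtMost' continuous_on_norm continuous_on_compose2[OF holomorphic_on_imp_continuous_on[OF hk]] continuous_intros) auto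
      have "horizontal_L1 a b k y \<le> (LINT x:{a..b}|lborel. C * norm (h (Complex x y)))"
        unfolding horizontal_L1_def using nk by (intro set_integral_mono ikk set_integrable_mult_right ih) auto
      also have "\<dots> = C * horizontal_L1 a b h y" unfolding horizontal_L1_def by (rule set_integral_mult_right)
      finally show "ennreal (horizontal_L1 a b k y) \<le> ennreal C * ennreal (horizontal_L1 a b h y)"
        by (subst ennreal_mult'[symmetric]) (auto simp: C_def horizontal_L1_nonneg intro: ennreal_leI)
    qed
    also have "\<dots> < \<infinity>"
      using horizontal_L1_finite[OF _ h ab fin] by (simp add: nn_integral_cmult ennreal_mult_less_top)
    finally show "(\<integral>\<^sup>+y. ennreal (horizontal_L1 a b k y) \<partial>lborel) < \<infinity>" .
  qed (use ab ia ib in \<open>auto intro: ik\<close>)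
  then have "of_real (exp (- (b * w))) * (LINT v|lborel. exp (- \<i> * of_real (v * w)) * h (Complex b v))
    = of_real (exp (- (a * w))) * (LINT v|lborel. exp (- \<i> * of_real (v * w)) * h (Complex a v))"
    unfolding kc integral_mult_right_zero .
  then show ?thesis unfolding fourier_def times_divide_eq_right by simp
qed

text \<open>
  Almost every vertical line carries an integrable restriction, and all of these lines produce the
  same density \<open>G\<close>; a line to the left of \<open>z\<close> gives the representation at \<open>z\<close>.
\<close>

theorem Paley_Wiener_L1:
  fixes F :: "complex \<Rightarrow> complex ^ 'm"
  assumes hol: "\<And>i. (\<lambda>z. F z $ i) holomorphic_on RHP" and [measurable]: "F \<in> borel_measurable borel"
    and fin: "area_L1 F < \<infinity>"
  obtains G :: "real \<Rightarrow> complex ^ 'm" where "G \<in> borel_measurable borel"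
    "AE u in lborel. u > 0 \<longrightarrow> integrable lborel (\<lambda>v. F (Complex u v)) \<and>
       (\<forall>w. of_real (exp (u * w)) *s G w = vfourier (\<lambda>v. F (Complex u v)) w)"
    "\<And>z i. Re z > 0 \<Longrightarrow> set_integrable lborel {..<0} (\<lambda>w. exp (z * of_real w) * G w $ i)"
    "\<And>z i. Re z > 0 \<Longrightarrow> F z $ i = (LINT w:{..<0}|lborel. exp (z * of_real w) * G w $ i) / of_real (sqrt (2 * pi))"
proof -
  have AE: "AE u in lborel. integrable lborel (\<lambda>v. F (Complex u v))"
    by (rule AE_vertical_integrable[OF _ fin]) measurable
  obtain a where a: "0 < a" "a < 1" "integrable lborel (\<lambda>v. F (Complex a v))"
    by (rule AE_lborel_obtain[OF AE zero_less_one])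
  define G where "G w = of_real (exp (- (a * w))) *s vfourier (\<lambda>v. F (Complex a v)) w" for w
  have finc: "(\<integral>\<^sup>+u. \<integral>\<^sup>+v. ennreal (norm (F (Complex u v) $ i)) \<partial>lborel \<partial>lborel) < \<infinity>" for i
    by (rule le_less_trans[OF _ fin]) (intro nn_integral_mono ennreal_leI Finite_Cartesian_Product.norm_nth_le)
  have G: "G w $ i = of_real (exp (- (b * w))) * fourier (\<lambda>v. F (Complex b v) $ i) w"
    if b: "b > 0" "integrable lborel (\<lambda>v. F (Complex b v))" for b w i
  proof -
    have "of_real (exp (- (a * w))) * fourier (\<lambda>v. F (Complex a v) $ i) w = of_real (exp (- (b * w))) * fourier (\<lambda>v. F (Complex b v) $ i) w"
    proof (cases "a \<le> b")
      case True
      show ?thesis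
        by (rule fourier_independent[OF hol _ a(1) True _ _ finc]) (use a b in auto)
    next
      case False
      show ?thesis
        by (rule fourier_independent[OF hol _ b(1) _ _ _ finc, symmetric]) (use a b False in auto)
    qed
    then show ?thesis by (simp add: G_def vfourier_def)
  qed
  show ?thesis
  proof (rule that[of G])
    show "G \<in> borel_measurable borel"
      unfolding G_def[abs_def] vector_scalar_mult_def by measurable
    show "AE u in lborel. u > 0 \<longrightarrow> integrable lborel (\<lambda>v. F (Complex u v)) \<and>
       (\<forall>w. of_real (exp (u * w)) *s G w = vfourier (\<lambda>v. F (Complex u v)) w)"
      using AE
    proof eventually_elim
      case (elim u)
      show ?case
      proof (intro impI conjI allI elim)
        fix w assume u: "u > 0"
        have "complex_of_real (exp (u * w)) * of_real (exp (- (u * w))) = 1"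
          by (simp flip: of_real_mult exp_add)
        then show "of_real (exp (u * w)) *s G w = vfourier (\<lambda>v. F (Complex u v)) w"
          by (simp add: vec_eq_iff G[OF u elim] vfourier_def flip: mult.assoc)
      qed
    qed
  next
    fix z i assume z: "Re z > 0"
    obtain b where b: "0 < b" "b < Re z" "integrable lborel (\<lambda>v. F (Complex b v))"
      by (rule AE_lborel_obtain[OF AE z])
    note rep = Laplace_representation[OF hol _ b(1,2) integrable_vec_nth[OF b(3)] finc, of i, folded G[OF b(1,3)]]
    show "set_integrable lborel {..<0} (\<lambda>w. exp (z * of_real w) * G w $ i)" by (rule rep) measurable
    show "F z $ i = (LINT w:{..<0}|lborel. exp (z * of_real w) * G w $ i) / of_real (sqrt (2 * pi))"
      by (rule rep) measurable
  qed
qed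

section \<open>Norm bounds for the Laplace density\<close>

abbreviation (input) area_Lp :: "real \<Rightarrow> (complex \<Rightarrow> 'b :: real_normed_vector) \<Rightarrow> ennreal" where
  "area_Lp p F \<equiv> \<integral>\<^sup>+u\<in>{0<..}. \<integral>\<^sup>+v. ennreal (norm (F (Complex u v)) powr p) \<partial>lborel \<partial>lborel"

abbreviation (input) weighted_Lq_int :: "real \<Rightarrow> real \<Rightarrow> (real \<Rightarrow> 'b :: real_normed_vector) \<Rightarrow> ennreal" where
  "weighted_Lq_int p q G \<equiv>
     \<integral>\<^sup>+w\<in>{..<0}. ennreal ((1 / (- p * w)) powr (q / p) * norm (G w) powr q) \<partial>lborel"

lemma nn_integral_exp_pos_line:
  assumes "r > (0::real)"
  shows "(\<integral>\<^sup>+u. ennreal (indicator {0<..} u * exp (- (r * u))) \<partial>lborel) = ennreal (1 / r)"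
proof -
  note ex = exp_integral_neg_line(3,4)[of "of_real r"]
  have "(\<integral>\<^sup>+u. ennreal (indicator {0<..} u * exp (- (r * u))) \<partial>lborel) = (\<integral>\<^sup>+w. ennreal (indicator {..<0} w * exp (r * w)) \<partial>lborel)"
    by (subst nn_integral_real_affine[where c = "-1" and t = 0]) (auto simp: indicator_def)
  also have "\<dots> = ennreal (1 / r)"
    using ex assms by (subst nn_integral_eq_integral) auto
  finally show ?thesis .
qed

text \<open>
  On almost every vertical line, Hausdorff--Young bounds the \<open>L\<^sup>q\<close> norm of \<open>e\<^bsup>u w\<^esup> G\<close> by the \<open>L\<^sup>p\<close> norm of
  \<open>F(u + i\<cdot>)\<close>.  Integrating the \<open>p\<close>-th powers over \<open>u\<close> and exchanging norm and integral by
  Minkowski's inequality with exponent \<open>q / p\<close> produces the weight, since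
  \<open>\<integral>e\<^bsup>p u w\<^esup> du = 1 / (- p w)\<close> over \<open>u > 0\<close>.  The exponent is at least \<open>1\<close> exactly because
  \<open>p \<le> 2\<close>.
\<close>

lemma weighted_norm_estimate:
  fixes F :: "complex \<Rightarrow> complex ^ 'm" and G :: "real \<Rightarrow> complex ^ 'm"
  assumes [measurable]: "F \<in> borel_measurable borel" "G \<in> borel_measurable borel"
    and FG: "AE u in lborel. u > 0 \<longrightarrow> integrable lborel (\<lambda>v. F (Complex u v)) \<and>
       (\<forall>w. of_real (exp (u * w)) *s G w = vfourier (\<lambda>v. F (Complex u v)) w)"
    and p: "1 < p" "p \<le> 2" and q: "1 / p + 1 / q = 1"
    and A: "area_Lp p F \<le> ennreal A" "A \<ge> 0"
  shows "weighted_Lq_int p q G \<le> ennreal (A powr (q / p))"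
proof -
  have q1: "q > 1" using conjugate_exponent_gt_1 p q by blast
  define r where "r = q / p"
  have r: "r \<ge> 1"
  proof -
    have "p + q = p * q" using p q q1 by (simp add: field_simps)
    then have "q * (p - 1) = p" by (simp add: algebra_simps)
    moreover have "q * (p - 1) \<le> q * 1" using p q1 by (intro mult_left_mono) auto
    ultimately show ?thesis using p by (simp add: r_def)
  qed
  define N where "N u = (\<integral>\<^sup>+v. ennreal (norm (F (Complex u v)) powr p) \<partial>lborel)" for u
  have [measurable]: "N \<in> borel_measurable borel" unfolding N_def[abs_def] by measurable
  define H where "H u w = indicator {0<..} u * indicator {..<0} w * (exp (p * (u * w)) * norm (G w) powr p)" for u w
  define m where "m w = indicator {..<0} w * ((1 / (- p * w)) * norm (G w) powr p)" for w
  define a where "a u = indicator {0<..} u * enn2real (N u)" for u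
  have Nfin: "AE u in lborel. u > 0 \<longrightarrow> N u < \<infinity>"
  proof -
    have "AE u in lborel. N u * indicator {0<..} u \<noteq> \<infinity>"
      by (rule nn_integral_PInf_AE) (use A in \<open>auto simp: N_def top_unique\<close>)
    then show ?thesis by eventually_elim (auto simp: top.not_eq_extremum)
  qed
  have "(\<integral>\<^sup>+w. ennreal (m w powr r) \<partial>lborel) \<le> ennreal (A powr r)"
  proof (rule nn_integral_Minkowski[where M = lborel and H = H and a = a])
    show "(\<lambda>(u, w). H u w) \<in> borel_measurable (lborel \<Otimes>\<^sub>M lborel)" unfolding H_def by measurable
    show "a \<in> borel_measurable lborel" unfolding a_def[abs_def] by measurable
    show "m \<in> borel_measurable lborel" unfolding m_def[abs_def] by measurable
    show "0 \<le> H u w" "0 \<le> a u" for u w by (auto simp: H_def a_def)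
    show "0 \<le> m w" for w
    proof (cases "w < 0")
      case True
      then have "0 \<le> 1 / (- p * w)" using p by (intro divide_nonneg_pos) (auto simp: mult_pos_neg)
      then show ?thesis unfolding m_def by (intro mult_nonneg_nonneg) auto
    qed (simp add: m_def)
    show "(\<integral>\<^sup>+u. ennreal (H u w) \<partial>lborel) = ennreal (m w)" for w
    proof (cases "w < 0")
      case True
      have "(\<integral>\<^sup>+u. ennreal (H u w) \<partial>lborel) = (\<integral>\<^sup>+u. ennreal (norm (G w) powr p) * ennreal (indicator {0<..} u * exp (- ((- p * w) * u))) \<partial>lborel)"
        using True by (intro nn_integral_cong) (auto simp: H_def indicator_def mult_ac simp flip: ennreal_mult)
      also have "\<dots> = ennreal (norm (G w) powr p) * ennreal (1 / (- p * w))"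
        using True p by (subst nn_integral_cmult) (simp_all only: nn_integral_exp_pos_line mult_neg_neg neg_less_0_iff_less, auto simp: mult_neg_pos mult_pos_neg)
      also have "\<dots> = ennreal (norm (G w) powr p * (1 / (- p * w)))"
        by (rule ennreal_mult'[symmetric]) simp
      finally show ?thesis using True by (simp add: m_def mult.commute)
    qed (simp add: H_def m_def)
    show "(\<integral>\<^sup>+u. ennreal (a u) \<partial>lborel) \<le> ennreal A"
      by (rule order_trans[OF nn_integral_mono A(1)]) (auto simp: a_def N_def indicator_def ennreal_enn2real_if)
    show "AE u in lborel. (\<integral>\<^sup>+w. ennreal (H u w powr r) \<partial>lborel) \<le> ennreal (a u powr r)"
      using FG Nfin
    proof eventually_elim
      case (elim u)
      show ?case
      proof (cases "u > 0")
        case True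
        define Fu where "Fu v = F (Complex u v)" for v
        have Fu: "integrable lborel Fu" "\<And>w. of_real (exp (u * w)) *s G w = vfourier Fu w"
          using elim True by (auto simp: Fu_def[abs_def])
        have [measurable]: "Fu \<in> borel_measurable borel" using Fu by auto
        have N': "N u = (\<integral>\<^sup>+v. ennreal (norm (Fu v) powr p) \<partial>lborel)" by (simp add: N_def Fu_def)
        have Fup: "integrable lborel (\<lambda>v. norm (Fu v) powr p)"
          using elim True by (intro integrableI_nonneg) (auto simp: N')
        have au: "a u = (LINT v|lborel. norm (Fu v) powr p)"
          using True nn_integral_eq_integral[OF Fup] by (simp add: a_def N')
        have "(\<integral>\<^sup>+w. ennreal (H u w powr r) \<partial>lborel) \<le> (\<integral>\<^sup>+w. ennreal (norm (vfourier Fu w) powr q) \<partial>lborel)"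
        proof (intro nn_integral_mono ennreal_leI)
          fix w
          have "H u w powr r \<le> (exp (p * (u * w)) * norm (G w) powr p) powr r"
            using r by (intro powr_mono2) (auto simp: H_def indicator_def)
          also have "exp (p * (u * w)) * norm (G w) powr p = (exp (u * w) * norm (G w)) powr p"
            by (simp add: powr_mult exp_powr_real mult.commute)
          also have "\<dots> powr r = (exp (u * w) * norm (G w)) powr q"
            using p by (simp add: powr_powr r_def)
          also have "exp (u * w) * norm (G w) = norm (vfourier Fu w)"
            unfolding Fu(2)[symmetric] by (simp add: norm_vector_smult del: of_real_exp)
          finally show "H u w powr r \<le> norm (vfourier Fu w) powr q" .
        qed
        also have "\<dots> \<le> ennreal (a u powr r)"
          unfolding au r_def by (rule Hausdorff_Young[OF Fu(1) Fup p q])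
        finally show ?thesis .
      qed (simp add: H_def)
    qed
  qed (use r A in \<open>auto intro: sigma_finite_lborel\<close>)
  moreover have "ennreal (m w powr r) = ennreal ((1 / (- p * w)) powr (q / p) * norm (G w) powr q) * indicator {..<0} w" for w
  proof (cases "w < 0")
    case True
    have "(X * norm (G w) powr p) powr (q / p) = X powr (q / p) * norm (G w) powr q" if "X \<ge> 0" for X
      using that p by (simp add: powr_mult powr_powr)
    moreover have "0 \<le> 1 / (- p * w)" using True p by (intro divide_nonneg_pos) (auto simp: mult_pos_neg)
    ultimately have "((1 / (- p * w)) * norm (G w) powr p) powr (q / p) = (1 / (- p * w)) powr (q / p) * norm (G w) powr q" by blast
    then show ?thesis using True by (simp only: m_def r_def) simp
  qed (simp add: m_def)
  ultimately show ?thesis by (simp add: r_def)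
qed

text \<open>
  Hoelder's inequality against \<open>e\<^bsup>x w\<^esup> (- p w)\<^bsup>1/p\<^esup>\<close>, so that convergence in the weighted \<open>L\<^sup>q\<close> norm implies
  convergence of the Laplace integrals at every point of the half-plane.
\<close>

lemma exp_weighted_L1_le:
  fixes G :: "real \<Rightarrow> complex ^ 'm"
  assumes [measurable]: "G \<in> borel_measurable borel"
    and p: "1 < p" and q: "1 / p + 1 / q = 1" and x: "x > 0"
    and B: "weighted_Lq_int p q G \<le> ennreal (B powr q)" "B \<ge> 0"
  shows "(\<integral>\<^sup>+w\<in>{..<0}. ennreal (exp (x * w) * norm (G w)) \<partial>lborel) \<le> ennreal ((4 / (p * x\<^sup>2)) powr (1 / p) * B)"
proof -
  have q1: "q > 1" using conjugate_exponent_gt_1 p q by blast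
  define f where "f w = indicator {..<0} w * (exp (x * w) * (- p * w) powr (1 / p))" for w
  define g where "g w = indicator {..<0} w * ((1 / (- p * w)) powr (1 / p) * norm (G w))" for w
  have "(\<integral>\<^sup>+w\<in>{..<0}. ennreal (exp (x * w) * norm (G w)) \<partial>lborel) = (\<integral>\<^sup>+w. ennreal (f w * g w) \<partial>lborel)"
  proof (intro nn_integral_cong)
    fix w
    have "t powr (1 / p) * (1 / t) powr (1 / p) = 1" if "t > 0" for t :: real
      using that by (simp add: powr_divide)
    from this[of "- p * w"] have "(- p * w) powr (1 / p) * (1 / (- p * w)) powr (1 / p) = 1" if "w < 0"
      using that p by (simp only: mult_pos_neg mult_minus_left neg_0_less_iff_less)
    then show "ennreal (exp (x * w) * norm (G w)) * indicator {..<0} w = ennreal (f w * g w)"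
      by (auto simp: f_def g_def indicator_def mult_ac)
  qed
  also have "\<dots> \<le> ennreal ((4 / (p * x\<^sup>2)) powr (1 / p) * B)"
  proof (rule nn_integral_Holder[where r = p and s = q])
    have "(\<integral>\<^sup>+w. ennreal (f w powr p) \<partial>lborel) \<le> (\<integral>\<^sup>+w. ennreal (2 / x) * ennreal (indicator {..<0} w * exp ((p * x / 2) * w)) \<partial>lborel)"
    proof (intro nn_integral_mono)
      fix w :: real
      have "f w powr p \<le> 2 / x * (indicator {..<0} w * exp ((p * x / 2) * w))"
      proof (cases "w < 0")
        case True
        have pw: "- p * w > 0" using True p by (simp add: mult_pos_neg)
        have "f w powr p = exp (x * w) powr p * ((- p * w) powr (1 / p)) powr p"
          using True by (simp add: f_def powr_mult)
        also have "\<dots> = exp (p * x * w) * (- p * w)"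
          using pw p unfolding powr_powr by (simp add: exp_powr_real mult_ac)
        \<comment> \<open>Half of the exponential absorbs the linear factor: \<open>t \<le> e\<^sup>t\<close>.\<close>
        also have "- p * w \<le> 2 / x * exp (- (p * x / 2) * w)"
        proof -
          have "- (p * x / 2) * w \<le> exp (- (p * x / 2) * w)"
            using exp_ge_add_one_self[of "- (p * x / 2) * w"] by linarith
          then have "2 / x * (- (p * x / 2) * w) \<le> 2 / x * exp (- (p * x / 2) * w)"
            using x by (intro mult_left_mono) auto
          then show ?thesis using x by simp
        qed
        finally have "f w powr p \<le> exp (p * x * w) * (2 / x * exp (- (p * x / 2) * w))" by simp
        also have "\<dots> = 2 / x * exp ((p * x / 2) * w)"
        proof -
          have "exp (p * x * w) * exp (- (p * x / 2) * w) = exp ((p * x / 2) * w)"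
            unfolding exp_add[symmetric] by (simp add: field_simps)
          then show ?thesis by simp
        qed
        finally show ?thesis using True by simp
      qed (simp add: f_def)
      then show "ennreal (f w powr p) \<le> ennreal (2 / x) * ennreal (indicator {..<0} w * exp ((p * x / 2) * w))"
        using x by (subst ennreal_mult[symmetric]) (auto intro: ennreal_leI)
    qed
    also have "\<dots> = ennreal (2 / x) * ennreal (1 / (p * x / 2))"
      using exp_integral_neg_line(3,4)[of "of_real (p * x / 2)"] p x
      by (subst nn_integral_cmult) (auto simp: nn_integral_eq_integral)
    also have "\<dots> = ennreal (((4 / (p * x\<^sup>2)) powr (1 / p)) powr p)"
      using p x by (simp add: powr_powr power2_eq_square flip: ennreal_mult)
    finally show "(\<integral>\<^sup>+w. ennreal (f w powr p) \<partial>lborel) \<le> ennreal (((4 / (p * x\<^sup>2)) powr (1 / p)) powr p)" .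
    have "(\<integral>\<^sup>+w. ennreal (g w powr q) \<partial>lborel) = weighted_Lq_int p q G"
      by (intro nn_integral_cong) (auto simp: g_def indicator_def powr_mult powr_powr)
    then show "(\<integral>\<^sup>+w. ennreal (g w powr q) \<partial>lborel) \<le> ennreal (B powr q)" using B by simp
    show "f \<in> borel_measurable lborel" unfolding f_def[abs_def] by measurable
    show "g \<in> borel_measurable lborel" unfolding g_def[abs_def] by measurable
  qed (use p q B in \<open>auto simp: f_def g_def\<close>)
  finally show ?thesis .
qed

text \<open>
  The trivial bound \<open>e\<^bsup>u w\<^esup> |G w| \<le> \<integral>|F(u + iv)| dv\<close> is integrated over \<open>u\<close>.
\<close>

theorem Paley_Wiener_Bergman_1:
  fixes F :: "complex \<Rightarrow> complex ^ 'm"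
  assumes hol: "\<And>i. (\<lambda>z. F z $ i) holomorphic_on RHP" and [measurable]: "F \<in> borel_measurable borel"
    and F0: "\<And>z. Re z \<le> 0 \<Longrightarrow> F z = 0"
    and A: "(\<integral>\<^sup>+u\<in>{0<..}. \<integral>\<^sup>+v. ennreal (norm (F (Complex u v))) \<partial>lborel \<partial>lborel) \<le> ennreal A" "A \<ge> 0"
  obtains G :: "real \<Rightarrow> complex ^ 'm" where "G \<in> borel_measurable borel"
    "\<And>z i. Re z > 0 \<Longrightarrow> set_integrable lborel {..<0} (\<lambda>w. exp (z * of_real w) * G w $ i)"
    "\<And>z i. Re z > 0 \<Longrightarrow> F z $ i = (LINT w:{..<0}|lborel. exp (z * of_real w) * G w $ i) / of_real (sqrt (2 * pi))"
    "\<And>w. w < 0 \<Longrightarrow> norm (G w) / (- w) \<le> A"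
proof -
  have "area_L1 F \<le> (\<integral>\<^sup>+u\<in>{0<..}. \<integral>\<^sup>+v. ennreal (norm (F (Complex u v))) \<partial>lborel \<partial>lborel)"
    by (intro nn_integral_mono) (auto simp: indicator_def F0)
  then have A': "area_L1 F \<le> ennreal A"
    using A(1) by (rule order_trans)
  then have fin: "area_L1 F < \<infinity>"
    by (auto intro: le_less_trans)
  obtain G :: "real \<Rightarrow> complex ^ 'm" where G: "G \<in> borel_measurable borel"
    "AE u in lborel. u > 0 \<longrightarrow> integrable lborel (\<lambda>v. F (Complex u v)) \<and>
       (\<forall>w. of_real (exp (u * w)) *s G w = vfourier (\<lambda>v. F (Complex u v)) w)"
    "\<And>z i. Re z > 0 \<Longrightarrow> set_integrable lborel {..<0} (\<lambda>w. exp (z * of_real w) * G w $ i)"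
    "\<And>z i. Re z > 0 \<Longrightarrow> F z $ i = (LINT w:{..<0}|lborel. exp (z * of_real w) * G w $ i) / of_real (sqrt (2 * pi))"
    by (rule Paley_Wiener_L1[OF hol _ fin]) (auto intro: that)
  show ?thesis
  proof (rule that[OF G(1,3,4)])
    fix w :: real assume w: "w < 0"
    have "ennreal (norm (G w) / (- w)) = ennreal (norm (G w)) * ennreal (1 / (- w))"
      by (subst ennreal_mult'[symmetric]) auto
    also have "\<dots> = (\<integral>\<^sup>+u. ennreal (norm (G w)) * ennreal (indicator {0<..} u * exp (- ((- w) * u))) \<partial>lborel)"
      using w by (subst nn_integral_cmult) (auto simp only: nn_integral_exp_pos_line neg_0_less_iff_less, auto)
    also have "\<dots> \<le> area_L1 F"
    proof (rule nn_integral_mono_AE)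
      show "AE u in lborel. ennreal (norm (G w)) * ennreal (indicator {0<..} u * exp (- ((- w) * u))) \<le> (\<integral>\<^sup>+v. ennreal (norm (F (Complex u v))) \<partial>lborel)"
        using G(2)
      proof eventually_elim
        case (elim u)
        show ?case
        proof (cases "u > 0")
          case True
          then have Fu: "integrable lborel (\<lambda>v. F (Complex u v))" "of_real (exp (u * w)) *s G w = vfourier (\<lambda>v. F (Complex u v)) w"
            using elim by auto
          have "norm (G w) * exp (u * w) = norm (vfourier (\<lambda>v. F (Complex u v)) w)"
            unfolding Fu(2)[symmetric] by (simp add: norm_vector_smult del: of_real_exp)
          also have "\<dots> \<le> (LINT v|lborel. norm (F (Complex u v)))" by (rule norm_vfourier_le'[OF Fu(1)])
          finally have "ennreal (norm (G w) * exp (u * w)) \<le> (\<integral>\<^sup>+v. ennreal (norm (F (Complex u v))) \<partial>lborel)"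
            using Fu(1) by (subst nn_integral_eq_integral) (auto intro: ennreal_leI)
          then show ?thesis using True by (subst ennreal_mult[symmetric]) (auto simp: mult.commute)
        qed simp
      qed
    qed
    also have "\<dots> \<le> ennreal A" by (rule A')
    finally show "norm (G w) / (- w) \<le> A" using A(2) by simp
  qed
qed

text \<open>
  A holomorphic factor of modulus at most \<open>1\<close> on the half-plane that is integrable over it and
  tends to \<open>1\<close> as \<open>k\<close> grows.  It turns a Bergman function with exponent \<open>p\<close> into one that is also integrable.
\<close>

definition damping :: "nat \<Rightarrow> complex \<Rightarrow> complex" where
  "damping k z = 1 / (1 + z / of_nat (Suc k)) ^ 4"

lemma damping_nonzero: "Re z > 0 \<Longrightarrow> 1 + z / of_nat (Suc k) \<noteq> 0"
proof -
  assume "Re z > 0"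
  then have "Re (1 + z / of_nat (Suc k)) > 0"
    by (simp add: Re_divide_of_nat add_pos_pos del: of_nat_Suc)
  then show ?thesis by (metis less_irrefl zero_complex.simps(1))
qed

lemma holomorphic_damping: "damping k holomorphic_on RHP"
  unfolding damping_def[abs_def] using damping_nonzero[of _ k]
  by (intro holomorphic_intros) (auto simp del: of_nat_Suc)

lemma damping_measurable [measurable]: "damping k \<in> borel_measurable borel"
  unfolding damping_def[abs_def] by measurable

lemma norm_damping_le_1:
  assumes "Re z > 0"
  shows "norm (damping k z) \<le> 1"
proof -
  have "1 \<le> Re (1 + z / of_nat (Suc k))"
    using assms by (simp add: Re_divide_of_nat del: of_nat_Suc)
  then have "1 \<le> norm (1 + z / of_nat (Suc k))"
    using complex_Re_le_cmod[of "1 + z / of_nat (Suc k)"] by linarith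
  then have "1 \<le> norm (1 + z / of_nat (Suc k)) ^ 4" by (rule one_le_power)
  then show ?thesis by (simp add: damping_def norm_divide norm_power divide_le_eq_1 del: of_nat_Suc)
qed

lemma damping_tendsto: "(\<lambda>k. damping k z) \<longlonglongrightarrow> 1"
proof -
  have "(\<lambda>k. damping k z) \<longlonglongrightarrow> 1 / (1 + 0) ^ 4"
    unfolding damping_def
    by (intro tendsto_intros LIMSEQ_Suc[OF lim_const_over_n]) auto
  then show ?thesis by simp
qed

text \<open>
  A one-variable majorant: the damping factor is bounded by a product of two of these.
\<close>

definition bump :: "real \<Rightarrow> real \<Rightarrow> real" where
  "bump d t = 1 / (1 + d * \<bar>t\<bar>)\<^sup>2"

lemma bump_measurable [measurable]: "bump d \<in> borel_measurable borel"
  unfolding bump_def[abs_def] by measurable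

lemma bump_nonneg: "bump d t \<ge> 0" by (simp add: bump_def)

lemma nn_integral_bump_finite:
  assumes d: "d > 0"
  shows "(\<integral>\<^sup>+t. ennreal (bump d t) \<partial>lborel) < \<infinity>"
proof -
  have half: "(\<integral>\<^sup>+t. ennreal (bump d t) * indicator {0..} t \<partial>lborel) = ennreal (1 / d)"
  proof -
    have "(\<integral>\<^sup>+t. ennreal (bump d t) * indicator {0..} t \<partial>lborel) = ennreal (0 - (- 1 / (d * (1 + d * 0))))"
    proof (rule nn_integral_FTC_atLeast)
      show "DERIV (\<lambda>t. - 1 / (d * (1 + d * t))) t :> bump d t" if "0 \<le> t" for t
      proof -
        have "1 + d * t > 0" using that d by (simp add: add_pos_nonneg)
        then have "1 + d * t \<noteq> 0" by simp
        then show ?thesis using that d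
          by (auto intro!: derivative_eq_intros simp: bump_def divide_simps power2_eq_square)
      qed
      show "((\<lambda>t. - 1 / (d * (1 + d * t))) \<longlongrightarrow> 0) at_top" using d by real_asymp
    qed (auto simp: bump_nonneg)
    then show ?thesis by simp
  qed
  have other: "(\<integral>\<^sup>+t. ennreal (bump d t) * indicator {..0} t \<partial>lborel) = (\<integral>\<^sup>+t. ennreal (bump d t) * indicator {0..} t \<partial>lborel)"
    by (subst nn_integral_real_affine[where c = "-1" and t = 0]) (auto simp: bump_def indicator_def intro!: nn_integral_cong)
  have "(\<integral>\<^sup>+t. ennreal (bump d t) \<partial>lborel) \<le> (\<integral>\<^sup>+t. ennreal (bump d t) * indicator {0..} t + ennreal (bump d t) * indicator {..0} t \<partial>lborel)"
    by (intro nn_integral_mono) (auto simp: indicator_def)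
  also have "\<dots> = ennreal (1 / d) + ennreal (1 / d)"
    by (subst nn_integral_add) (auto simp: half other)
  also have "\<dots> < \<infinity>" by simp
  finally show ?thesis .
qed

lemma norm_damping_le_bump:
  assumes u: "u > 0"
  shows "norm (damping k (Complex u v)) \<le> 4 * (bump (1 / real (Suc k)) u * bump (1 / real (Suc k)) v)"
proof -
  define d where "d = 1 / real (Suc k)"
  have d: "d > 0" by (simp add: d_def)
  define X where "X = norm (1 + Complex u v / of_nat (Suc k))"
  have eq: "1 + Complex u v / of_nat (Suc k) = Complex (1 + d * u) (d * v)"
    by (simp add: d_def complex_eq_iff Re_divide_of_nat Im_divide_of_nat del: of_nat_Suc)
  have X2: "X\<^sup>2 = (1 + d * u)\<^sup>2 + (d * v)\<^sup>2"
    unfolding X_def eq by (simp add: cmod_power2)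
  define P where "P = (1 + d * \<bar>u\<bar>) * (1 + d * \<bar>v\<bar>)"
  have P1: "P > 0" using d by (auto simp: P_def intro!: mult_pos_pos add_pos_nonneg)
  have "P \<le> 2 * X\<^sup>2"
  proof -
    define s t where "s = d * u" and "t = \<bar>d * v\<bar>"
    have st: "s \<ge> 0" "t \<ge> 0" using d u by (auto simp: s_def t_def)
    have "P = (1 + s) * (1 + t)" using d u by (simp add: P_def s_def t_def abs_mult)
    also have "\<dots> \<le> 2 * ((1 + s)\<^sup>2 + t\<^sup>2)"
    proof -
      have "2 * ((1 + s)\<^sup>2 + t\<^sup>2) - (1 + s) * (1 + t) = (1 + s) * s + (1 + s - t / 2)\<^sup>2 + 7 / 4 * t\<^sup>2"
        by (simp add: power2_eq_square algebra_simps)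
      moreover have "\<dots> \<ge> 0" using st by (intro add_nonneg_nonneg mult_nonneg_nonneg) auto
      ultimately show ?thesis by linarith
    qed
    also have "(1 + s)\<^sup>2 + t\<^sup>2 = X\<^sup>2" by (simp add: X2 s_def t_def)
    finally show ?thesis .
  qed
  then have "P\<^sup>2 \<le> (2 * X\<^sup>2)\<^sup>2" using P1 by (intro power_mono) auto
  also have "(2 * X\<^sup>2)\<^sup>2 = 4 * X ^ 4" by (simp add: power_mult_distrib flip: power_mult)
  finally have PX: "P\<^sup>2 \<le> 4 * X ^ 4" .
  then have "X ^ 4 > 0" using P1 zero_less_power[OF P1, of 2] by linarith
  then have "1 / X ^ 4 \<le> 4 / P\<^sup>2" using PX P1 by (simp add: field_simps)
  then show ?thesis
    by (simp add: damping_def norm_divide norm_power X_def P_def bump_def d_def power_mult_distrib del: of_nat_Suc)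
qed

section \<open>Bergman functions with exponent greater than one\<close>

text \<open>
  The damped functions \<open>F\<^sub>k\<close> are integrable, hence have densities \<open>G\<^sub>k\<close>.  They converge to \<open>F\<close> in \<open>L\<^sup>p\<close>
  by dominated convergence, so the norm estimate applied to differences makes the \<open>G\<^sub>k\<close> a Cauchy
  sequence in the weighted \<open>L\<^sup>q\<close> norm, and therefore in \<open>L\<^sup>1\<close> with every weight \<open>e\<^bsup>x w\<^esup>\<close>.  An almost everywhere
  convergent subsequence defines \<open>G\<close>; the representation passes to the limit in \<open>L\<^sup>1\<close> and the norm
  bound by Fatou's lemma.
\<close>

theorem Paley_Wiener_Bergman_gt_1:
  fixes F :: "complex \<Rightarrow> complex ^ 'm"
  assumes hol: "\<And>i. (\<lambda>z. F z $ i) holomorphic_on RHP" and [measurable]: "F \<in> borel_measurable borel"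
    and p: "1 < p" "p \<le> 2" and q: "1 / p + 1 / q = 1"
    and A: "area_Lp p F \<le> ennreal A" "A \<ge> 0"
  obtains G :: "real \<Rightarrow> complex ^ 'm" where "G \<in> borel_measurable borel"
    "\<And>z i. Re z > 0 \<Longrightarrow> set_integrable lborel {..<0} (\<lambda>w. exp (z * of_real w) * G w $ i)"
    "\<And>z i. Re z > 0 \<Longrightarrow> F z $ i = (LINT w:{..<0}|lborel. exp (z * of_real w) * G w $ i) / of_real (sqrt (2 * pi))"
    "weighted_Lq_int p q G \<le> ennreal (A powr (q / p))"
proof -
  have q1: "q > 1" using conjugate_exponent_gt_1 p q by blast
  let ?R = "\<lambda>u. indicator {0<..} u :: real"
  define Fk where "Fk k z = (if Re z > 0 then damping k z *s F z else 0)" for k z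
  have [measurable]: "(\<lambda>z. damping k z *s F z) \<in> borel_measurable borel" for k
    unfolding vector_scalar_mult_def by measurable
  have [measurable]: "Fk k \<in> borel_measurable borel" for k
    unfolding Fk_def[abs_def] by measurable
  have nFk: "norm (Fk k (Complex u v)) = ?R u * (norm (damping k (Complex u v)) * norm (F (Complex u v)))" for k u v
    by (simp add: Fk_def norm_vector_smult)
  have hk: "(\<lambda>z. Fk k z $ i) holomorphic_on RHP" for k i
    by (rule holomorphic_transform[of "\<lambda>z. damping k z * F z $ i"])
      (auto intro!: holomorphic_intros holomorphic_damping hol simp: Fk_def)
  have fin1: "area_L1 (Fk k) < \<infinity>" for k
  proof -
    define d where "d = 1 / real (Suc k)"
    define B where "B = (\<integral>\<^sup>+t. ennreal (bump d t) \<partial>lborel)"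
    have B: "B < \<infinity>" unfolding B_def by (rule nn_integral_bump_finite) (simp add: d_def)
    have "area_L1 (Fk k) \<le>
      (\<integral>\<^sup>+u. \<integral>\<^sup>+v. ennreal (norm (F (Complex u v)) powr p) * indicator {0<..} u + ennreal (4 * bump d u) * ennreal (bump d v) \<partial>lborel \<partial>lborel)"
    proof (intro nn_integral_mono)
      fix u v
      show "ennreal (norm (Fk k (Complex u v))) \<le> ennreal (norm (F (Complex u v)) powr p) * indicator {0<..} u + ennreal (4 * bump d u) * ennreal (bump d v)"
      proof (cases "u > 0")
        case True
        have "norm (Fk k (Complex u v)) \<le> norm (F (Complex u v)) powr p + 4 * bump d u * bump d v"
        \<comment> \<open>Where \<open>F\<close> is large it is dominated by its \<open>p\<close>-th power, elsewhere the damping factor dominates.\<close>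
        proof (cases "norm (F (Complex u v)) \<ge> 1")
          case ge: True
          have "norm (Fk k (Complex u v)) \<le> 1 * norm (F (Complex u v))"
            unfolding nFk using True norm_damping_le_1[of "Complex u v" k] by (simp add: mult_left_le_one_le)
          also have "\<dots> = norm (F (Complex u v)) powr 1" using ge by simp
          also have "\<dots> \<le> norm (F (Complex u v)) powr p" using ge p by (intro powr_mono) auto
          finally show ?thesis using bump_nonneg[of d u] bump_nonneg[of d v] by (simp add: add_increasing2)
        next
          case False
          have "norm (Fk k (Complex u v)) \<le> norm (damping k (Complex u v)) * 1"
            unfolding nFk using True False by (simp add: mult_left_le)
          also have "\<dots> \<le> 4 * bump d u * bump d v"
            using norm_damping_le_bump[OF True, of k v] by (simp add: d_def mult.assoc)
          finally show ?thesis by (simp add: add_increasing)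
        qed
        then have "ennreal (norm (Fk k (Complex u v))) \<le> ennreal (norm (F (Complex u v)) powr p + 4 * bump d u * bump d v)"
          by (rule ennreal_leI)
        then show ?thesis using True bump_nonneg by (simp add: ennreal_mult'')
      qed (simp add: nFk)
    qed
    also have "\<dots> = (\<integral>\<^sup>+u. (\<integral>\<^sup>+v. ennreal (norm (F (Complex u v)) powr p) \<partial>lborel) * indicator {0<..} u + ennreal (4 * bump d u) * B \<partial>lborel)"
    proof (intro nn_integral_cong)
      fix u
      show "(\<integral>\<^sup>+v. ennreal (norm (F (Complex u v)) powr p) * indicator {0<..} u + ennreal (4 * bump d u) * ennreal (bump d v) \<partial>lborel)
        = (\<integral>\<^sup>+v. ennreal (norm (F (Complex u v)) powr p) \<partial>lborel) * indicator {0<..} u + ennreal (4 * bump d u) * B"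
        unfolding B_def by (subst nn_integral_add, measurable, subst nn_integral_multc, measurable, subst nn_integral_cmult, measurable)
    qed
    also have "\<dots> = area_Lp p F + (\<integral>\<^sup>+u. ennreal (4 * bump d u) * B \<partial>lborel)"
      by (rule nn_integral_add) measurable
    also have "(\<integral>\<^sup>+u. ennreal (4 * bump d u) * B \<partial>lborel) = (\<integral>\<^sup>+u. ennreal 4 * ennreal (bump d u) \<partial>lborel) * B"
      by (subst nn_integral_multc[symmetric]) (simp_all only: ennreal_mult[OF _ bump_nonneg] zero_le_numeral, measurable)
    also have "(\<integral>\<^sup>+u. ennreal 4 * ennreal (bump d u) \<partial>lborel) = ennreal 4 * B"
      unfolding B_def by (rule nn_integral_cmult) measurable
    also have "area_Lp p F + ennreal 4 * B * B < \<infinity>"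
      using le_less_trans[OF A(1) ennreal_less_top] B by (simp add: ennreal_mult_less_top)
    finally show ?thesis .
  qed
  define PW where "PW k G \<longleftrightarrow> G \<in> borel_measurable borel \<and>
    (AE u in lborel. u > 0 \<longrightarrow> integrable lborel (\<lambda>v. Fk k (Complex u v)) \<and>
       (\<forall>w. of_real (exp (u * w)) *s G w = vfourier (\<lambda>v. Fk k (Complex u v)) w)) \<and>
    (\<forall>z i. Re z > 0 \<longrightarrow> set_integrable lborel {..<0} (\<lambda>w. exp (z * of_real w) * G w $ i) \<and>
     Fk k z $ i = (LINT w:{..<0}|lborel. exp (z * of_real w) * G w $ i) / of_real (sqrt (2 * pi)))"
    for k and G :: "real \<Rightarrow> complex ^ 'm"
  have "\<exists>G. PW k G" for k
  proof -
    have "Fk k \<in> borel_measurable borel" by measurable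
    then show ?thesis
      by (rule Paley_Wiener_L1[OF hk _ fin1[of k]]) (unfold PW_def, blast)
  qed
  then have "\<exists>Gk. \<forall>k. PW k (Gk k)" by (intro choice allI)
  then obtain Gk where Gk_PW: "\<And>k. PW k (Gk k)" by blast
  have Gk[measurable]: "Gk k \<in> borel_measurable borel" and
    GF: "AE u in lborel. u > 0 \<longrightarrow> integrable lborel (\<lambda>v. Fk k (Complex u v)) \<and>
       (\<forall>w. of_real (exp (u * w)) *s Gk k w = vfourier (\<lambda>v. Fk k (Complex u v)) w)" for k
    using Gk_PW[of k] unfolding PW_def by blast+
  have Gint: "set_integrable lborel {..<0} (\<lambda>w. exp (z * of_real w) * Gk k w $ i)" and
    Grep: "Fk k z $ i = (LINT w:{..<0}|lborel. exp (z * of_real w) * Gk k w $ i) / of_real (sqrt (2 * pi))"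
    if "Re z > 0" for k z i
    using Gk_PW[of k] that unfolding PW_def by blast+
  let ?W = "\<lambda>G. \<integral>\<^sup>+w\<in>{..<0}. ennreal ((1 / (- p * w)) powr (q / p) * norm (G w :: complex ^ 'm) powr q) \<partial>lborel"
  have Wk: "?W (Gk k) \<le> ennreal (A powr (q / p))" for k
  proof (rule weighted_norm_estimate[OF _ _ GF p q _ A(2)])
    show "area_Lp p (Fk k) \<le> ennreal A"
    proof (rule order_trans[OF _ A(1)], intro nn_integral_mono)
      fix u
      show "(\<integral>\<^sup>+v. ennreal (norm (Fk k (Complex u v)) powr p) \<partial>lborel) * indicator {0<..} u
        \<le> (\<integral>\<^sup>+v. ennreal (norm (F (Complex u v)) powr p) \<partial>lborel) * indicator {0<..} u"
      proof (cases "u > 0")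
        case True
        have "norm (Fk k (Complex u v)) \<le> norm (F (Complex u v))" for v
          unfolding nFk using True norm_damping_le_1[of "Complex u v" k] by (simp add: mult_left_le_one_le)
        then show ?thesis using p by (intro mult_right_mono nn_integral_mono ennreal_leI powr_mono2) auto
      qed simp
    qed
  qed measurable
  define D where "D k x = ?R (fst x) * (norm (F (Complex (fst x) (snd x))) * norm (damping k (Complex (fst x) (snd x)) - 1)) powr p" for k and x :: "real \<times> real"
  have [measurable]: "D k \<in> borel_measurable (lborel \<Otimes>\<^sub>M lborel)" for k
    unfolding D_def[abs_def] by measurable
  have D0: "D k x \<ge> 0" for k x by (simp add: D_def)
  define dn where "dn k = (\<integral>\<^sup>+x. ennreal (D k x) \<partial>(lborel \<Otimes>\<^sub>M lborel))" for k
  define d where "d k = enn2real (dn k)" for k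
  have dom: "(\<integral>\<^sup>+x. ennreal (2 powr p) * ennreal (?R (fst x) * norm (F (Complex (fst x) (snd x))) powr p) \<partial>(lborel \<Otimes>\<^sub>M lborel)) < \<infinity>"
  proof -
    have "(\<integral>\<^sup>+x. ennreal (?R (fst x) * norm (F (Complex (fst x) (snd x))) powr p) \<partial>(lborel \<Otimes>\<^sub>M lborel))
      = (\<integral>\<^sup>+u. \<integral>\<^sup>+v. ennreal (?R (fst (u, v)) * norm (F (Complex (fst (u, v)) (snd (u, v)))) powr p) \<partial>lborel \<partial>lborel)"
      by (rule lborel.nn_integral_fst[symmetric]) measurable
    also have "\<dots> = area_Lp p F"
      by (intro nn_integral_cong) (auto simp: indicator_def)
    also have "\<dots> < \<infinity>" using A(1) by (auto intro: le_less_trans)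
    finally show ?thesis by (subst nn_integral_cmult) (auto simp: ennreal_mult_less_top)
  qed
  have Dle: "D k x \<le> 2 powr p * (?R (fst x) * norm (F (Complex (fst x) (snd x))) powr p)" for k x
  proof (cases "fst x > 0")
    case True
    have "norm (damping k (Complex (fst x) (snd x)) - 1) \<le> 2"
      using norm_triangle_ineq4[of "damping k (Complex (fst x) (snd x))" 1] norm_damping_le_1[of "Complex (fst x) (snd x)" k] True by simp
    then have "norm (F (Complex (fst x) (snd x))) * norm (damping k (Complex (fst x) (snd x)) - 1) \<le> 2 * norm (F (Complex (fst x) (snd x)))"
      by (subst mult.commute) (intro mult_right_mono, auto)
    then have "D k x \<le> (2 * norm (F (Complex (fst x) (snd x)))) powr p"
      using True p by (auto simp: D_def intro!: powr_mono2)
    then show ?thesis using True by (simp add: powr_mult)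
  qed (simp add: D_def)
  have dfin: "dn k < \<infinity>" for k
    unfolding dn_def using Dle
    by (intro le_less_trans[OF nn_integral_mono dom]) (auto simp flip: ennreal_mult intro!: ennreal_leI)
  have "dn \<longlonglongrightarrow> (\<integral>\<^sup>+x. 0 \<partial>(lborel \<Otimes>\<^sub>M lborel :: (real \<times> real) measure))"
    unfolding dn_def
  proof (rule nn_integral_dominated_convergence[OF _ _ _ _ dom])
    show "AE x in lborel \<Otimes>\<^sub>M lborel. ennreal (D k x) \<le> ennreal (2 powr p) * ennreal (?R (fst x) * norm (F (Complex (fst x) (snd x))) powr p)" for k
      using Dle by (intro AE_I2) (auto simp flip: ennreal_mult intro!: ennreal_leI)
    show "AE x in lborel \<Otimes>\<^sub>M lborel. (\<lambda>k. ennreal (D k x)) \<longlonglongrightarrow> 0"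
    proof (intro AE_I2)
      fix x :: "real \<times> real"
      have "(\<lambda>k. norm (F (Complex (fst x) (snd x))) * norm (damping k (Complex (fst x) (snd x)) - 1)) \<longlonglongrightarrow> norm (F (Complex (fst x) (snd x))) * norm (1 - 1 :: complex)"
        by (intro tendsto_intros damping_tendsto)
      then have "(\<lambda>k. (norm (F (Complex (fst x) (snd x))) * norm (damping k (Complex (fst x) (snd x)) - 1)) powr p) \<longlonglongrightarrow> 0 powr p"
        using p by (intro tendsto_powr' tendsto_const) auto
      then have "(\<lambda>k. ?R (fst x) * (norm (F (Complex (fst x) (snd x))) * norm (damping k (Complex (fst x) (snd x)) - 1)) powr p) \<longlonglongrightarrow> ?R (fst x) * 0 powr p"
        by (intro tendsto_mult tendsto_const)
      then have "(\<lambda>k. D k x) \<longlonglongrightarrow> 0" by (simp add: D_def)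
      then have "(\<lambda>k. ennreal (D k x)) \<longlonglongrightarrow> ennreal 0" by (rule tendsto_ennrealI)
      then show "(\<lambda>k. ennreal (D k x)) \<longlonglongrightarrow> 0" by simp
    qed
  qed measurable
  then have "dn \<longlonglongrightarrow> ennreal 0" by simp
  then have d_lim: "d \<longlonglongrightarrow> 0"
    unfolding d_def by (intro tendsto_enn2real) auto
  have d_dn: "dn k = ennreal (d k)" for k using dfin[of k] by (simp add: d_def)
  have d0: "d k \<ge> 0" for k by (simp add: d_def)
  have diff: "(\<integral>\<^sup>+u\<in>{0<..}. \<integral>\<^sup>+v. ennreal (norm (Fk j (Complex u v) - Fk k (Complex u v)) powr p) \<partial>lborel \<partial>lborel) \<le> ennreal (2 powr p * (d j + d k))" for j k
  proof -
    have "(\<integral>\<^sup>+u\<in>{0<..}. \<integral>\<^sup>+v. ennreal (norm (Fk j (Complex u v) - Fk k (Complex u v)) powr p) \<partial>lborel \<partial>lborel)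
      \<le> (\<integral>\<^sup>+u. \<integral>\<^sup>+v. ennreal (2 powr p) * (ennreal (D j (u, v)) + ennreal (D k (u, v))) \<partial>lborel \<partial>lborel)"
    proof (intro nn_integral_mono)
      fix u
      show "(\<integral>\<^sup>+v. ennreal (norm (Fk j (Complex u v) - Fk k (Complex u v)) powr p) \<partial>lborel) * indicator {0<..} u
        \<le> (\<integral>\<^sup>+v. ennreal (2 powr p) * (ennreal (D j (u, v)) + ennreal (D k (u, v))) \<partial>lborel)"
      proof (cases "u > 0")
        case True
        have "norm (Fk j (Complex u v) - Fk k (Complex u v)) powr p \<le> 2 powr p * (D j (u, v) + D k (u, v))" for v
        proof -
          let ?f = "norm (F (Complex u v))" and ?m = "\<lambda>k. damping k (Complex u v)"
          have "Fk j (Complex u v) - Fk k (Complex u v) = (?m j - ?m k) *s F (Complex u v)"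
            using True by (simp add: Fk_def vec_eq_iff algebra_simps)
          then have "norm (Fk j (Complex u v) - Fk k (Complex u v)) = norm (?m j - ?m k) * ?f"
            by (simp only: norm_vector_smult)
          also have "\<dots> = ?f * norm ((?m j - 1) - (?m k - 1))"
            by (simp add: mult.commute)
          also have "\<dots> \<le> ?f * (norm (?m j - 1) + norm (?m k - 1))"
            by (intro mult_left_mono norm_triangle_ineq4) auto
          also have "\<dots> \<le> 2 * max (?f * norm (?m j - 1)) (?f * norm (?m k - 1))"
            by (simp add: distrib_left max_def)
          finally have "norm (Fk j (Complex u v) - Fk k (Complex u v)) powr p \<le> (2 * max (?f * norm (?m j - 1)) (?f * norm (?m k - 1))) powr p"
            using p by (intro powr_mono2) auto
          also have "\<dots> = 2 powr p * max (?f * norm (?m j - 1)) (?f * norm (?m k - 1)) powr p"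
            by (intro powr_mult)
          also have "\<dots> \<le> 2 powr p * (D j (u, v) + D k (u, v))"
            using True by (intro mult_left_mono) (auto simp: D_def max_def)
          finally show ?thesis .
        qed
        then have "ennreal (norm (Fk j (Complex u v) - Fk k (Complex u v)) powr p) \<le> ennreal (2 powr p) * (ennreal (D j (u, v)) + ennreal (D k (u, v)))" for v
          using D0 by (simp add: ennreal_leI flip: ennreal_plus ennreal_mult)
        then show ?thesis using True by (simp add: nn_integral_mono)
      qed simp
    qed
    also have "\<dots> = (\<integral>\<^sup>+x. ennreal (2 powr p) * (ennreal (D j x) + ennreal (D k x)) \<partial>(lborel \<Otimes>\<^sub>M lborel))"
      by (rule lborel.nn_integral_fst) measurable
    also have "\<dots> = ennreal (2 powr p) * (dn j + dn k)"
      by (simp add: nn_integral_cmult nn_integral_add dn_def)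
    finally show ?thesis using d0 by (simp add: d_dn ennreal_mult')
  qed
  define C where "C x = (4 / (p * x\<^sup>2)) powr (1 / p)" for x
  define \<epsilon> where "\<epsilon> j k = (2 powr p * (d j + d k)) powr (1 / p)" for j k
  have L1: "(\<integral>\<^sup>+w\<in>{..<0}. ennreal (exp (x * w) * norm (Gk j w - Gk k w)) \<partial>lborel) \<le> ennreal (C x * \<epsilon> j k)" if x: "x > 0" for x j k
    unfolding C_def
  proof (rule exp_weighted_L1_le[OF _ p(1) q x])
    have "(\<integral>\<^sup>+w\<in>{..<0}. ennreal ((1 / (- p * w)) powr (q / p) * norm (Gk j w - Gk k w) powr q) \<partial>lborel) \<le> ennreal ((2 powr p * (d j + d k)) powr (q / p))"
    proof (rule weighted_norm_estimate[OF _ _ _ p q diff])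
      show "AE u in lborel. u > 0 \<longrightarrow> integrable lborel (\<lambda>v. Fk j (Complex u v) - Fk k (Complex u v)) \<and>
       (\<forall>w. of_real (exp (u * w)) *s (Gk j w - Gk k w) = vfourier (\<lambda>v. Fk j (Complex u v) - Fk k (Complex u v)) w)"
        using GF[of j] GF[of k]
        by eventually_elim (auto simp: vfourier_diff vector_sub_rdistrib vector_ssub_ldistrib)
    qed (use d0 in auto)
    then show "(\<integral>\<^sup>+w\<in>{..<0}. ennreal ((1 / (- p * w)) powr (q / p) * norm (Gk j w - Gk k w) powr q) \<partial>lborel) \<le> ennreal (\<epsilon> j k powr q)"
      by (simp add: \<epsilon>_def powr_powr)
  qed (auto simp: \<epsilon>_def)
  have C0: "C x > 0" if "x > 0" for x using that p by (simp add: C_def)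
  have \<epsilon>0: "\<epsilon> j k \<ge> 0" for j k by (simp add: \<epsilon>_def)
  have L1k: "(\<integral>\<^sup>+w\<in>{..<0}. ennreal (exp (x * w) * norm (Gk k w)) \<partial>lborel) \<le> ennreal (C x * A powr (1 / p))" if x: "x > 0" for x k
    unfolding C_def using Wk[of k] by (intro exp_weighted_L1_le[OF _ p(1) q x]) (auto simp: powr_powr)
  \<comment> \<open>The single weight \<open>e\<^sup>w\<close> serves to select the subsequence; all other weights follow from \<open>L1\<close>.\<close>
  define s where "s n w = indicator {..<0} w *\<^sub>R (exp w *\<^sub>R Gk n w)" for n w
  have [measurable]: "s n \<in> borel_measurable borel" for n unfolding s_def[abs_def] by measurable
  have s_int: "integrable lborel (s n)" for n
  proof (rule integrableI_bounded)
    have "(\<integral>\<^sup>+w. ennreal (norm (s n w)) \<partial>lborel) = (\<integral>\<^sup>+w\<in>{..<0}. ennreal (exp (1 * w) * norm (Gk n w)) \<partial>lborel)"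
      by (intro nn_integral_cong) (auto simp: s_def indicator_def)
    also have "\<dots> < \<infinity>" using L1k[of 1 n] by (auto intro: le_less_trans)
    finally show "(\<integral>\<^sup>+w. ennreal (norm (s n w)) \<partial>lborel) < \<infinity>" .
  qed measurable
  have sdiff: "(LINT w|lborel. norm (s i w - s j w)) \<le> C 1 * \<epsilon> i j" for i j
  proof -
    have "ennreal (LINT w|lborel. norm (s i w - s j w)) = (\<integral>\<^sup>+w. ennreal (norm (s i w - s j w)) \<partial>lborel)"
      using s_int by (subst nn_integral_eq_integral) auto
    also have "\<dots> = (\<integral>\<^sup>+w\<in>{..<0}. ennreal (exp (1 * w) * norm (Gk i w - Gk j w)) \<partial>lborel)"
      by (intro nn_integral_cong) (auto simp: s_def indicator_def simp flip: scaleR_diff_right)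
    also have "\<dots> \<le> ennreal (C 1 * \<epsilon> i j)" by (rule L1) simp
    finally show ?thesis using C0[of 1] \<epsilon>0 by (simp add: ennreal_le_iff)
  qed
  have "\<exists>N. \<forall>i\<ge>N. \<forall>j\<ge>N. (LINT w|lborel. norm (s i w - s j w)) < e" if e: "e > 0" for e
  proof -
    define t where "t = e / (2 * C 1)"
    have t: "t > 0" using e C0[of 1] by (simp add: t_def)
    \<comment> \<open>Chosen such that \<open>d i, d j < \<eta>\<close> forces \<open>\<epsilon> i j \<le> t\<close>.\<close>
    define \<eta> where "\<eta> = t powr p / (2 * 2 powr p)"
    have \<eta>: "\<eta> > 0" using t by (simp add: \<eta>_def)
    obtain N where N: "\<And>k. k \<ge> N \<Longrightarrow> d k < \<eta>"
      using order_tendstoD(2)[OF d_lim \<eta>] by (auto simp: eventually_sequentially)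
    show ?thesis
    proof (intro exI[of _ N] allI impI)
      fix i j assume "N \<le> i" "N \<le> j"
      then have "d i + d j \<le> 2 * \<eta>" using N[of i] N[of j] by simp
      then have "2 powr p * (d i + d j) \<le> 2 powr p * (2 * \<eta>)" by (intro mult_left_mono) auto
      also have "\<dots> = t powr p" by (simp add: \<eta>_def)
      finally have "\<epsilon> i j \<le> (t powr p) powr (1 / p)"
        unfolding \<epsilon>_def using d0 p by (intro powr_mono2) auto
      also have "\<dots> = t" using t p by (simp add: powr_powr)
      finally have "C 1 * \<epsilon> i j \<le> C 1 * t" using C0[of 1] by (intro mult_left_mono) auto
      also have "\<dots> < e" using C0[of 1] e by (simp add: t_def)
      finally show "(LINT w|lborel. norm (s i w - s j w)) < e" using sdiff[of i j] by simp
    qed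
  qed
  then obtain r :: "nat \<Rightarrow> nat" where r: "strict_mono r" "AE w in lborel. Cauchy (\<lambda>i. s (r i) w)"
    by (rule cauchy_L1_AE_cauchy_subseq[OF s_int]) auto
  define G where "G w = lim (\<lambda>n. Gk (r n) w)" for w
  have [measurable]: "G \<in> borel_measurable borel"
    unfolding G_def[abs_def] by (intro borel_measurable_lim_metric Gk)
  have conv: "AE w in lborel. w < 0 \<longrightarrow> (\<lambda>n. Gk (r n) w) \<longlonglongrightarrow> G w"
    using r(2)
  proof eventually_elim
    case (elim w)
    show ?case
    proof
      assume w: "w < 0"
      have "(\<lambda>n. exp (- w) *\<^sub>R s (r n) w) = (\<lambda>n. Gk (r n) w)"
        using w by (simp add: s_def exp_minus)
      moreover obtain L where "(\<lambda>n. s (r n) w) \<longlonglongrightarrow> L"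
        using elim unfolding Cauchy_convergent_iff convergent_def by blast
      from tendsto_scaleR[OF tendsto_const[of "exp (- w)"] this]
      have "convergent (\<lambda>n. exp (- w) *\<^sub>R s (r n) w)" by (rule convergentI)
      ultimately show "(\<lambda>n. Gk (r n) w) \<longlonglongrightarrow> G w" by (simp add: G_def convergent_LIMSEQ_iff)
    qed
  qed
  have dr: "(\<lambda>n. d (r n)) \<longlonglongrightarrow> 0" using LIMSEQ_subseq_LIMSEQ[OF d_lim r(1)] by (simp add: comp_def)
  have Lx: "(\<integral>\<^sup>+w\<in>{..<0}. ennreal (exp (x * w) * norm (Gk (r n) w - G w)) \<partial>lborel) \<le> ennreal (C x * (2 powr p * d (r n)) powr (1 / p))"
    if x: "x > 0" for x n
  proof -
    let ?f = "\<lambda>m w. ennreal (exp (x * w) * norm (Gk (r n) w - Gk (r m) w)) * indicator {..<0} w"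
    have "(\<integral>\<^sup>+w\<in>{..<0}. ennreal (exp (x * w) * norm (Gk (r n) w - G w)) \<partial>lborel) = (\<integral>\<^sup>+w. liminf (\<lambda>m. ?f m w) \<partial>lborel)"
    proof (intro nn_integral_cong_AE)
      show "AE w in lborel. ennreal (exp (x * w) * norm (Gk (r n) w - G w)) * indicator {..<0} w = liminf (\<lambda>m. ?f m w)"
        using conv
      proof eventually_elim
        case (elim w)
        have "(\<lambda>m. ?f m w) \<longlonglongrightarrow> ennreal (exp (x * w) * norm (Gk (r n) w - G w)) * indicator {..<0} w"
        proof (cases "w < 0")
          case True
          then have "(\<lambda>m. ennreal (exp (x * w) * norm (Gk (r n) w - Gk (r m) w))) \<longlonglongrightarrow> ennreal (exp (x * w) * norm (Gk (r n) w - G w))"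
            using elim by (intro tendsto_intros) auto
          then show ?thesis using True by simp
        qed simp
        then show ?case by (intro lim_imp_Liminf[symmetric]) auto
      qed
    qed
    also have "\<dots> \<le> liminf (\<lambda>m. \<integral>\<^sup>+w. ?f m w \<partial>lborel)"
      by (intro nn_integral_liminf) measurable
    also have "\<dots> \<le> liminf (\<lambda>m. ennreal (C x * \<epsilon> (r n) (r m)))"
      by (intro Liminf_mono always_eventually allI L1 x)
    also have "\<dots> = ennreal (C x * (2 powr p * (d (r n) + 0)) powr (1 / p))"
    proof (intro lim_imp_Liminf)
      show "(\<lambda>m. ennreal (C x * \<epsilon> (r n) (r m))) \<longlonglongrightarrow> ennreal (C x * (2 powr p * (d (r n) + 0)) powr (1 / p))"
        unfolding \<epsilon>_def using p d0
        by (intro tendsto_ennrealI tendsto_mult tendsto_const tendsto_powr' tendsto_add dr) (auto intro!: always_eventually)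
    qed simp
    finally show ?thesis by simp
  qed
  show ?thesis
  proof (rule that[of G])
    show "G \<in> borel_measurable borel" by measurable
  next
    fix z :: complex and i assume z: "Re z > 0"
    define u where "u n w = indicator {..<0} w *\<^sub>R (exp (z * of_real w) * Gk (r n) w $ i)" for n w
    define f where "f w = indicator {..<0} w *\<^sub>R (exp (z * of_real w) * G w $ i)" for w
    have [measurable]: "u n \<in> borel_measurable borel" for n unfolding u_def[abs_def] by measurable
    have [measurable]: "f \<in> borel_measurable borel" unfolding f_def[abs_def] by measurable
    have iu: "integrable lborel (u n)" for n
      using Gint[OF z, of "r n" i] by (simp add: u_def[abs_def] set_integrable_def)
    have uf: "(\<integral>\<^sup>+w. ennreal (norm (u n w - f w)) \<partial>lborel) \<le> ennreal (C (Re z) * (2 powr p * d (r n)) powr (1 / p))" for n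
    proof (rule order_trans[OF nn_integral_mono Lx[OF z, of n]])
      fix w
      have "norm (Gk (r n) w $ i - G w $ i) \<le> norm (Gk (r n) w - G w)"
        using Finite_Cartesian_Product.norm_nth_le[of "Gk (r n) w - G w" i] by simp
      then show "ennreal (norm (u n w - f w)) \<le> ennreal (exp (Re z * w) * norm (Gk (r n) w - G w)) * indicator {..<0} w"
        by (auto simp: u_def f_def indicator_def norm_mult simp flip: right_diff_distrib intro!: ennreal_leI mult_left_mono)
    qed
    have "integrable lborel (\<lambda>w. u 0 w - f w)"
      using uf[of 0] by (intro integrableI_bounded) (auto intro: le_less_trans)
    from Bochner_Integration.integrable_diff[OF iu[of 0] this]
    have if': "integrable lborel f" by simp
    then show "set_integrable lborel {..<0} (\<lambda>w. exp (z * of_real w) * G w $ i)"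
      by (simp add: f_def[abs_def] set_integrable_def)
    have "(\<lambda>n. \<integral>\<^sup>+w. ennreal (norm (u n w - f w)) \<partial>lborel) \<longlonglongrightarrow> 0"
    proof (rule tendsto_sandwich[OF _ _ tendsto_const])
      show "(\<lambda>n. ennreal (C (Re z) * (2 powr p * d (r n)) powr (1 / p))) \<longlonglongrightarrow> 0"
      proof -
        have "(\<lambda>n. ennreal (C (Re z) * (2 powr p * d (r n)) powr (1 / p))) \<longlonglongrightarrow> ennreal (C (Re z) * (2 powr p * 0) powr (1 / p))"
          using p d0 by (intro tendsto_ennrealI tendsto_mult tendsto_const tendsto_powr' dr) (auto intro!: always_eventually)
        then show ?thesis by simp
      qed
    qed (use uf in auto)
    then have "(\<lambda>n. LINT w|lborel. u n w) \<longlonglongrightarrow> (LINT w|lborel. f w)"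
      by (intro tendsto_L1_int iu if')
    then have "(\<lambda>n. (LINT w|lborel. u n w) / of_real (sqrt (2 * pi))) \<longlonglongrightarrow> (LINT w|lborel. f w) / of_real (sqrt (2 * pi))"
      by (intro tendsto_divide tendsto_const) auto
    moreover have "(\<lambda>n. (LINT w|lborel. u n w) / of_real (sqrt (2 * pi))) = (\<lambda>n. damping (r n) z * F z $ i)"
      using Grep[OF z, of "r _" i] z by (simp add: u_def set_lebesgue_integral_def Fk_def)
    moreover have "(\<lambda>n. damping (r n) z * F z $ i) \<longlonglongrightarrow> 1 * F z $ i"
      using LIMSEQ_subseq_LIMSEQ[OF damping_tendsto[of z] r(1)] by (intro tendsto_mult tendsto_const) (simp add: comp_def)
    ultimately have "(LINT w|lborel. f w) / of_real (sqrt (2 * pi)) = 1 * F z $ i"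
      by (metis LIMSEQ_unique)
    then show "F z $ i = (LINT w:{..<0}|lborel. exp (z * of_real w) * G w $ i) / of_real (sqrt (2 * pi))"
      by (simp add: f_def set_lebesgue_integral_def)
  next
    let ?f = "\<lambda>n w. ennreal ((1 / (- p * w)) powr (q / p) * norm (Gk (r n) w) powr q) * indicator {..<0} w"
    have "?W G = (\<integral>\<^sup>+w. liminf (\<lambda>n. ?f n w) \<partial>lborel)"
    proof (intro nn_integral_cong_AE)
      show "AE w in lborel. ennreal ((1 / (- p * w)) powr (q / p) * norm (G w) powr q) * indicator {..<0} w = liminf (\<lambda>n. ?f n w)"
        using conv
      proof eventually_elim
        case (elim w)
        have "(\<lambda>n. ?f n w) \<longlonglongrightarrow> ennreal ((1 / (- p * w)) powr (q / p) * norm (G w) powr q) * indicator {..<0} w"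
        proof (cases "w < 0")
          case True
          then have "(\<lambda>n. norm (Gk (r n) w) powr q) \<longlonglongrightarrow> norm (G w) powr q"
            using elim q1 by (intro tendsto_powr' tendsto_norm tendsto_const) auto
          then have "(\<lambda>n. ennreal ((1 / (- p * w)) powr (q / p) * norm (Gk (r n) w) powr q)) \<longlonglongrightarrow> ennreal ((1 / (- p * w)) powr (q / p) * norm (G w) powr q)"
            by (intro tendsto_ennrealI tendsto_mult tendsto_const)
          then show ?thesis using True by simp
        qed simp
        then show ?case by (intro lim_imp_Liminf[symmetric]) auto
      qed
    qed
    also have "\<dots> \<le> liminf (\<lambda>n. ?W (Gk (r n)))"
      by (intro nn_integral_liminf) measurable
    also have "\<dots> \<le> ennreal (A powr (q / p))"
      by (intro Liminf_le always_eventually allI Wk) simp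
    finally show "?W G \<le> ennreal (A powr (q / p))" .
  qed
qed

section \<open>The Clifford algebra as a complex vector space over a slice\<close>

lemma blade_sign_singleton_flip:
  "blade_sign {i} (sym_diff A {i}) = - blade_sign {i} A"
  unfolding blade_sign_sym_diff_right by (simp add: blade_sign_prod)

lemma gen_mult_nth: "(gen i \<odot> x) $ B = - blade_sign {i} B * x $ (sym_diff B {i})"
proof -
  have sd: "sym_diff {i} A = B \<longleftrightarrow> A = sym_diff B {i}" for A B :: "'a set" by auto
  have "gen i \<odot> x = gen i \<odot> (\<Sum>A\<in>UNIV. x $ A *\<^sub>R blade A)"
    by (simp flip: clifford_expand)
  also have "\<dots> = (\<Sum>A\<in>UNIV. (x $ A * blade_sign {i} A) *\<^sub>R blade (sym_diff {i} A))"
    by (simp add: clifford_mult_sum_right clifford_mult_simps blade_mult)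
  finally have "(gen i \<odot> x) $ B = (\<Sum>A\<in>UNIV. x $ A * blade_sign {i} A * (if sym_diff {i} A = B then 1 else 0))"
    by (simp add: blade_nth)
  also have "\<dots> = (\<Sum>A\<in>UNIV. if A = sym_diff B {i} then x $ A * blade_sign {i} A else 0)"
    unfolding sd by (intro sum.cong) auto
  also have "\<dots> = x $ (sym_diff B {i}) * blade_sign {i} (sym_diff B {i})" by (simp del: Un_iff)
  finally show ?thesis unfolding blade_sign_singleton_flip by simp
qed

text \<open>
  Left multiplication by a generator permutes the basis blades up to sign, and the sign is reversed
  when the generator is applied a second time.
\<close>

lemma inner_gen_mult:
  "inner (gen i \<odot> x) y = - inner x (gen i \<odot> (y :: 'n::{finite,linorder} clifford))"
proof -
  have sd: "sym_diff (sym_diff B {i}) {i} = B" for B :: "'n set" by auto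
  have bij: "bij_betw (\<lambda>B :: 'n set. sym_diff B {i}) UNIV UNIV"
    by (rule bij_betwI[where g = "\<lambda>B. sym_diff B {i}"]) (auto simp: sd)
  have "inner (gen i \<odot> x) y = (\<Sum>B\<in>UNIV. (- blade_sign {i} B * x $ (sym_diff B {i})) * y $ B)"
    by (simp only: inner_vec_def gen_mult_nth inner_real_def)
  also have "\<dots> = (\<Sum>B\<in>UNIV. (- blade_sign {i} (sym_diff B {i}) * x $ (sym_diff (sym_diff B {i}) {i})) * y $ (sym_diff B {i}))"
    by (rule sum.reindex_bij_betw[OF bij, symmetric])
  also have "\<dots> = (\<Sum>B\<in>UNIV. - (x $ B * (- blade_sign {i} B * y $ (sym_diff B {i}))))"
    by (simp only: sd blade_sign_singleton_flip) (simp add: mult_ac)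
  also have "\<dots> = - inner x (gen i \<odot> y)"
    by (simp only: inner_vec_def gen_mult_nth inner_real_def sum_negf)
  finally show ?thesis .
qed

lemma inner_imag_unit_mult:
  assumes "I \<in> imag_units"
  shows "inner (I \<odot> x) y = - inner x (I \<odot> y)"
proof -
  obtain c where I: "I = (\<Sum>i\<in>UNIV. c i *\<^sub>R gen i)"
    using assms by (auto simp: imag_units_def)
  show ?thesis
    by (simp add: I clifford_mult_sum_left clifford_mult_simps inner_sum_left inner_sum_right inner_gen_mult sum_negf)
qed

lemma imag_unit_mult_twice:
  assumes "I \<in> imag_units"
  shows "I \<odot> (I \<odot> x) = - x"
  by (simp add: imag_unit_sq[OF assms] bilinear_lneg[OF bilinear_clifford_mult] flip: clifford_mult_assoc)

lemma norm_imag_unit_mult: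
  assumes "I \<in> imag_units"
  shows "norm (I \<odot> x) = norm x"
  unfolding norm_eq_sqrt_inner
  by (simp add: inner_imag_unit_mult[OF assms] imag_unit_mult_twice[OF assms])

text \<open>
  The isomorphism of \<open>\<complex>\<close> with the slice \<open>L\<^sub>I\<close>.
\<close>

definition of_complex :: "'n::{finite,linorder} clifford \<Rightarrow> complex \<Rightarrow> 'n clifford" where
  "of_complex I z = slice_pt I (Re z) (Im z)"

lemma of_complex_mult:
  assumes "I \<in> imag_units"
  shows "of_complex I (z * w) = of_complex I z \<odot> of_complex I w"
  using imag_unit_sq[OF assms]
  by (simp add: of_complex_def slice_pt_def clifford_mult_simps algebra_simps)

lemma bounded_linear_of_complex: "bounded_linear (of_complex I)"
  unfolding of_complex_def[abs_def] slice_pt_def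
  by (intro bounded_linear_add bounded_linear_scaleR_left[THEN bounded_linear_compose] bounded_linear_Re bounded_linear_Im)

lemma clifford_power_of_complex:
  assumes "I \<in> imag_units"
  shows "clifford_power (of_complex I z) k = of_complex I (z ^ k)"
proof (induction k)
  case 0
  show ?case by (simp add: of_complex_def slice_pt_def)
qed (simp add: of_complex_mult[OF assms])

lemma clifford_exp_of_complex:
  assumes "I \<in> imag_units"
  shows "clifford_exp (of_complex I z) = of_complex I (exp z)"
proof -
  interpret L: bounded_linear "of_complex I" by (rule bounded_linear_of_complex)
  have "(\<lambda>k. of_complex I (z ^ k /\<^sub>R fact k)) sums of_complex I (exp z)"
    unfolding exp_def by (intro L.sums summable_sums summable_exp_generic)
  then show ?thesis
    unfolding clifford_exp_def clifford_power_of_complex[OF assms]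
    by (simp add: L.scaleR sums_iff inverse_eq_divide)
qed

lemma scaleR_slice_pt: "w *\<^sub>R slice_pt I u v = of_complex I (Complex u v * of_real w)"
  by (simp add: slice_pt_def of_complex_def algebra_simps)

lemma of_complex_mult_left: "of_complex I z \<odot> x = Re z *\<^sub>R x + Im z *\<^sub>R (I \<odot> x)"
  by (simp add: of_complex_def slice_pt_def clifford_mult_simps)

text \<open>
  Left multiplication by \<open>I\<close> makes the algebra a complex vector space.  The functional
  \<open>x \<mapsto> x\<^sub>A - i (I x)\<^sub>A\<close> is complex linear for this structure; the \<open>2\<^sup>n\<close> functionals together give an
  embedding that multiplies the norm by \<open>sqrt 2\<close>, because \<open>x\<close> and \<open>I x\<close> have the same norm.
\<close>

definition complexify :: "'n::{finite,linorder} clifford \<Rightarrow> 'n clifford \<Rightarrow> complex ^ 'n set" where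
  "complexify I x = (\<chi> A. Complex (x $ A) (- ((I \<odot> x) $ A)) / of_real (sqrt 2))"

text \<open>
  The adjoint of the embedding, which is a contractive complex-linear left inverse.
\<close>

definition decomplexify :: "'n::{finite,linorder} clifford \<Rightarrow> complex ^ 'n set \<Rightarrow> 'n clifford" where
  "decomplexify I y = (1 / sqrt 2) *\<^sub>R (\<Sum>A\<in>UNIV. of_complex I (y $ A) \<odot> blade A)"

lemma norm_complexify:
  assumes "I \<in> imag_units"
  shows "norm (complexify I x) = norm x"
proof -
  have sq: "(norm y)\<^sup>2 = (\<Sum>A\<in>UNIV. (y $ A)\<^sup>2)" for y :: "'a clifford"
    unfolding power2_norm_eq_inner inner_vec_def by (simp add: power2_eq_square)
  have "(norm (complexify I x))\<^sup>2 = (\<Sum>A\<in>UNIV. ((x $ A)\<^sup>2 + ((I \<odot> x) $ A)\<^sup>2) / 2)"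
    unfolding norm_vec_sq complexify_def by (simp add: norm_divide power_divide cmod_power2)
  also have "\<dots> = ((norm x)\<^sup>2 + (norm (I \<odot> x))\<^sup>2) / 2"
    by (simp add: sq sum.distrib flip: sum_divide_distrib)
  also have "\<dots> = (norm x)\<^sup>2" by (simp add: norm_imag_unit_mult[OF assms])
  finally show ?thesis by (simp add: power2_eq_iff_nonneg)
qed

lemma linear_complexify: "linear (complexify I)"
  by (intro linearI)
    (auto simp: complexify_def vec_eq_iff clifford_mult_simps complex_eq_iff Re_divide_of_real Im_divide_of_real algebra_simps add_divide_distrib diff_divide_distrib)

lemma complexify_I:
  assumes "I \<in> imag_units"
  shows "complexify I (I \<odot> x) = \<i> *s complexify I x"
  by (simp add: complexify_def vec_eq_iff imag_unit_mult_twice[OF assms] complex_eq_iff Re_divide_of_real Im_divide_of_real)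

lemma linear_decomplexify: "linear (decomplexify I)"
  by (intro linearI)
    (auto simp: decomplexify_def of_complex_mult_left algebra_simps sum.distrib scaleR_sum_right)

lemma decomplexify_complexify:
  assumes "I \<in> imag_units"
  shows "decomplexify I (complexify I x) = x"
proof -
  have "decomplexify I (complexify I x) = (1 / 2) *\<^sub>R (\<Sum>A\<in>UNIV. x $ A *\<^sub>R blade A - (I \<odot> x) $ A *\<^sub>R (I \<odot> blade A))"
    by (simp add: decomplexify_def complexify_def of_complex_mult_left Re_divide_of_real Im_divide_of_real
        scaleR_sum_right algebra_simps real_sqrt_mult_self[simplified])
  also have "(\<Sum>A\<in>UNIV. x $ A *\<^sub>R blade A - (I \<odot> x) $ A *\<^sub>R (I \<odot> blade A)) = x - I \<odot> (I \<odot> x)"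
  proof -
    have "I \<odot> (I \<odot> x) = I \<odot> (\<Sum>A\<in>UNIV. (I \<odot> x) $ A *\<^sub>R blade A)" by (simp flip: clifford_expand)
    also have "\<dots> = (\<Sum>A\<in>UNIV. (I \<odot> x) $ A *\<^sub>R (I \<odot> blade A))"
      by (simp add: clifford_mult_sum_right clifford_mult_simps)
    finally show ?thesis by (simp add: sum_subtractf flip: clifford_expand)
  qed
  also have "\<dots> = 2 *\<^sub>R x" by (simp add: imag_unit_mult_twice[OF assms] scaleR_2)
  finally show ?thesis by simp
qed

lemma decomplexify_smult:
  assumes "I \<in> imag_units"
  shows "decomplexify I (c *s y) = of_complex I c \<odot> decomplexify I y"
  by (simp add: decomplexify_def clifford_mult_sum_right clifford_mult_simps of_complex_mult[OF assms] clifford_mult_assoc)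

lemma decomplexify_adjoint:
  assumes "I \<in> imag_units"
  shows "inner (decomplexify I y) x = inner y (complexify I x)"
proof -
  have "inner (blade A) z = (\<Sum>B\<in>UNIV. if A = B then z $ B else 0)" for A and z :: "'a clifford"
    unfolding inner_vec_def by (intro sum.cong) (auto simp: blade_nth)
  then have "inner (blade A) z = z $ A" for A and z :: "'a clifford" by simp
  then have "inner (of_complex I (y $ A) \<odot> blade A) x / sqrt 2 = inner (y $ A) (complexify I x $ A)" for A
    by (simp add: of_complex_mult_left inner_add_left inner_imag_unit_mult[OF assms] complexify_def inner_complex_def
       Re_divide_of_real Im_divide_of_real add_divide_distrib diff_divide_distrib)
  then have "(\<Sum>A\<in>UNIV. inner (of_complex I (y $ A) \<odot> blade A) x / sqrt 2) = inner y (complexify I x)"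
    unfolding inner_vec_def[of y] by simp
  then show ?thesis
    by (simp add: decomplexify_def inner_sum_left sum_divide_distrib)
qed

lemma norm_decomplexify_le:
  assumes "I \<in> imag_units"
  shows "norm (decomplexify I y) \<le> norm y"
proof (cases "decomplexify I y = 0")
  case False
  have "(norm (decomplexify I y))\<^sup>2 = inner y (complexify I (decomplexify I y))"
    by (simp add: power2_norm_eq_inner decomplexify_adjoint[OF assms])
  also have "\<dots> \<le> norm y * norm (decomplexify I y)"
    using norm_cauchy_schwarz[of y "complexify I (decomplexify I y)"] by (simp add: norm_complexify[OF assms])
  finally show ?thesis using False by (simp add: power2_eq_square)
qed simp

section \<open>Slice monogenic functions as holomorphic functions\<close>

lemma slice_pt_in_half_space: "I \<in> imag_units \<Longrightarrow> u > 0 \<Longrightarrow> slice_pt I u v \<in> half_space"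
  by (auto simp: half_space_def)

text \<open>
  The slice equation says that the partial derivative in \<open>v\<close> is \<open>I\<close> times the one in \<open>u\<close>; hence the
  real derivative of the restriction to the slice commutes with multiplication by \<open>I\<close>, and its image
  under the embedding is complex linear.
\<close>

lemma slice_restriction_holomorphic:
  fixes f :: "'n::{finite,linorder} clifford \<Rightarrow> 'n clifford"
  assumes f: "f \<in> left_slice_monogenic half_space" and I: "I \<in> imag_units"
  shows "(\<lambda>z. complexify I (f (of_complex I z)) $ A) holomorphic_on RHP"
proof -
  let ?\<phi> = "of_complex I" and ?T = "complexify I"
  have bl: "bounded_linear ?\<phi>" by (rule bounded_linear_of_complex)
  have bT: "bounded_linear (\<lambda>x. ?T x $ A)"
    by (rule bounded_linear_compose[OF bounded_linear_vec_nth])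
      (use linear_complexify[of I] in \<open>simp add: linear_conv_bounded_linear\<close>)
  have img: "?\<phi> ` RHP \<subseteq> half_space"
    using I by (auto simp: of_complex_def intro: slice_pt_in_half_space)
  have "\<exists>c. ((\<lambda>z. ?T (f (?\<phi> z)) $ A) has_field_derivative c) (at z)" if z: "Re z > 0" for z
  proof -
    have "f differentiable (at (?\<phi> z) within half_space)"
      using f img z by (auto simp: left_slice_monogenic_def differentiable_on_def)
    then obtain f' where f': "(f has_derivative f') (at (?\<phi> z) within half_space)"
      by (auto simp: differentiable_def)
    have "(?\<phi> has_derivative ?\<phi>) (at z within RHP)"
      by (rule bounded_linear_imp_has_derivative[OF bl])
    moreover have "(f has_derivative f') (at (?\<phi> z) within ?\<phi> ` RHP)"
      by (rule has_derivative_subset[OF f' img])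
    ultimately have "(f \<circ> ?\<phi> has_derivative f' \<circ> ?\<phi>) (at z within RHP)"
      by (rule diff_chain_within)
    then have d: "((\<lambda>z. f (?\<phi> z)) has_derivative (\<lambda>h. f' (?\<phi> h))) (at z)"
      using z by (simp add: comp_def at_within_open[OF _ open_RHP])
    define D where "D h = f' (?\<phi> h)" for h
    have D: "bounded_linear D" using d unfolding D_def[abs_def] by (rule has_derivative_bounded_linear)
    interpret D: bounded_linear D by fact
    have path: "((\<lambda>t. f (?\<phi> (\<gamma> t))) has_vector_derivative D h) (at t)"
      if "(\<gamma> has_vector_derivative h) (at t)" "\<gamma> t = z" for \<gamma> h t
    proof -
      have "((\<lambda>z. f (?\<phi> z)) \<circ> \<gamma> has_derivative D \<circ> (\<lambda>s. s *\<^sub>R h)) (at t)"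
        using that d unfolding has_vector_derivative_def D_def[abs_def]
        by (intro diff_chain_at) simp_all
      then show ?thesis by (simp add: has_vector_derivative_def comp_def D.scaleR)
    qed
    have "((\<lambda>s. Complex s (Im z)) has_vector_derivative 1) (at (Re z))"
      unfolding Complex_eq by (auto intro!: derivative_eq_intros)
    from path[OF this] have du: "((\<lambda>s. f (slice_pt I s (Im z))) has_vector_derivative D 1) (at (Re z))"
      by (simp add: of_complex_def)
    have "((\<lambda>t. Complex (Re z) t) has_vector_derivative \<i>) (at (Im z))"
      unfolding Complex_eq by (auto intro!: derivative_eq_intros)
    from path[OF this] have dv: "((\<lambda>t. f (slice_pt I (Re z) t)) has_vector_derivative D \<i>) (at (Im z))"
      by (simp add: of_complex_def)
    have "slice_pt I (Re z) (Im z) \<in> half_space" using I z by (rule slice_pt_in_half_space)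
    then have "(1/2) *\<^sub>R (vector_derivative (\<lambda>s. f (slice_pt I s (Im z))) (at (Re z)) +
        I \<odot> vector_derivative (\<lambda>t. f (slice_pt I (Re z) t)) (at (Im z))) = 0"
      using f I unfolding left_slice_monogenic_def by blast
    then have "(1/2) *\<^sub>R (D 1 + I \<odot> D \<i>) = 0"
      unfolding vector_derivative_at[OF du] vector_derivative_at[OF dv] .
    then have CR: "D 1 + I \<odot> D \<i> = 0" by simp
    then have "I \<odot> (D 1 + I \<odot> D \<i>) = 0" by (simp add: clifford_mult_simps)
    then have Di: "D \<i> = I \<odot> D 1"
      by (simp add: clifford_mult_simps imag_unit_mult_twice[OF I])
    have Dh: "?T (D h) = h *s ?T (D 1)" for h
    proof -
      have "h = Re h *\<^sub>R 1 + Im h *\<^sub>R \<i>" by (simp add: complex_eq_iff)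
      then have "D h = Re h *\<^sub>R D 1 + Im h *\<^sub>R D \<i>" by (metis D.add D.scaleR)
      then have "?T (D h) = Re h *\<^sub>R ?T (D 1) + Im h *\<^sub>R (\<i> *s ?T (D 1))"
        by (simp add: Di linear_add[OF linear_complexify] linear_scale[OF linear_complexify] complexify_I[OF I])
      then show ?thesis by (simp add: vec_eq_iff complex_eq_iff algebra_simps)
    qed
    have "((\<lambda>z. ?T (f (?\<phi> z)) $ A) has_derivative (\<lambda>h. ?T (D h) $ A)) (at z)"
      using bounded_linear.has_derivative[OF bT d] by (simp add: D_def)
    moreover have "(\<lambda>h. ?T (D h) $ A) = (\<lambda>h. ?T (D 1) $ A * h)"
    proof
      show "?T (D h) $ A = ?T (D 1) $ A * h" for h
        by (subst Dh[of h]) (simp add: mult.commute)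
    qed
    ultimately have "((\<lambda>z. ?T (f (?\<phi> z)) $ A) has_derivative (\<lambda>h. ?T (D 1) $ A * h)) (at z)"
      by (rule subst[rotated])
    then show ?thesis unfolding has_field_derivative_def by blast
  qed
  then show ?thesis
    unfolding holomorphic_on_open[OF open_RHP] by auto
qed

lemma bounded_linear_decomplexify: "bounded_linear (decomplexify I)"
  using linear_decomplexify by (simp add: linear_conv_bounded_linear)

lemma slice_Laplace_representation:
  fixes G :: "real \<Rightarrow> complex ^ 'n::{finite,linorder} set"
  assumes I: "I \<in> imag_units"
    and int: "\<And>A. set_integrable lborel {..<0} (\<lambda>w. exp (Complex u v * of_real w) * G w $ A)"
    and rep: "\<And>A. F $ A = (LINT w:{..<0}|lborel. exp (Complex u v * of_real w) * G w $ A) / of_real (sqrt (2 * pi))"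
  shows "set_integrable lborel {..<0} (\<lambda>w. clifford_exp (w *\<^sub>R slice_pt I u v) \<odot> decomplexify I (G w))"
    and "decomplexify I F = (1 / sqrt (2 * pi)) *\<^sub>R
         (LINT w:{..<0}|lborel. clifford_exp (w *\<^sub>R slice_pt I u v) \<odot> decomplexify I (G w))"
proof -
  define h where "h A w = indicator {..<0} w *\<^sub>R (exp (Complex u v * of_real w) * G w $ A)" for A w
  have ih: "integrable lborel (h A)" for A using int[of A] by (simp add: h_def[abs_def] set_integrable_def)
  define L where "L A c = (1 / sqrt 2) *\<^sub>R (of_complex I c \<odot> blade A)" for A c
  have bL: "bounded_linear (L A)" for A
  proof -
    have "bounded_linear (\<lambda>c. of_complex I c \<odot> blade A)"
      unfolding of_complex_mult_left
      by (intro bounded_linear_add bounded_linear_scaleR_left[THEN bounded_linear_compose] bounded_linear_Re bounded_linear_Im)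
    then show ?thesis unfolding L_def[abs_def]
      by (rule bounded_linear_compose[OF bounded_linear_scaleR_right])
  qed
  have dec: "decomplexify I y = (\<Sum>A\<in>UNIV. L A (y $ A))" for y
    by (simp add: decomplexify_def L_def scaleR_sum_right)
  have eq: "indicator {..<0} w *\<^sub>R (clifford_exp (w *\<^sub>R slice_pt I u v) \<odot> decomplexify I (G w)) = (\<Sum>A\<in>UNIV. L A (h A w))" for w
  proof -
    have "clifford_exp (w *\<^sub>R slice_pt I u v) \<odot> decomplexify I (G w) = decomplexify I (exp (Complex u v * of_real w) *s G w)"
      unfolding scaleR_slice_pt clifford_exp_of_complex[OF I] decomplexify_smult[OF I] ..
    also have "\<dots> = (\<Sum>A\<in>UNIV. L A (exp (Complex u v * of_real w) * G w $ A))"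
      by (simp add: dec)
    finally show ?thesis
      by (simp add: h_def scaleR_sum_right linear_simps(5)[OF bL])
  qed
  have iL: "integrable lborel (\<lambda>w. L A (h A w))" for A
    by (rule integrable_bounded_linear[OF bL ih])
  show "set_integrable lborel {..<0} (\<lambda>w. clifford_exp (w *\<^sub>R slice_pt I u v) \<odot> decomplexify I (G w))"
    unfolding set_integrable_def eq using iL by simp
  have "(LINT w:{..<0}|lborel. clifford_exp (w *\<^sub>R slice_pt I u v) \<odot> decomplexify I (G w)) = (\<Sum>A\<in>UNIV. LINT w|lborel. L A (h A w))"
    unfolding set_lebesgue_integral_def eq by (rule Bochner_Integration.integral_sum) (rule iL)
  also have "\<dots> = (\<Sum>A\<in>UNIV. L A (LINT w|lborel. h A w))"
    by (intro sum.cong refl integral_bounded_linear bL ih)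
  also have "\<dots> = (\<Sum>A\<in>UNIV. L A (sqrt (2 * pi) *\<^sub>R F $ A))"
  proof (intro sum.cong refl)
    fix A
    have "(LINT w|lborel. h A w) = sqrt (2 * pi) *\<^sub>R F $ A"
      unfolding rep[of A] by (simp add: h_def set_lebesgue_integral_def scaleR_conv_of_real del: real_sqrt_mult)
    then show "L A (LINT w|lborel. h A w) = L A (sqrt (2 * pi) *\<^sub>R F $ A)" by simp
  qed
  also have "\<dots> = sqrt (2 * pi) *\<^sub>R decomplexify I F"
    by (simp add: dec linear_simps(5)[OF bL] scaleR_sum_right)
  finally show "decomplexify I F = (1 / sqrt (2 * pi)) *\<^sub>R
         (LINT w:{..<0}|lborel. clifford_exp (w *\<^sub>R slice_pt I u v) \<odot> decomplexify I (G w))"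
    by simp
qed

section \<open>The slice Bergman space\<close>

text \<open>
  The value \<open>0\<close> outside the half-plane makes the function Borel measurable everywhere.
\<close>

definition slice_lift :: "('n::{finite,linorder} clifford \<Rightarrow> 'n clifford) \<Rightarrow> 'n clifford \<Rightarrow> complex \<Rightarrow> complex ^ 'n set" where
  "slice_lift f I z = (if Re z > 0 then complexify I (f (of_complex I z)) else 0)"

lemma slice_lift_holomorphic:
  assumes "f \<in> left_slice_monogenic half_space" and "I \<in> imag_units"
  shows "(\<lambda>z. slice_lift f I z $ A) holomorphic_on RHP"
  by (rule holomorphic_transform[OF slice_restriction_holomorphic[OF assms, of A]]) (auto simp: slice_lift_def)

lemma slice_lift_measurable:
  assumes "f \<in> left_slice_monogenic half_space" and "I \<in> imag_units"
  shows "slice_lift f I \<in> borel_measurable borel"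
proof -
  have "(\<lambda>z. indicator RHP z *\<^sub>R (complexify I (f (of_complex I z)) $ A)) \<in> borel_measurable borel" for A
    by (rule borel_measurable_continuous_on_indicator)
      (use open_RHP slice_restriction_holomorphic[OF assms, of A] in \<open>auto intro: holomorphic_on_imp_continuous_on\<close>)
  then have "(\<lambda>z. \<chi> A. indicator RHP z *\<^sub>R (complexify I (f (of_complex I z)) $ A)) \<in> borel_measurable borel"
    by measurable
  also have "(\<lambda>z. \<chi> A. indicator RHP z *\<^sub>R (complexify I (f (of_complex I z)) $ A)) = slice_lift f I"
    by (auto simp: slice_lift_def vec_eq_iff indicator_def)
  finally show ?thesis .
qed

lemma decomplexify_slice_lift:
  assumes "I \<in> imag_units" "u > 0"
  shows "decomplexify I (slice_lift f I (Complex u v)) = f (slice_pt I u v)"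
  using assms by (simp add: slice_lift_def decomplexify_complexify of_complex_def)

lemma nn_integral_slice_lift:
  assumes "I \<in> imag_units"
  shows "area_Lp p (slice_lift f I)
    = (\<integral>\<^sup>+u\<in>{0<..}. (\<integral>\<^sup>+v. ennreal (norm (f (slice_pt I u v)) powr p) \<partial>lborel) \<partial>lborel)"
  by (intro nn_integral_cong) (auto simp: indicator_def slice_lift_def norm_complexify[OF assms] of_complex_def)

lemma decomplexify_measurable [measurable]: "decomplexify I \<in> borel_measurable borel"
  by (intro borel_measurable_continuous_onI linear_continuous_on bounded_linear_decomplexify)

lemma space_neg_line: "space neg_line = {..<0}"
  by (simp add: neg_line_def space_restrict_space)

lemma measurable_neg_line: "g \<in> borel_measurable borel \<Longrightarrow> g \<in> borel_measurable neg_line"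
  unfolding neg_line_def by (rule measurable_restrict_space1) simp

lemma nn_integral_neg_line: "(\<integral>\<^sup>+w. h w \<partial>neg_line) = (\<integral>\<^sup>+w\<in>{..<0}. h w \<partial>lborel)"
  unfolding neg_line_def by (subst nn_integral_restrict_space) auto

lemma esssup_neg_line_le:
  fixes g :: "real \<Rightarrow> 'b :: euclidean_space"
  assumes [measurable]: "g \<in> borel_measurable borel" and "\<And>w. w < 0 \<Longrightarrow> norm (g w) / (- w) \<le> s"
  shows "esssup neg_line (\<lambda>w. ennreal (norm (g w) / (- w))) \<le> ennreal s"
proof (rule esssup_I)
  show "(\<lambda>w. ennreal (norm (g w) / (- w))) \<in> borel_measurable neg_line"
    by (rule measurable_neg_line) measurable
  show "AE w in neg_line. ennreal (norm (g w) / (- w)) \<le> ennreal s"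
    by (intro AE_I2 ennreal_leI assms(2)) (simp add: space_neg_line)
qed

lemma weighted_Lq_finite:
  fixes g :: "real \<Rightarrow> 'b :: euclidean_space"
  assumes [measurable]: "g \<in> borel_measurable borel" and p: "p > 0" and q: "q > 0"
    and fin: "weighted_Lq_int p q g < \<infinity>"
  shows "g \<in> weighted_Lq p (ennreal q)"
proof -
  have "(\<integral>\<^sup>+w. ennreal (norm (g w) powr q) \<partial>density neg_line (\<lambda>w. ennreal ((- w) powr (- q / p))))
    = (\<integral>\<^sup>+w. ennreal ((- w) powr (- q / p)) * ennreal (norm (g w) powr q) \<partial>neg_line)"
    by (intro nn_integral_density measurable_neg_line) measurable
  also have "\<dots> = (\<integral>\<^sup>+w\<in>{..<0}. ennreal ((- w) powr (- q / p)) * ennreal (norm (g w) powr q) \<partial>lborel)"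
    by (rule nn_integral_neg_line)
  also have "\<dots> = (\<integral>\<^sup>+w. ennreal (p powr (q / p)) * (ennreal ((1 / (- p * w)) powr (q / p) * norm (g w) powr q) * indicator {..<0} w) \<partial>lborel)"
  proof (intro nn_integral_cong)
    fix w :: real
    have "(- w) powr (- q / p) = p powr (q / p) * (1 / (- p * w)) powr (q / p)" if "w < 0"
    proof -
      have "1 / (- p * w) = (1 / p) * (1 / (- w))" by simp
      then have "(1 / (- p * w)) powr (q / p) = (1 / p) powr (q / p) * (1 / (- w)) powr (q / p)"
        using p that by (simp only: powr_mult)
      moreover have "p powr (q / p) * (1 / p) powr (q / p) = 1" using p by (simp add: powr_divide)
      moreover have "(1 / t) powr x = t powr (- x)" if "t > 0" for t x :: real
        using that by (simp add: powr_divide powr_minus_divide)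
      from this[of "- w" "q / p"] have "(1 / (- w)) powr (q / p) = (- w) powr (- q / p)" using that by simp
      ultimately show ?thesis by (simp flip: mult.assoc)
    qed
    then show "ennreal ((- w) powr (- q / p)) * ennreal (norm (g w) powr q) * indicator {..<0} w =
      ennreal (p powr (q / p)) * (ennreal ((1 / (- p * w)) powr (q / p) * norm (g w) powr q) * indicator {..<0} w)"
      by (cases "w < 0") (simp_all add: mult.assoc flip: ennreal_mult)
  qed
  also have "\<dots> = ennreal (p powr (q / p)) * weighted_Lq_int p q g"
    by (rule nn_integral_cmult) measurable
  also have "\<dots> < \<infinity>" using fin by (simp add: ennreal_mult_less_top)
  finally show ?thesis
    using q by (simp add: weighted_Lq_def measurable_neg_line)
qed

lemma conjugate_exponent_ennreal:
  assumes "1 \<le> p" and "1 / ennreal p + 1 / q = 1"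
  shows "p = 1 \<Longrightarrow> q = \<infinity>"
    and "1 < p \<Longrightarrow> \<exists>r. q = ennreal r \<and> 1 < r \<and> 1 / p + 1 / r = 1"
proof -
  have p': "1 / ennreal p = ennreal (1 / p)"
    using assms(1) divide_ennreal[of 1 p] by simp
  {
    assume "p = 1"
    then have "1 + 1 / q = 1 + (0::ennreal)" using assms(2) by simp
    then have "1 / q = 0" by (subst (asm) ennreal_add_left_cancel) simp
    then show "q = \<infinity>" by (simp add: ennreal_divide_eq_0_iff)
  }
  assume p: "1 < p"
  show "\<exists>r. q = ennreal r \<and> 1 < r \<and> 1 / p + 1 / r = 1"
  proof (cases q)
    case top
    then have "ennreal (1 / p) = ennreal 1" using assms(2) p' by simp
    then show ?thesis using p by (subst (asm) ennreal_inj) auto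
  next
    case (real r)
    have "r \<noteq> 0"
    proof
      assume "r = 0"
      then have "1 / q = \<infinity>" using real by simp
      then show False using assms(2) by simp
    qed
    then have r: "r > 0" using real by simp
    then have "1 / q = ennreal (1 / r)" using real divide_ennreal[of 1 r] by simp
    then have "ennreal (1 / p + 1 / r) = ennreal 1" using assms(2) p' p r by simp
    then have eq: "1 / p + 1 / r = 1" using p r by (subst (asm) ennreal_inj) auto
    then show ?thesis using real conjugate_exponent_gt_1[OF p eq] by auto
  qed
qed

theorem theorem3p19:
  fixes p :: real and q :: ennreal
    and f :: "'n::{finite,linorder} clifford \<Rightarrow> 'n clifford"
  assumes "1 \<le> p" and "p \<le> 2" and "1 / ennreal p + 1 / q = 1"
    and "f \<in> slice_bergman p"
  shows "\<forall>I\<in>imag_units. \<exists>g\<in>weighted_Lq p q.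
    (\<forall>u v. u > 0 \<longrightarrow>
       set_integrable lborel {..<0} (\<lambda>w. clifford_exp (w *\<^sub>R slice_pt I u v) \<odot> g w) \<and>
       f (slice_pt I u v) = (1 / sqrt (2 * pi)) *\<^sub>R
         (LINT w:{..<0}|lborel. clifford_exp (w *\<^sub>R slice_pt I u v) \<odot> g w)) \<and>
    (1 < p \<longrightarrow>
       ennreal_powr (\<integral>\<^sup>+w\<in>{..<0}. ennreal ((1 / (- p * w)) powr (enn2real q / p) *
           norm (g w) powr enn2real q) \<partial>lborel) (1 / enn2real q) \<le> bergman_norm p f \<and>
       bergman_norm p f < \<infinity>) \<and>
    (p = 1 \<longrightarrow>
       esssup neg_line (\<lambda>w. ennreal (norm (g w) / (- w))) \<le> bergman_norm 1 f \<and>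
       bergman_norm 1 f < \<infinity>)"
proof
  fix I :: "'n clifford" assume I: "I \<in> imag_units"
  define S where "S = (SUP I\<in>imag_units. \<integral>\<^sup>+u\<in>{0<..}. (\<integral>\<^sup>+v. ennreal (norm (f (slice_pt I u v)) powr p) \<partial>lborel) \<partial>lborel)"
  have f: "f \<in> left_slice_monogenic half_space" and fin: "bergman_norm p f < \<infinity>"
    using assms(4) by (auto simp: slice_bergman_def)
  have norm_S: "bergman_norm p f = ennreal_powr S (1 / p)" by (simp add: bergman_norm_def S_def)
  have "S \<noteq> \<infinity>" using fin unfolding norm_S by (auto simp: ennreal_powr_def)
  then obtain s where s: "S = ennreal s" "s \<ge> 0" by (cases S) auto
  have norm_s: "bergman_norm p f = ennreal (s powr (1 / p))"
    using s unfolding norm_S by (simp add: ennreal_powr_def)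
  let ?F = "slice_lift f I"
  have hol: "(\<lambda>z. ?F z $ A) holomorphic_on RHP" for A by (rule slice_lift_holomorphic[OF f I])
  have meas: "?F \<in> borel_measurable borel" by (rule slice_lift_measurable[OF f I])
  have area: "area_Lp p ?F \<le> ennreal s"
    unfolding nn_integral_slice_lift[OF I] s(1)[symmetric] S_def using I by (rule SUP_upper)
  have rep: "set_integrable lborel {..<0} (\<lambda>w. clifford_exp (w *\<^sub>R slice_pt I u v) \<odot> decomplexify I (G w)) \<and>
      f (slice_pt I u v) = (1 / sqrt (2 * pi)) *\<^sub>R (LINT w:{..<0}|lborel. clifford_exp (w *\<^sub>R slice_pt I u v) \<odot> decomplexify I (G w))"
    if "\<And>z A. Re z > 0 \<Longrightarrow> set_integrable lborel {..<0} (\<lambda>w. exp (z * of_real w) * G w $ A)"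
      "\<And>z A. Re z > 0 \<Longrightarrow> ?F z $ A = (LINT w:{..<0}|lborel. exp (z * of_real w) * G w $ A) / of_real (sqrt (2 * pi))"
      "u > 0" for G :: "real \<Rightarrow> complex ^ 'n set" and u v
    using slice_Laplace_representation[OF I that(1)[of "Complex u v"] that(2)[of "Complex u v"]] that(3)
      decomplexify_slice_lift[OF I that(3), of f v] by simp
  consider "p = 1" | "1 < p" using assms(1) by linarith
  then show "\<exists>g\<in>weighted_Lq p q.
    (\<forall>u v. u > 0 \<longrightarrow>
       set_integrable lborel {..<0} (\<lambda>w. clifford_exp (w *\<^sub>R slice_pt I u v) \<odot> g w) \<and>
       f (slice_pt I u v) = (1 / sqrt (2 * pi)) *\<^sub>R
         (LINT w:{..<0}|lborel. clifford_exp (w *\<^sub>R slice_pt I u v) \<odot> g w)) \<and>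
    (1 < p \<longrightarrow>
       ennreal_powr (\<integral>\<^sup>+w\<in>{..<0}. ennreal ((1 / (- p * w)) powr (enn2real q / p) *
           norm (g w) powr enn2real q) \<partial>lborel) (1 / enn2real q) \<le> bergman_norm p f \<and>
       bergman_norm p f < \<infinity>) \<and>
    (p = 1 \<longrightarrow>
       esssup neg_line (\<lambda>w. ennreal (norm (g w) / (- w))) \<le> bergman_norm 1 f \<and>
       bergman_norm 1 f < \<infinity>)"
  proof cases
    case 1
    have q: "q = \<infinity>" using conjugate_exponent_ennreal(1)[OF assms(1,3) 1] .
    have area1: "(\<integral>\<^sup>+u\<in>{0<..}. \<integral>\<^sup>+v. ennreal (norm (?F (Complex u v))) \<partial>lborel \<partial>lborel) \<le> ennreal s"
      using area 1 by simp
    obtain G :: "real \<Rightarrow> complex ^ 'n set" where G: "G \<in> borel_measurable borel"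
      "\<And>z A. Re z > 0 \<Longrightarrow> set_integrable lborel {..<0} (\<lambda>w. exp (z * of_real w) * G w $ A)"
      "\<And>z A. Re z > 0 \<Longrightarrow> ?F z $ A = (LINT w:{..<0}|lborel. exp (z * of_real w) * G w $ A) / of_real (sqrt (2 * pi))"
      "\<And>w. w < 0 \<Longrightarrow> norm (G w) / (- w) \<le> s"
      by (rule Paley_Wiener_Bergman_1[OF hol meas _ area1 s(2)]) (auto simp: slice_lift_def intro: that)
    note [measurable] = G(1)
    define g where "g w = decomplexify I (G w)" for w
    have [measurable]: "g \<in> borel_measurable borel" unfolding g_def[abs_def] by measurable
    have gs: "norm (g w) / (- w) \<le> s" if "w < 0" for w
    proof -
      have "norm (g w) / (- w) \<le> norm (G w) / (- w)"
        unfolding g_def using that by (intro divide_right_mono norm_decomplexify_le I) auto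
      then show ?thesis using G(4)[OF that] by simp
    qed
    have ess: "esssup neg_line (\<lambda>w. ennreal (norm (g w) / (- w))) \<le> ennreal s"
      by (rule esssup_neg_line_le) (use gs in auto)
    have "bergman_norm 1 f = ennreal s" using norm_s 1 s by simp
    moreover have "g \<in> weighted_Lq p q"
      using le_less_trans[OF ess ennreal_less_top] by (simp add: weighted_Lq_def q measurable_neg_line)
    ultimately show ?thesis
      using rep[OF G(2,3)] ess 1 by (intro bexI[of _ g]) (auto simp: g_def[abs_def])
  next
    case 2
    obtain r where r: "q = ennreal r" "1 < r" "1 / p + 1 / r = 1"
      using conjugate_exponent_ennreal(2)[OF assms(1,3) 2] by blast
    have er: "enn2real q = r" using r by simp
    obtain G :: "real \<Rightarrow> complex ^ 'n set" where G: "G \<in> borel_measurable borel"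
      "\<And>z A. Re z > 0 \<Longrightarrow> set_integrable lborel {..<0} (\<lambda>w. exp (z * of_real w) * G w $ A)"
      "\<And>z A. Re z > 0 \<Longrightarrow> ?F z $ A = (LINT w:{..<0}|lborel. exp (z * of_real w) * G w $ A) / of_real (sqrt (2 * pi))"
      "weighted_Lq_int p r G \<le> ennreal (s powr (r / p))"
      by (rule Paley_Wiener_Bergman_gt_1[OF hol meas 2 assms(2) r(3) area s(2)]) (rule that)
    note [measurable] = G(1)
    define g where "g w = decomplexify I (G w)" for w
    have [measurable]: "g \<in> borel_measurable borel" unfolding g_def[abs_def] by measurable
    let ?X = "weighted_Lq_int p r g"
    have X: "?X \<le> ennreal (s powr (r / p))"
    proof (rule order_trans[OF nn_integral_mono G(4)])
      fix w
      have "norm (g w) powr r \<le> norm (G w) powr r"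
        unfolding g_def using r by (intro powr_mono2 norm_decomplexify_le I) auto
      then show "ennreal ((1 / (- p * w)) powr (r / p) * norm (g w) powr r) * indicator {..<0} w
        \<le> ennreal ((1 / (- p * w)) powr (r / p) * norm (G w) powr r) * indicator {..<0} w"
        by (intro mult_right_mono ennreal_leI mult_left_mono) auto
    qed
    have "ennreal_powr ?X (1 / r) \<le> bergman_norm p f"
    proof -
      have "?X \<noteq> \<infinity>" using X by (auto simp: top_unique)
      then obtain x where x: "?X = ennreal x" "x \<ge> 0" by (cases ?X) auto
      have "x \<le> s powr (r / p)" using X x by simp
      then have "x powr (1 / r) \<le> (s powr (r / p)) powr (1 / r)"
        using x r by (intro powr_mono2) auto
      also have "\<dots> = s powr (1 / p)" using r by (simp add: powr_powr)
      finally show ?thesis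
        unfolding norm_s x(1) using x(2) by (simp add: ennreal_powr_def ennreal_leI)
    qed
    moreover have "g \<in> weighted_Lq p q"
      unfolding r(1) using 2 r le_less_trans[OF X ennreal_less_top] by (intro weighted_Lq_finite) auto
    ultimately show ?thesis
      using rep[OF G(2,3)] fin 2 unfolding er by (intro bexI[of _ g]) (auto simp: g_def[abs_def])
  qed
qed

end
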